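(* Let $G_o=\langle V_o,E_o\rangle$ be a simple, finite, connected graph with $N$ vertices and largest vertex degree $\delta$. Let $X_t$ ($t\ge 0$) be the continuous-time delayed random walk on $G_o$ with $X_0$ uniformly distributed on $V_o$, and let $\beta_2$ be the second-largest eigenvalue of its transition matrix $P$. Then for every $k\in\{1,\dots,N-2\}$ and $t>0$: (i) $\displaystyle \mathbb{P}[X_t=X_0]\le \frac1N+\delta\frac{k}{N}e^{-t(1-\beta_2)}+\sqrt{\frac{\pi}{32}}\,\frac{\delta\sqrt{\delta+2}}{\sqrt t}\exp\Big(-\frac{32tk^2}{(\delta+2)\delta^2N^2}\Big)$; (ii) $\displaystyle \mathbb{P}[X_t=X_0]\le \frac1N+\delta\frac{k}{N}e^{-t(1-\beta_2)}+\frac{\delta^2(\delta+2)}{16t}\,\frac{N}{k}\exp\Big(-\frac{32tk^2}{(\delta+2)\delta^2N^2}\Big)$. (iii) If in addition $G_o$ is planar and $N>288$, then $\displaystyle \mathbb{P}[X_t=X_0]\ge \frac1N+\frac{\exp(-tK/\sqrt N)}{N}$ with $K=12\sqrt2\,\delta$.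
   Context: For a finite simple graph $G_o=\langle V_o,E_o\rangle$ with maximal degree $\delta=\max_v \deg(v)$, the delayed random walk has transition matrix $P$ with $P_{vw}=1/\delta$ if $\{v,w\}\in E_o$, $P_{vv}=1-\deg(v)/\delta$, and $P_{vw}=0$ otherwise. The continuous-time delayed random walk is the Markov process on $V_o$ with $\mathbb{P}[X_t=w\mid X_0=v]=(e^{-t(I-P)})_{vw}$. With uniform initial distribution, $\mathbb{P}[X_t=X_0]=\frac{1}{|V_o|}\mathrm{Tr}\,e^{-t(I-P)}$. The eigenvalues of $P$ are real and ordered $1=\beta_1\ge\beta_2\ge\dots\ge\beta_N$. *)

theory Defs
  imports "HOL-Analysis.Analysis" "Jordan_Normal_Form.Matrix" "Jordan_Normal_Form.Char_Poly"
    "HOL-Computational_Algebra.Polynomial"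
begin

definition simple_graph :: "nat \<Rightarrow> (nat \<Rightarrow> nat \<Rightarrow> bool) \<Rightarrow> bool" where
  "simple_graph N E \<longleftrightarrow> (\<forall>v w. E v w \<longrightarrow> v < N \<and> w < N) \<and> (\<forall>v w. E v w \<longrightarrow> E w v)
     \<and> (\<forall>v. \<not> E v v)"

definition connected_graph :: "nat \<Rightarrow> (nat \<Rightarrow> nat \<Rightarrow> bool) \<Rightarrow> bool" where
  "connected_graph N E \<longleftrightarrow> (\<forall>v<N. \<forall>w<N. E\<^sup>*\<^sup>* v w)"

definition gdeg :: "nat \<Rightarrow> (nat \<Rightarrow> nat \<Rightarrow> bool) \<Rightarrow> nat \<Rightarrow> nat" where
  "gdeg N E v = card {w. w < N \<and> E v w}"

definition max_deg :: "nat \<Rightarrow> (nat \<Rightarrow> nat \<Rightarrow> bool) \<Rightarrow> nat" where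
  "max_deg N E = Max (gdeg N E ` {..<N})"

definition delayed_P :: "nat \<Rightarrow> (nat \<Rightarrow> nat \<Rightarrow> bool) \<Rightarrow> real mat" where
  "delayed_P N E = mat N N (\<lambda>(v,w).
      if E v w then 1 / real (max_deg N E)
      else if v = w then 1 - real (gdeg N E v) / real (max_deg N E) else 0)"

definition mat_exp :: "real mat \<Rightarrow> real mat" where
  "mat_exp A = mat (dim_row A) (dim_col A) (\<lambda>(i,j). \<Sum>n. (A ^\<^sub>m n) $$ (i,j) / fact n)"

definition mat_trace :: "real mat \<Rightarrow> real" where
  "mat_trace A = (\<Sum>i<dim_row A. A $$ (i,i))"

text \<open>P[X_t = X_0] for the continuous-time delayed random walk started uniformly:
  (1/N) Tr exp(-t(I-P)).\<close>
definition return_prob :: "nat \<Rightarrow> (nat \<Rightarrow> nat \<Rightarrow> bool) \<Rightarrow> real \<Rightarrow> real" where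
  "return_prob N E t = (1 / real N) *
     mat_trace (mat_exp ((- t) \<cdot>\<^sub>m (1\<^sub>m N - delayed_P N E)))"

definition eigs_desc :: "real mat \<Rightarrow> real list" where
  "eigs_desc A = rev (sorted_list_of_multiset (proots (char_poly A)))"

definition beta :: "nat \<Rightarrow> (nat \<Rightarrow> nat \<Rightarrow> bool) \<Rightarrow> nat \<Rightarrow> real" where
  "beta N E i = eigs_desc (delayed_P N E) ! (i - 1)"

definition planar_graph :: "nat \<Rightarrow> (nat \<Rightarrow> nat \<Rightarrow> bool) \<Rightarrow> bool" where
  "planar_graph N E \<longleftrightarrow> (\<exists>(f :: nat \<Rightarrow> complex) (\<gamma> :: nat \<Rightarrow> nat \<Rightarrow> real \<Rightarrow> complex).
     inj_on f {..<N} \<and>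
     (\<forall>v w. E v w \<and> v < w \<longrightarrow> arc (\<gamma> v w) \<and> pathstart (\<gamma> v w) = f v \<and>
         pathfinish (\<gamma> v w) = f w \<and> path_image (\<gamma> v w) \<inter> f ` {..<N} = {f v, f w}) \<and>
     (\<forall>v w v' w'. E v w \<and> v < w \<and> E v' w' \<and> v' < w' \<and> (v, w) \<noteq> (v', w') \<longrightarrow>
         path_image (\<gamma> v w) \<inter> path_image (\<gamma> v' w') \<subseteq> f ` ({v, w} \<inter> {v', w'})))"

end

theory Submission
  imports Defs "Jordan_Normal_Form.Schur_Decomposition" "HOL-Probability.Distributions"
begin

text \<open>Write \<open>1 = \<mu>\<^sub>0 \<ge> \<mu>\<^sub>1 \<ge> \<dots>\<close> for the eigenvalues of \<open>P\<close>, so that the return probability is the mean of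
  \<open>exp (- t (1 - \<mu>\<^sub>j))\<close>.

  Upper bounds: a spanning tree can be cut at \<open>j\<close> vertices so that every function vanishing there
  satisfies a Poincare inequality with constant \<open>(N div j)\<^sup>2\<close>, independently of the degree.  By the
  variational principle \<open>1 - \<mu>\<^sub>j \<ge> j\<^sup>2 / (\<delta> N\<^sup>2)\<close>; the terms with \<open>0 < j \<le> \<delta> k\<close> are estimated by
  \<open>\<mu>\<^sub>1\<close> and the remaining ones by a Gaussian tail.

  Lower bound: it suffices that \<open>1 - \<mu>\<^sub>1 \<le> 12 sqrt 2 \<delta> / sqrt N\<close>.  This is elementary unless
  \<open>N > 288 \<delta>\<^sup>2\<close>.  In that case, the Jordan curve theorem excludes a drawing of \<open>K\<^bsub>3,3\<^esub>\<close>, hence a \<open>K\<^sub>6\<close>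
  minor of a planar graph, and the argument of Alon, Seymour and Thomas yields a balanced separation
  by \<open>O(sqrt N)\<close> vertices; the indicator of the side with the smaller boundary is the test function.\<close>

unbundle no vec_syntax

section \<open>Eigenbases of real symmetric matrices\<close>

text \<open>Delaying the walk makes P symmetric: I - P is the graph Laplacian divided by \<delta>,
  so all eigenvalue questions concern one quadratic form. The obstacle in the upper bounds is that
  cutting a tree into connected pieces of comparable size costs a factor of the degree. Here the
  pieces may be arbitrarily large: the small subtrees hanging at a vertex are compared with that
  vertex one by one, each through its own edges, so no degree enters. The resulting bounds imply the
  stated ones because N >= 3 and connectedness force \<delta> >= 2. In the lower bound the degree
  cancels as well: a separator S gives 1 - \<mu>_1 <= 25 |S| / (8 N), roughly 27 / sqrt N, while the
  target is at least 24 sqrt 2 / sqrt N > 33 / sqrt N. This slack allows excluding only K_6, at the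
  price of a larger separator. K_6 is convenient because it contains K_{3,3}, all of whose vertices
  have degree 3; a minor of such a graph already contains a subdivision of it, and this can be drawn
  as nine arcs.\<close>

lemma homogeneous_system_nontrivial:
  fixes a :: "'j \<Rightarrow> 'i \<Rightarrow> real"
  assumes "finite J" "finite I" "card J < card I"
  shows "\<exists>c. (\<exists>i\<in>I. c i \<noteq> 0) \<and> (\<forall>j\<in>J. (\<Sum>i\<in>I. a j i * c i) = 0)"
  using assms
proof (induction J arbitrary: I a rule: finite_induct)
  case empty
  then have "I \<noteq> {}" by auto
  then show ?case by (intro exI[of _ "\<lambda>_. 1"]) auto
next
  case (insert j J)
  show ?case
  proof (cases "\<forall>i\<in>I. a j i = 0")
    case True
    have "card J < card I" using insert by simp
    from insert.IH[OF insert.prems(1) this, of a] True show ?thesis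
      by auto
  next
    case False
    then obtain p where p: "p \<in> I" "a j p \<noteq> 0" by auto
    define I' where "I' = I - {p}"
    have fI: "finite I'" "card J < card I'"
      using insert p by (auto simp: I'_def)
    \<comment> \<open>Gaussian elimination with pivot \<open>a j p\<close>: the smaller system no
      longer contains the unknown \<open>p\<close>, which \<open>d\<close> then recovers from
      equation \<open>j\<close>.\<close>
    obtain c where c: "\<exists>i\<in>I'. c i \<noteq> 0"
      "\<forall>j'\<in>J. (\<Sum>i\<in>I'. (a j' i - a j' p * a j i / a j p) * c i) = 0"
      using insert.IH[OF fI, of "\<lambda>j' i. a j' i - a j' p * a j i / a j p"] by auto
    define S where "S = (\<Sum>i\<in>I'. a j i * c i)"
    define d where "d = c(p := - S / a j p)"
    have split: "(\<Sum>i\<in>I. b i * d i) = b p * d p + (\<Sum>i\<in>I'. b i * c i)" for b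
    proof -
      have "(\<Sum>i\<in>I. b i * d i) = b p * d p + (\<Sum>i\<in>I'. b i * d i)"
        unfolding I'_def using p insert.prems by (simp add: sum.remove)
      also have "(\<Sum>i\<in>I'. b i * d i) = (\<Sum>i\<in>I'. b i * c i)"
        by (rule sum.cong) (auto simp: I'_def d_def)
      finally show ?thesis .
    qed
    have "(\<Sum>i\<in>I. a j i * d i) = 0"
      unfolding split using p by (simp add: d_def S_def)
    moreover have "(\<Sum>i\<in>I. a j' i * d i) = 0" if "j' \<in> J" for j'
    proof -
      have "(\<Sum>i\<in>I'. a j' i * c i) - (a j' p / a j p) * S = 0"
        using c(2) that unfolding S_def sum_distrib_left sum_subtractf[symmetric]
        by (auto simp: algebra_simps)
      then show ?thesis unfolding split by (simp add: d_def)
    qed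
    moreover have "\<exists>i\<in>I. d i \<noteq> 0"
      using c(1) by (auto simp: I'_def d_def)
    ultimately show ?thesis by blast
  qed
qed

lemma index_mult_mat_sum:
  assumes "A \<in> carrier_mat n m" "B \<in> carrier_mat m l" "i < n" "j < l"
  shows "(A * B) $$ (i,j) = (\<Sum>k<m. A $$ (i,k) * B $$ (k,j))"
  using assms by (auto simp: scalar_prod_def atLeast0LessThan intro!: sum.cong)

lemma index_mult_mat_vec_sum:
  assumes "A \<in> carrier_mat n m" "v \<in> carrier_vec m" "i < n"
  shows "(A *\<^sub>v v) $ i = (\<Sum>k<m. A $$ (i,k) * v $ k)"
  using assms by (auto simp: scalar_prod_def atLeast0LessThan intro!: sum.cong)

lemma trace_mult_commute:
  fixes A B :: "'a :: comm_ring_1 mat"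
  assumes "A \<in> carrier_mat n n" "B \<in> carrier_mat n n"
  shows "(\<Sum>i<n. (A * B) $$ (i,i)) = (\<Sum>i<n. (B * A) $$ (i,i))"
proof -
  have "(\<Sum>i<n. (A * B) $$ (i,i)) = (\<Sum>i<n. \<Sum>k<n. A $$ (i,k) * B $$ (k,i))"
    using assms by (intro sum.cong refl index_mult_mat_sum) auto
  also have "\<dots> = (\<Sum>k<n. \<Sum>i<n. B $$ (k,i) * A $$ (i,k))"
    by (subst sum.swap) (simp add: mult.commute)
  also have "\<dots> = (\<Sum>i<n. (B * A) $$ (i,i))"
    using assms by (intro sum.cong refl index_mult_mat_sum[symmetric]) auto
  finally show ?thesis .
qed

text \<open>The Hermitian form \<open>q\<close> of an eigenvector equals \<open>k\<close> times its
  squared norm \<open>s\<close>, and symmetry makes it its own conjugate.\<close>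

lemma symmetric_mat_eigenvalue_real:
  fixes A :: "real mat"
  assumes A: "A \<in> carrier_mat n n" and sym: "\<And>i j. i < n \<Longrightarrow> j < n \<Longrightarrow> A $$ (i,j) = A $$ (j,i)"
    and ev: "eigenvalue (map_mat complex_of_real A) k"
  shows "k \<in> \<real>"
proof -
  let ?B = "map_mat complex_of_real A"
  have B: "?B \<in> carrier_mat n n" using A by auto
  obtain v where v: "v \<in> carrier_vec n" "v \<noteq> 0\<^sub>v n" "?B *\<^sub>v v = k \<cdot>\<^sub>v v"
    using ev A unfolding eigenvalue_def eigenvector_def by auto
  have row: "(\<Sum>j<n. complex_of_real (A $$ (i,j)) * v $ j) = k * v $ i" if "i < n" for i
  proof -
    have "(?B *\<^sub>v v) $ i = (\<Sum>j<n. ?B $$ (i,j) * v $ j)"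
      by (rule index_mult_mat_vec_sum[OF B v(1) that])
    also have "\<dots> = (\<Sum>j<n. complex_of_real (A $$ (i,j)) * v $ j)"
      using A that by (intro sum.cong) auto
    finally show ?thesis using v that by auto
  qed
  define q where "q = (\<Sum>i<n. \<Sum>j<n. cnj (v $ i) * (of_real (A $$ (i,j)) * v $ j))"
  define s where "s = (\<Sum>i<n. (cmod (v $ i))\<^sup>2)"
  have q1: "q = k * of_real s"
    unfolding q_def s_def sum_distrib_left[symmetric] of_real_sum
    using row by (simp add: sum_distrib_left complex_norm_square mult_ac del: of_real_power)
  have "cnj q = (\<Sum>i<n. \<Sum>j<n. v $ i * (of_real (A $$ (i,j)) * cnj (v $ j)))"
    unfolding q_def by simp
  also have "\<dots> = (\<Sum>j<n. \<Sum>i<n. v $ i * (of_real (A $$ (i,j)) * cnj (v $ j)))"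
    by (rule sum.swap)
  also have "\<dots> = q"
    unfolding q_def using sym by (intro sum.cong refl) (simp add: mult_ac)
  finally have qr: "q \<in> \<real>" by (simp add: Reals_cnj_iff)
  have "\<exists>i<n. v $ i \<noteq> 0"
    using v(1,2) by (metis carrier_vecD eq_vecI index_zero_vec(1) index_zero_vec(2))
  then have "s > 0" unfolding s_def by (auto intro!: sum_pos2)
  then have "k = q / of_real s" using q1 by simp
  then show ?thesis using qr by simp
qed

lemma real_eigenvector_of_complex:
  fixes A :: "real mat"
  assumes A: "A \<in> carrier_mat n n" and ev: "eigenvalue (map_mat complex_of_real A) (of_real x)"
  shows "eigenvalue A x"
proof -
  have "poly (char_poly (map_mat complex_of_real A)) (of_real x) = 0"
    using eigenvalue_root_char_poly[of "map_mat complex_of_real A" n] A ev by auto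
  then have "poly (map_poly complex_of_real (char_poly A)) (of_real x) = 0"
    by (simp add: of_real_hom.char_poly_hom[OF A])
  then have "complex_of_real (poly (char_poly A) x) = 0" by simp
  then show ?thesis using eigenvalue_root_char_poly[OF A] by auto
qed

text \<open>The trace of the square of a nonzero symmetric matrix is positive, so after
  triangularisation over the complex numbers some diagonal entry is nonzero.\<close>

lemma symmetric_mat_nonzero_eigenvalue:
  fixes A :: "real mat"
  assumes A: "A \<in> carrier_mat n n" and sym: "\<And>i j. i < n \<Longrightarrow> j < n \<Longrightarrow> A $$ (i,j) = A $$ (j,i)"
    and nz: "i0 < n" "j0 < n" "A $$ (i0,j0) \<noteq> 0"
  shows "\<exists>x. x \<noteq> 0 \<and> eigenvalue A x"
proof -
  let ?B = "map_mat complex_of_real A"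
  have B: "?B \<in> carrier_mat n n" using A by auto
  obtain es where es: "char_poly ?B = (\<Prod>a\<leftarrow>es. [:- a, 1:])"
    using char_poly_factorized[OF B] by auto
  obtain T where T: "T \<in> carrier_mat n n" "upper_triangular T" "similar_mat ?B T"
    using schur_decomposition_exists[OF B es] by auto
  obtain P Q where PQ: "similar_mat_wit ?B T P Q" using T(3) by (auto simp: similar_mat_def)
  note w = similar_mat_witD2[OF B PQ]
  have QP: "Q * (P * X) = X" if "X \<in> carrier_mat n n" for X
    using w that by (simp flip: assoc_mult_mat[of Q n n P n X n])
  have "?B * ?B = P * (T * T) * Q"
  proof -
    have "?B * ?B = P * (T * (Q * (P * (T * Q))))"
      using w by (simp add: assoc_mult_mat[of _ n n _ n _ n])
    also have "\<dots> = P * (T * T) * Q"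
      using w by (simp add: QP assoc_mult_mat[of _ n n _ n _ n])
    finally show ?thesis .
  qed
  then have "(\<Sum>i<n. (?B * ?B) $$ (i,i)) = (\<Sum>i<n. (P * (T * T * Q)) $$ (i,i))"
    using w by (simp add: assoc_mult_mat[of _ n n _ n _ n])
  also have "\<dots> = (\<Sum>i<n. (T * T * Q * P) $$ (i,i))"
    using w by (intro trace_mult_commute) auto
  also have "T * T * Q * P = T * T" using w by (simp add: assoc_mult_mat[of _ n n _ n _ n])
  also have "(\<Sum>i<n. (T * T) $$ (i,i)) = (\<Sum>i<n. T $$ (i,i) * T $$ (i,i))"
  proof (rule sum.cong[OF refl])
    fix i assume i: "i \<in> {..<n}"
    have "(T * T) $$ (i,i) = (\<Sum>k<n. T $$ (i,k) * T $$ (k,i))"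
      using i by (intro index_mult_mat_sum[OF T(1) T(1)]) auto
    also have "\<dots> = (\<Sum>k<n. if k = i then T $$ (i,i) * T $$ (i,i) else 0)"
    proof (intro sum.cong refl)
      fix k assume k: "k \<in> {..<n}"
      have u: "T $$ (a,b) = 0" if "b < a" "a < n" for a b
        using T(1,2) that unfolding upper_triangular_def by auto
      show "T $$ (i,k) * T $$ (k,i) = (if k = i then T $$ (i,i) * T $$ (i,i) else 0)"
        using i k u[of k i] u[of i k] by (cases k i rule: linorder_cases) auto
    qed
    finally show "(T * T) $$ (i,i) = T $$ (i,i) * T $$ (i,i)" using i by simp
  qed
  finally have tr: "(\<Sum>i<n. (?B * ?B) $$ (i,i)) = (\<Sum>i<n. T $$ (i,i) * T $$ (i,i))" .
  have "(\<Sum>i<n. (?B * ?B) $$ (i,i)) = (\<Sum>i<n. \<Sum>k<n. ?B $$ (i,k) * ?B $$ (k,i))"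
    by (intro sum.cong refl index_mult_mat_sum[OF B B]) auto
  also have "\<dots> = of_real (\<Sum>i<n. \<Sum>k<n. (A $$ (i,k))\<^sup>2)"
    unfolding of_real_sum using A sym by (intro sum.cong refl) (auto simp: power2_eq_square)
  finally have tr2: "(\<Sum>i<n. (?B * ?B) $$ (i,i)) = of_real (\<Sum>i<n. \<Sum>k<n. (A $$ (i,k))\<^sup>2)" .
  have "(\<Sum>i<n. \<Sum>k<n. (A $$ (i,k))\<^sup>2) > 0"
    using nz by (intro sum_pos2[of _ i0] sum_pos2[of _ j0] sum_nonneg) auto
  then have "complex_of_real (\<Sum>i<n. \<Sum>k<n. (A $$ (i,k))\<^sup>2) \<noteq> 0"
    by (simp only: of_real_eq_0_iff)
  then have "(\<Sum>i<n. T $$ (i,i) * T $$ (i,i)) \<noteq> 0" unfolding tr[symmetric] tr2 .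
  then obtain i where i: "i < n" "T $$ (i,i) \<noteq> 0"
    by (metis (no_types, lifting) lessThan_iff mult_zero_left sum.neutral)
  have "char_poly ?B = (\<Prod>a\<leftarrow>diag_mat T. [:- a, 1:])"
    using char_poly_similar[OF T(3)] char_poly_upper_triangular[OF T(1,2)] by simp
  moreover have "T $$ (i,i) \<in> set (diag_mat T)"
    using i T(1) by (auto simp: diag_mat_def)
  ultimately have "poly (char_poly ?B) (T $$ (i,i)) = 0"
    by (auto simp: poly_prod_list prod_list_zero_iff)
  then have ev: "eigenvalue ?B (T $$ (i,i))" using eigenvalue_root_char_poly[OF B] by auto
  have "T $$ (i,i) \<in> \<real>" by (rule symmetric_mat_eigenvalue_real[OF A sym ev])
  then obtain x where x: "T $$ (i,i) = of_real x" by (auto elim: Reals_cases)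
  then show ?thesis using ev i real_eigenvector_of_complex[OF A] by auto
qed

text \<open>Deflation: \<open>D\<close> is A minus the spectral part already found, so it
  annihilates every \<open>u a\<close>. An eigenvector of the symmetric \<open>D\<close> for a
  nonzero eigenvalue is therefore orthogonal to all \<open>u a\<close>, and on such vectors
  \<open>D\<close> and A agree. If \<open>D\<close> is zero, A kills every vector orthogonal to the
  family, and one exists by counting unknowns.\<close>

lemma symmetric_mat_extend_eigenbasis:
  fixes A :: "real mat" and u :: "nat \<Rightarrow> nat \<Rightarrow> real"
  assumes A: "A \<in> carrier_mat n n" and sym: "\<And>i j. i < n \<Longrightarrow> j < n \<Longrightarrow> A $$ (i,j) = A $$ (j,i)"
    and m: "m < n"
    and orth: "\<And>a b. a < m \<Longrightarrow> b < m \<Longrightarrow> (\<Sum>i<n. u a i * u b i) = (if a = b then 1 else 0)"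
    and eig: "\<And>a i. a < m \<Longrightarrow> i < n \<Longrightarrow> (\<Sum>k<n. A $$ (i,k) * u a k) = \<mu> a * u a i"
  shows "\<exists>w c. (\<Sum>i<n. w i * w i) = 1 \<and> (\<forall>a<m. (\<Sum>i<n. u a i * w i) = 0)
    \<and> (\<forall>i<n. (\<Sum>k<n. A $$ (i,k) * w k) = c * w i)"
proof -
  have normalise: ?thesis
    if w: "\<exists>i<n. w i \<noteq> 0" "\<forall>a<m. (\<Sum>i<n. u a i * w i) = 0"
      "\<forall>i<n. (\<Sum>k<n. A $$ (i,k) * w k) = c * w i" for w c
  proof -
    define s where "s = sqrt (\<Sum>i<n. w i * w i)"
    have "(\<Sum>i<n. w i * w i) > 0" using w(1) by (auto intro!: sum_pos2 simp: zero_less_mult_iff)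
    then have s: "s > 0" "s * s = (\<Sum>i<n. w i * w i)" unfolding s_def by auto
    have "(\<Sum>i<n. (w i / s) * (w i / s)) = (\<Sum>i<n. w i * w i) / (s * s)"
      unfolding sum_divide_distrib by (intro sum.cong) auto
    moreover have "(\<Sum>i<n. u a i * (w i / s)) = (\<Sum>i<n. u a i * w i) / s" for a
      unfolding sum_divide_distrib by (intro sum.cong) auto
    moreover have "(\<Sum>k<n. A $$ (i,k) * (w k / s)) = (\<Sum>k<n. A $$ (i,k) * w k) / s" for i
      unfolding sum_divide_distrib by (intro sum.cong) auto
    ultimately show ?thesis using w s by (intro exI[of _ "\<lambda>i. w i / s"] exI[of _ c]) auto
  qed
  define D where "D = mat n n (\<lambda>(i,j). A $$ (i,j) - (\<Sum>a<m. \<mu> a * u a i * u a j))"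
  have D: "D \<in> carrier_mat n n" by (simp add: D_def)
  have symD: "D $$ (i,j) = D $$ (j,i)" if "i < n" "j < n" for i j
    using that sym by (simp add: D_def mult_ac)
  have AD: "(\<Sum>k<n. A $$ (i,k) * x k) =
      (\<Sum>k<n. D $$ (i,k) * x k) + (\<Sum>a<m. \<mu> a * u a i * (\<Sum>k<n. u a k * x k))" if "i < n" for i x
  proof -
    have "(\<Sum>a<m. \<mu> a * u a i * (\<Sum>k<n. u a k * x k)) = (\<Sum>k<n. (\<Sum>a<m. \<mu> a * u a i * u a k) * x k)"
      unfolding sum_distrib_left sum_distrib_right by (subst sum.swap) (simp add: mult_ac)
    then show ?thesis
      unfolding sum.distrib[symmetric] using that by (simp add: D_def algebra_simps sum.distrib sum_subtractf)
  qed
  show ?thesis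
  proof (cases "\<forall>i<n. \<forall>j<n. D $$ (i,j) = 0")
    case True
    obtain w where w: "\<exists>i<n. w i \<noteq> 0" "\<forall>a<m. (\<Sum>i<n. u a i * w i) = 0"
      using homogeneous_system_nontrivial[of "{..<m}" "{..<n}" u] m by auto
    have "\<forall>i<n. (\<Sum>k<n. A $$ (i,k) * w k) = 0 * w i"
      using AD[of _ w] True w(2) by auto
    from normalise[OF w this] show ?thesis .
  next
    case False
    then obtain i0 j0 where ij: "i0 < n" "j0 < n" "D $$ (i0,j0) \<noteq> 0" by auto
    obtain x where x: "x \<noteq> 0" "eigenvalue D x"
      using symmetric_mat_nonzero_eigenvalue[OF D symD ij] by auto
    obtain v where v: "v \<in> carrier_vec n" "v \<noteq> 0\<^sub>v n" "D *\<^sub>v v = x \<cdot>\<^sub>v v"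
      using x(2) D unfolding eigenvalue_def eigenvector_def by auto
    have Dv: "(\<Sum>k<n. D $$ (i,k) * v $ k) = x * v $ i" if "i < n" for i
      using index_mult_mat_vec_sum[OF D v(1) that] v that by auto
    have Du: "(\<Sum>k<n. D $$ (i,k) * u b k) = 0" if "i < n" "b < m" for i b
    proof -
      have "(\<Sum>a<m. \<mu> a * u a i * (\<Sum>k<n. u a k * u b k)) = (\<Sum>a<m. if a = b then \<mu> b * u b i else 0)"
        using orth that by (intro sum.cong) auto
      then show ?thesis using AD[OF that(1), of "u b"] eig that by simp
    qed
    have orthv: "(\<Sum>i<n. u b i * v $ i) = 0" if "b < m" for b
    proof -
      have "x * (\<Sum>i<n. u b i * v $ i) = (\<Sum>i<n. u b i * (\<Sum>k<n. D $$ (i,k) * v $ k))"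
        using Dv by (simp add: sum_distrib_left mult_ac)
      also have "\<dots> = (\<Sum>k<n. v $ k * (\<Sum>i<n. D $$ (k,i) * u b i))"
        unfolding sum_distrib_left
        by (subst sum.swap) (intro sum.cong refl, simp add: symD mult_ac)
      also have "\<dots> = 0" using Du that by simp
      finally show ?thesis using x by simp
    qed
    have "\<exists>i<n. v $ i \<noteq> 0"
      using v(1,2) by (metis carrier_vecD eq_vecI index_zero_vec(1) index_zero_vec(2))
    moreover have "\<forall>i<n. (\<Sum>k<n. A $$ (i,k) * v $ k) = x * v $ i"
      using AD[of _ "\<lambda>k. v $ k"] orthv Dv by simp
    ultimately show ?thesis using orthv by (intro normalise[of "\<lambda>k. v $ k" x]) auto
  qed
qed

lemma symmetric_mat_eigenbasis:
  fixes A :: "real mat"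
  assumes A: "A \<in> carrier_mat n n" and sym: "\<And>i j. i < n \<Longrightarrow> j < n \<Longrightarrow> A $$ (i,j) = A $$ (j,i)"
  shows "\<exists>u \<mu>. (\<forall>a<n. \<forall>b<n. (\<Sum>i<n. u a i * u b i) = (if a = b then 1 else (0::real)))
    \<and> (\<forall>a<n. \<forall>i<n. (\<Sum>k<n. A $$ (i,k) * u a k) = \<mu> a * u a i)"
proof -
  have "\<exists>u \<mu>. (\<forall>a<m. \<forall>b<m. (\<Sum>i<n. u a i * u b i) = (if a = b then 1 else (0::real)))
    \<and> (\<forall>a<m. \<forall>i<n. (\<Sum>k<n. A $$ (i,k) * u a k) = \<mu> a * u a i)" if "m \<le> n" for m
    using that
  proof (induction m)
    case (Suc m)
    then obtain u \<mu> where IH: "\<forall>a<m. \<forall>b<m. (\<Sum>i<n. u a i * u b i) = (if a = b then 1 else (0::real))"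
      "\<forall>a<m. \<forall>i<n. (\<Sum>k<n. A $$ (i,k) * u a k) = \<mu> a * u a i" by auto
    obtain w c where w: "(\<Sum>i<n. w i * w i) = 1" "\<forall>a<m. (\<Sum>i<n. u a i * w i) = 0"
      "\<forall>i<n. (\<Sum>k<n. A $$ (i,k) * w k) = c * w i"
      using symmetric_mat_extend_eigenbasis[OF A sym, of m u \<mu>] IH Suc.prems by auto
    have w2: "\<forall>a<m. (\<Sum>i<n. w i * u a i) = 0" using w(2) by (simp add: mult.commute)
    show ?case
      using IH w w2 by (intro exI[of _ "u(m := w)"] exI[of _ "\<mu>(m := c)"]) (auto simp: less_Suc_eq)
  qed auto
  then show ?thesis by blast
qed

text \<open>A one-sided inverse of a square matrix is two-sided. In this form it is the completeness
  relation behind Parseval's identity.\<close>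

lemma orthonormal_rows_imp_columns:
  fixes u :: "nat \<Rightarrow> nat \<Rightarrow> real"
  assumes "\<And>a b. a < n \<Longrightarrow> b < n \<Longrightarrow> (\<Sum>i<n. u a i * u b i) = (if a = b then 1 else 0)"
    and "i < n" "j < n"
  shows "(\<Sum>a<n. u a i * u a j) = (if i = j then 1 else 0)"
proof -
  define U where "U = mat n n (\<lambda>(a,i). u a i)"
  define V where "V = mat n n (\<lambda>(i,a). u a i)"
  have UV: "U \<in> carrier_mat n n" "V \<in> carrier_mat n n" by (auto simp: U_def V_def)
  have "U * V = 1\<^sub>m n"
  proof (rule eq_matI)
    fix a b assume "a < dim_row (1\<^sub>m n)" "b < dim_col (1\<^sub>m n)"
    then have ab: "a < n" "b < n" by auto
    show "(U * V) $$ (a,b) = 1\<^sub>m n $$ (a,b)"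
      unfolding index_mult_mat_sum[OF UV ab] using ab assms(1) by (simp add: U_def V_def)
  qed (use UV in auto)
  then have "V * U = 1\<^sub>m n" by (rule mat_mult_left_right_inverse[OF UV])
  then have "(V * U) $$ (i,j) = (if i = j then 1 else 0)" using assms by simp
  then show ?thesis
    unfolding index_mult_mat_sum[OF UV(2,1) assms(2,3)] using assms by (simp add: U_def V_def)
qed

text \<open>Links the analytic and the algebraic side: \<open>eigs_desc\<close> is read off the
  characteristic polynomial with multiplicities, and the basis makes A similar to a diagonal
  matrix.\<close>

lemma proots_eigenbasis:
  fixes A :: "real mat"
  assumes A: "A \<in> carrier_mat n n"
    and orth: "\<And>a b. a < n \<Longrightarrow> b < n \<Longrightarrow> (\<Sum>i<n. u a i * u b i) = (if a = b then 1 else (0::real))"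
    and eig: "\<And>a i. a < n \<Longrightarrow> i < n \<Longrightarrow> (\<Sum>k<n. A $$ (i,k) * u a k) = \<mu> a * u a i"
  shows "proots (char_poly A) = mset (map \<mu> [0..<n])"
proof -
  define U where "U = mat n n (\<lambda>(i,a). u a i)"
  define V where "V = mat n n (\<lambda>(a,i). u a i)"
  define D where "D = mat n n (\<lambda>(a,b). if a = b then \<mu> a else 0)"
  have c: "U \<in> carrier_mat n n" "V \<in> carrier_mat n n" "D \<in> carrier_mat n n"
    by (auto simp: U_def V_def D_def)
  have UV: "U * V = 1\<^sub>m n"
  proof (rule eq_matI)
    fix a b assume "a < dim_row (1\<^sub>m n)" "b < dim_col (1\<^sub>m n)"
    then have ab: "a < n" "b < n" by auto
    show "(U * V) $$ (a,b) = 1\<^sub>m n $$ (a,b)"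
      unfolding index_mult_mat_sum[OF c(1,2) ab]
      using ab orthonormal_rows_imp_columns[OF orth, where i = a and j = b] by (simp add: U_def V_def)
  qed (use c in auto)
  have VU: "V * U = 1\<^sub>m n" by (rule mat_mult_left_right_inverse[OF c(1,2) UV])
  have AU: "A * U = U * D"
  proof (rule eq_matI)
    fix i a assume "i < dim_row (U * D)" "a < dim_col (U * D)"
    then have ia: "i < n" "a < n" using c by auto
    have "(\<Sum>k<n. U $$ (i,k) * D $$ (k,a)) = (\<Sum>k<n. if k = a then U $$ (i,a) * \<mu> a else 0)"
      using ia by (intro sum.cong) (auto simp: D_def)
    then show "(A * U) $$ (i,a) = (U * D) $$ (i,a)"
      unfolding index_mult_mat_sum[OF A c(1) ia] index_mult_mat_sum[OF c(1,3) ia]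
      using ia eig by (simp add: U_def mult_ac)
  qed (use c A in auto)
  have "U * D * V = A * (U * V)" using AU A c by (simp flip: AU)
  then have "A = U * D * V" using UV A by simp
  then have "similar_mat A D"
    using A c UV VU unfolding similar_mat_def similar_mat_wit_def Let_def
    by (intro exI[of _ U] exI[of _ V]) auto
  moreover have "upper_triangular D" by (auto simp: D_def upper_triangular_def)
  ultimately have "char_poly A = (\<Prod>a\<leftarrow>diag_mat D. [:- a, 1:])"
    using char_poly_similar char_poly_upper_triangular[OF c(3)] by metis
  also have "diag_mat D = map \<mu> [0..<n]" by (auto simp: diag_mat_def D_def)
  finally have *: "char_poly A = (\<Prod>a\<leftarrow>map \<mu> [0..<n]. [:- a, 1:])" .
  have "proots (\<Prod>a\<leftarrow>xs. [:- a, 1:]) = mset xs" for xs :: "real list"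
  proof (induction xs)
    case (Cons x xs)
    have "(\<Prod>a\<leftarrow>xs. [:- a, 1:]) \<noteq> 0" by (auto simp: prod_list_zero_iff)
    then show ?case using Cons by (simp add: proots_mult del: mult_pCons_left)
  qed auto
  then show ?thesis using * by metis
qed

text \<open>Allows the eigenvectors to be renumbered so that their order matches the descending list
  of eigenvalues.\<close>

lemma mset_eq_map_imp_bij:
  fixes g :: "nat \<Rightarrow> 'a" and xs :: "'a list"
  assumes "mset (map g [0..<n]) = mset xs"
  shows "\<exists>p. bij_betw p {..<n} {..<n} \<and> (\<forall>i<n. xs ! i = g (p i))"
proof -
  obtain p where p: "p permutes {..<length xs}" "permute_list p xs = map g [0..<n]"
    using assms mset_eq_permutation by metis
  have len: "length xs = n" using assms by (metis length_map length_upt minus_nat.diff_0 size_mset)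
  have q: "bij_betw (inv_into UNIV p) {..<n} {..<n}"
    using p(1) len by (simp add: permutes_imp_bij permutes_inv)
  have "xs ! i = g (inv_into UNIV p i)" if "i < n" for i
  proof -
    have "inv_into UNIV p i < n" using q that by (auto simp: bij_betw_def)
    then have "permute_list p xs ! inv_into UNIV p i = g (inv_into UNIV p i)" using p(2) by simp
    moreover have "permute_list p xs ! inv_into UNIV p i = xs ! i"
      using p(1) len \<open>inv_into UNIV p i < n\<close> by (simp add: permute_list_nth permutes_inverses)
    ultimately show ?thesis by simp
  qed
  then show ?thesis using q by blast
qed

theorem symmetric_mat_sorted_eigenbasis:
  fixes A :: "real mat"
  assumes A: "A \<in> carrier_mat n n" and sym: "\<And>i j. i < n \<Longrightarrow> j < n \<Longrightarrow> A $$ (i,j) = A $$ (j,i)"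
  obtains u where
    "length (eigs_desc A) = n"
    "\<And>a b. a \<le> b \<Longrightarrow> b < n \<Longrightarrow> eigs_desc A ! b \<le> eigs_desc A ! a"
    "\<And>a b. a < n \<Longrightarrow> b < n \<Longrightarrow> (\<Sum>i<n. u a i * u b i) = (if a = b then 1 else (0::real))"
    "\<And>a i. a < n \<Longrightarrow> i < n \<Longrightarrow> (\<Sum>k<n. A $$ (i,k) * u a k) = eigs_desc A ! a * u a i"
proof -
  obtain u \<mu> where *: "\<forall>a<n. \<forall>b<n. (\<Sum>i<n. u a i * u b i) = (if a = b then 1 else (0::real))"
    "\<forall>a<n. \<forall>i<n. (\<Sum>k<n. A $$ (i,k) * u a k) = \<mu> a * u a i"
    using symmetric_mat_eigenbasis[OF A] sym by blast
  have u: "(\<Sum>i<n. u a i * u b i) = (if a = b then 1 else 0)" if "a < n" "b < n" for a b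
    using *(1) that by blast
  have u': "(\<Sum>k<n. A $$ (i,k) * u a k) = \<mu> a * u a i" if "a < n" "i < n" for a i
    using *(2) that by blast
  have ms: "mset (map \<mu> [0..<n]) = mset (eigs_desc A)"
    using proots_eigenbasis[OF A u u'] by (simp add: eigs_desc_def)
  then have len: "length (eigs_desc A) = n"
    by (metis length_map length_upt minus_nat.diff_0 size_mset)
  have srt: "eigs_desc A ! b \<le> eigs_desc A ! a" if "a \<le> b" "b < n" for a b
  proof -
    have "sorted (rev (eigs_desc A))" by (simp add: eigs_desc_def)
    then show ?thesis using that len by (simp add: sorted_rev_iff_nth_mono)
  qed
  obtain \<rho> where \<rho>: "bij_betw \<rho> {..<n} {..<n}" "\<forall>i<n. eigs_desc A ! i = \<mu> (\<rho> i)"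
    using mset_eq_map_imp_bij[OF ms] by auto
  have \<rho>n: "\<rho> a < n" if "a < n" for a using \<rho>(1) that by (auto simp: bij_betw_def)
  have \<rho>i: "\<rho> a = \<rho> b \<longleftrightarrow> a = b" if "a < n" "b < n" for a b
    using \<rho>(1) that by (auto simp: bij_betw_def inj_on_def)
  show ?thesis
    by (rule that[of "u \<circ> \<rho>", OF len srt]) (use u u' \<rho>n \<rho>i \<rho>(2) in auto)
qed

section \<open>The Dirichlet form of the delayed random walk\<close>

lemma eigenbasis_pow_mat:
  fixes A :: "real mat"
  assumes A: "A \<in> carrier_mat n n"
    and orth: "\<And>a b. a < n \<Longrightarrow> b < n \<Longrightarrow> (\<Sum>i<n. u a i * u b i) = (if a = b then 1 else (0::real))"
    and eig: "\<And>a i. a < n \<Longrightarrow> i < n \<Longrightarrow> (\<Sum>k<n. A $$ (i,k) * u a k) = \<mu> a * u a i"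
    and ij: "i < n" "j < n"
  shows "(A ^\<^sub>m p) $$ (i,j) = (\<Sum>a<n. \<mu> a ^ p * u a i * u a j)"
  using ij
proof (induction p arbitrary: i j)
  case 0
  then show ?case using A orthonormal_rows_imp_columns[OF orth, where i = i and j = j] by simp
next
  case (Suc p)
  have Ap: "A ^\<^sub>m p \<in> carrier_mat n n" using A by simp
  have A2: "A $$ (k,j) = (\<Sum>a<n. u a j * (\<mu> a * u a k))" if "k < n" for k
  proof -
    have "(\<Sum>a<n. u a j * (\<mu> a * u a k)) = (\<Sum>a<n. u a j * (\<Sum>l<n. A $$ (k,l) * u a l))"
      using eig that by simp
    also have "\<dots> = (\<Sum>l<n. A $$ (k,l) * (\<Sum>a<n. u a l * u a j))"
      unfolding sum_distrib_left by (subst sum.swap) (simp add: mult_ac)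
    also have "\<dots> = (\<Sum>l<n. A $$ (k,l) * (if l = j then 1 else 0))"
      using orthonormal_rows_imp_columns[OF orth, where j = j] Suc.prems by simp
    also have "\<dots> = A $$ (k,j)" using Suc.prems by (simp add: if_distrib cong: if_cong)
    finally show ?thesis by simp
  qed
  have "(A ^\<^sub>m Suc p) $$ (i,j) = (\<Sum>k<n. (A ^\<^sub>m p) $$ (i,k) * A $$ (k,j))"
    using index_mult_mat_sum[OF Ap A Suc.prems] by simp
  also have "\<dots> = (\<Sum>k<n. (\<Sum>a<n. \<mu> a ^ p * u a i * u a k) * (\<Sum>b<n. u b j * (\<mu> b * u b k)))"
    using Suc.IH Suc.prems A2 by simp
  also have "\<dots> = (\<Sum>k<n. \<Sum>a<n. \<Sum>b<n. (\<mu> a ^ p * u a i) * (u b j * \<mu> b) * (u a k * u b k))"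
    by (simp only: sum_product) (simp add: mult_ac)
  also have "\<dots> = (\<Sum>a<n. \<Sum>k<n. \<Sum>b<n. (\<mu> a ^ p * u a i) * (u b j * \<mu> b) * (u a k * u b k))"
    by (rule sum.swap)
  also have "\<dots> = (\<Sum>a<n. \<Sum>b<n. (\<mu> a ^ p * u a i) * (u b j * \<mu> b) * (\<Sum>k<n. u a k * u b k))"
    unfolding sum_distrib_left by (intro sum.cong refl sum.swap)
  also have "\<dots> = (\<Sum>a<n. \<Sum>b<n. (\<mu> a ^ p * u a i) * (u b j * \<mu> b) * (if a = b then 1 else 0))"
    using orth by (intro sum.cong refl) simp
  also have "\<dots> = (\<Sum>a<n. \<mu> a ^ Suc p * u a i * u a j)"
    by (intro sum.cong refl) (simp add: if_distrib mult_ac cong: if_cong)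
  finally show ?case .
qed

lemma mat_trace_mat_exp:
  fixes A :: "real mat"
  assumes A: "A \<in> carrier_mat n n"
    and orth: "\<And>a b. a < n \<Longrightarrow> b < n \<Longrightarrow> (\<Sum>i<n. u a i * u b i) = (if a = b then 1 else (0::real))"
    and eig: "\<And>a i. a < n \<Longrightarrow> i < n \<Longrightarrow> (\<Sum>k<n. A $$ (i,k) * u a k) = \<mu> a * u a i"
  shows "mat_trace (mat_exp A) = (\<Sum>a<n. exp (\<mu> a))"
proof -
  have entry: "mat_exp A $$ (i,i) = (\<Sum>a<n. exp (\<mu> a) * (u a i * u a i))" if "i < n" for i
  proof -
    have "(\<lambda>p. \<mu> a ^ p /\<^sub>R fact p * (u a i * u a i)) sums (exp (\<mu> a) * (u a i * u a i))" for a
      by (intro sums_mult2 exp_converges)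
    then have "(\<lambda>p. \<Sum>a<n. \<mu> a ^ p /\<^sub>R fact p * (u a i * u a i)) sums (\<Sum>a<n. exp (\<mu> a) * (u a i * u a i))"
      by (intro sums_sum)
    moreover have "(\<Sum>a<n. \<mu> a ^ p /\<^sub>R fact p * (u a i * u a i)) = (A ^\<^sub>m p) $$ (i,i) / fact p" for p
      using eigenbasis_pow_mat[OF A orth eig that that, where p = p]
      by (simp add: sum_divide_distrib divide_inverse sum_distrib_left mult_ac)
    ultimately show ?thesis using A that by (simp add: mat_exp_def sums_iff)
  qed
  have "mat_trace (mat_exp A) = (\<Sum>i<n. \<Sum>a<n. exp (\<mu> a) * (u a i * u a i))"
    using A entry by (simp add: mat_trace_def mat_exp_def)
  also have "\<dots> = (\<Sum>a<n. exp (\<mu> a) * (\<Sum>i<n. u a i * u a i))"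
    unfolding sum_distrib_left by (rule sum.swap)
  also have "\<dots> = (\<Sum>a<n. exp (\<mu> a))" using orth by simp
  finally show ?thesis .
qed

section \<open>The quadratic form of I - P and its eigenvalues\<close>

text \<open>The factor 1/2 compensates for meeting each edge in both directions.\<close>

definition dirichlet :: "nat \<Rightarrow> (nat \<Rightarrow> nat \<Rightarrow> bool) \<Rightarrow> (nat \<Rightarrow> real) \<Rightarrow> real" where
  "dirichlet N E f = (\<Sum>v<N. \<Sum>w | w < N \<and> E v w. (f v - f w)\<^sup>2) / 2"

lemma dirichlet_nonneg: "dirichlet N E f \<ge> 0"
  by (simp add: dirichlet_def sum_nonneg)

lemma dirichlet_const [simp]: "dirichlet N E (\<lambda>_. c) = 0"
  by (simp add: dirichlet_def)

lemma dirichlet_diff_const [simp]: "dirichlet N E (\<lambda>v. f v - c) = dirichlet N E f"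
  by (simp add: dirichlet_def)

lemma delayed_P_carrier [simp]: "delayed_P N E \<in> carrier_mat N N"
  by (simp add: delayed_P_def)

lemma delayed_P_dims [simp]: "dim_row (delayed_P N E) = N" "dim_col (delayed_P N E) = N"
  by (simp_all add: delayed_P_def)

lemma delayed_P_symmetric:
  assumes "simple_graph N E" "i < N" "j < N"
  shows "delayed_P N E $$ (i,j) = delayed_P N E $$ (j,i)"
  using assms by (auto simp: delayed_P_def simple_graph_def)

lemma gdeg_le_max_deg: "v < N \<Longrightarrow> gdeg N E v \<le> max_deg N E"
  by (auto simp: max_deg_def)

lemma delayed_P_apply:
  assumes sg: "simple_graph N E" and d: "max_deg N E > 0" and i: "i < N"
  shows "f i - (\<Sum>k<N. delayed_P N E $$ (i,k) * f k)
    = (\<Sum>k | k < N \<and> E i k. f i - f k) / max_deg N E"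
proof -
  let ?d = "real (max_deg N E)"
  have "(\<Sum>k<N. delayed_P N E $$ (i,k) * f k)
      = (\<Sum>k<N. (if E i k then f k / ?d else 0) + (if k = i then (1 - gdeg N E i / ?d) * f i else 0))"
    using sg i by (intro sum.cong) (auto simp: delayed_P_def simple_graph_def)
  also have "\<dots> = (\<Sum>k | k < N \<and> E i k. f k / ?d) + (1 - gdeg N E i / ?d) * f i"
    using i by (simp add: sum.distrib flip: sum.inter_filter)
  also have "\<dots> = f i - ((\<Sum>k | k < N \<and> E i k. f i) - (\<Sum>k | k < N \<and> E i k. f k)) / ?d"
    using d by (simp add: gdeg_def field_simps flip: sum_divide_distrib)
  finally show ?thesis by (simp add: sum_subtractf)
qed

text \<open>Summation by parts for the Laplacian: by symmetry of adjacency the two square terms have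
  equal sums, which absorbs the factor 1/2 of the energy.\<close>

lemma dirichlet_eq:
  assumes sg: "simple_graph N E" and d: "max_deg N E > 0"
  shows "(\<Sum>i<N. f i * (f i - (\<Sum>k<N. delayed_P N E $$ (i,k) * f k))) = dirichlet N E f / max_deg N E"
proof -
  define e where "e i k = (if E i k then 1 else (0::real))" for i k
  have sumE: "(\<Sum>k | k < N \<and> E i k. g k) = (\<Sum>k<N. e i k * g k)" for i and g :: "nat \<Rightarrow> real"
    by (simp add: e_def if_distrib[of "\<lambda>x. x * _"] sum.If_cases Int_def cong: if_cong)
  have esym: "e i k = e k i" for i k using sg by (auto simp: simple_graph_def e_def)
  have sw: "(\<Sum>i<N. \<Sum>k<N. e i k * (f k * f k)) = (\<Sum>i<N. \<Sum>k<N. e i k * (f i * f i))"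
    by (subst sum.swap) (simp add: esym)
  have "(\<Sum>i<N. f i * (f i - (\<Sum>k<N. delayed_P N E $$ (i,k) * f k)))
      = (\<Sum>i<N. f i * (\<Sum>k<N. e i k * (f i - f k))) / max_deg N E"
    using delayed_P_apply[OF sg d] by (simp add: sumE flip: sum_divide_distrib)
  also have "(\<Sum>i<N. f i * (\<Sum>k<N. e i k * (f i - f k))) = dirichlet N E f"
    unfolding dirichlet_def sumE
    using sw by (simp add: sum_distrib_left power2_eq_square algebra_simps sum.distrib sum_subtractf)
  finally show ?thesis .
qed

text \<open>Positions in \<open>eigs_desc\<close> start at 0, so \<open>\<mu> 0\<close> is the top
  eigenvalue and \<open>\<mu> 1\<close> is the second-largest one, \<beta>_2.\<close>

locale walk_eigenbasis =
  fixes N :: nat and E :: "nat \<Rightarrow> nat \<Rightarrow> bool" and u :: "nat \<Rightarrow> nat \<Rightarrow> real"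
  assumes sg: "simple_graph N E" and dpos: "max_deg N E > 0"
    and desc: "\<And>a b. a \<le> b \<Longrightarrow> b < N \<Longrightarrow> eigs_desc (delayed_P N E) ! b \<le> eigs_desc (delayed_P N E) ! a"
    and orth: "\<And>a b. a < N \<Longrightarrow> b < N \<Longrightarrow> (\<Sum>i<N. u a i * u b i) = (if a = b then 1 else (0::real))"
    and eig: "\<And>a i. a < N \<Longrightarrow> i < N \<Longrightarrow>
      (\<Sum>k<N. delayed_P N E $$ (i,k) * u a k) = eigs_desc (delayed_P N E) ! a * u a i"
begin

abbreviation "\<mu> a \<equiv> eigs_desc (delayed_P N E) ! a"
abbreviation "\<delta> \<equiv> real (max_deg N E)"
definition "coef f a = (\<Sum>i<N. u a i * f i)"

lemma columns: "i < N \<Longrightarrow> j < N \<Longrightarrow> (\<Sum>a<N. u a i * u a j) = (if i = j then 1 else 0)"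
  by (rule orthonormal_rows_imp_columns[OF orth])

lemma return_prob_eq: "return_prob N E t = (\<Sum>a<N. exp (- t * (1 - \<mu> a))) / N"
proof -
  let ?M = "(- t) \<cdot>\<^sub>m (1\<^sub>m N - delayed_P N E)"
  have M: "?M \<in> carrier_mat N N"
    by (intro smult_carrier_mat minus_carrier_mat delayed_P_carrier)
  have "(\<Sum>k<N. ?M $$ (i,k) * u a k) = - t * (1 - \<mu> a) * u a i" if "a < N" "i < N" for a i
  proof -
    have "(\<Sum>k<N. ?M $$ (i,k) * u a k)
        = (\<Sum>k<N. - t * (if k = i then u a i else 0) + t * (delayed_P N E $$ (i,k) * u a k))"
      using that by (intro sum.cong) (auto simp: algebra_simps)
    also have "\<dots> = - t * u a i + t * (\<mu> a * u a i)"
      using that eig[OF that] by (simp add: sum.distrib sum_subtractf flip: sum_distrib_left)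
    finally show ?thesis by (simp add: algebra_simps)
  qed
  from mat_trace_mat_exp[OF M orth this] show ?thesis by (simp add: return_prob_def)
qed

lemma coef_expansion: "i < N \<Longrightarrow> (\<Sum>a<N. coef f a * u a i) = f i"
proof -
  assume i: "i < N"
  have "(\<Sum>a<N. coef f a * u a i) = (\<Sum>k<N. f k * (\<Sum>a<N. u a k * u a i))"
    unfolding coef_def sum_distrib_left sum_distrib_right by (subst sum.swap) (simp add: mult_ac)
  also have "\<dots> = (\<Sum>k<N. f k * (if k = i then 1 else 0))"
    using columns i by simp
  also have "\<dots> = f i" using i by (simp add: if_distrib cong: if_cong)
  finally show ?thesis .
qed

lemma inner_eq_coef: "(\<Sum>i<N. f i * g i) = (\<Sum>a<N. coef f a * coef g a)"
proof -
  have "(\<Sum>i<N. f i * g i) = (\<Sum>i<N. (\<Sum>a<N. coef f a * u a i) * g i)"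
    using coef_expansion by simp
  also have "\<dots> = (\<Sum>a<N. coef f a * (\<Sum>i<N. u a i * g i))"
    unfolding sum_distrib_left sum_distrib_right by (subst sum.swap) (simp add: mult_ac)
  finally show ?thesis by (simp add: coef_def)
qed

lemma dirichlet_spectral: "dirichlet N E f / \<delta> = (\<Sum>a<N. (1 - \<mu> a) * (coef f a)\<^sup>2)"
proof -
  have "coef (\<lambda>i. f i - (\<Sum>k<N. delayed_P N E $$ (i,k) * f k)) a = (1 - \<mu> a) * coef f a" if "a < N" for a
  proof -
    have "(\<Sum>i<N. u a i * (\<Sum>k<N. delayed_P N E $$ (i,k) * f k))
        = (\<Sum>k<N. f k * (\<Sum>i<N. delayed_P N E $$ (k,i) * u a i))"
      unfolding sum_distrib_left
      by (subst sum.swap) (intro sum.cong refl, simp add: delayed_P_symmetric[OF sg] mult_ac)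
    also have "\<dots> = \<mu> a * coef f a"
      using eig that by (simp add: coef_def sum_distrib_left mult_ac)
    finally show ?thesis by (simp add: coef_def right_diff_distrib sum_subtractf left_diff_distrib)
  qed
  then show ?thesis
    unfolding dirichlet_eq[OF sg dpos, symmetric]
    by (subst inner_eq_coef, intro sum.cong) (auto simp: power2_eq_square)
qed

lemma eigs_le_1: "a < N \<Longrightarrow> \<mu> a \<le> 1"
proof -
  assume a: "a < N"
  have "coef (u a) b = (if b = a then 1 else 0)" if "b < N" for b
    using orth[OF that a] by (simp add: coef_def)
  then have "(\<Sum>b<N. (1 - \<mu> b) * (coef (u a) b)\<^sup>2) = (\<Sum>b<N. if b = a then 1 - \<mu> a else 0)"
    by (intro sum.cong) auto
  then have "dirichlet N E (u a) / \<delta> = 1 - \<mu> a" using a by (simp add: dirichlet_spectral)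
  moreover have "dirichlet N E (u a) / \<delta> \<ge> 0" using dirichlet_nonneg dpos by simp
  ultimately show ?thesis by linarith
qed

text \<open>Constants have zero energy. If every 1 - \<mu>_a were positive, the constant 1 would
  have no component along any basis vector, contradicting Parseval.\<close>

lemma eigs_0: "N > 0 \<Longrightarrow> \<mu> 0 = 1"
proof (rule ccontr)
  assume N: "N > 0" and ne: "\<mu> 0 \<noteq> 1"
  then have lt: "1 - \<mu> a > 0" if "a < N" for a using desc[of 0 a] eigs_le_1[of 0] that by auto
  let ?f = "\<lambda>_::nat. 1::real"
  have "(\<Sum>a<N. (1 - \<mu> a) * (coef ?f a)\<^sup>2) = 0"
    using dirichlet_spectral[of ?f] by simp
  then have "\<forall>a\<in>{..<N}. (1 - \<mu> a) * (coef ?f a)\<^sup>2 = 0"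
    using lt by (subst (asm) sum_nonneg_eq_0_iff) (auto simp: less_imp_le intro!: mult_nonneg_nonneg)
  then have "coef ?f a = 0" if "a < N" for a using lt[OF that] that by force
  then have "(\<Sum>i<N. ?f i * ?f i) = 0" by (subst inner_eq_coef) simp
  then show False using N by simp
qed

text \<open>The variational principle: the j + 1 vectors \<open>u 0\<close>, ..., \<open>u j\<close>
  have a nontrivial combination vanishing on the at most j points of \<open>Z\<close>. Its Rayleigh
  quotient is at most 1 - \<mu>_j, and the Poincare inequality bounds the same quotient from below.
  The product form avoids dividing by \<open>C\<close>.\<close>

lemma eigs_gap_lower:
  assumes j: "j < N" and Z: "finite Z" "card Z \<le> j"
    and poincare: "\<And>f. (\<And>z. z \<in> Z \<Longrightarrow> f z = 0) \<Longrightarrow> (\<Sum>i<N. (f i)\<^sup>2) \<le> C * dirichlet N E f"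
    and C: "C \<ge> 0"
  shows "1 \<le> C * \<delta> * (1 - \<mu> j)"
proof -
  obtain c where c: "\<exists>a\<in>{..j}. c a \<noteq> 0" "\<forall>z\<in>Z. (\<Sum>a\<in>{..j}. u a z * c a) = 0"
    using homogeneous_system_nontrivial[OF Z(1), of "{..j}" "\<lambda>z a. u a z"] Z(2) by auto
  define f where "f i = (\<Sum>a\<le>j. u a i * c a)" for i
  have coef: "coef f b = (if b \<le> j then c b else 0)" if "b < N" for b
  proof -
    have "coef f b = (\<Sum>a\<le>j. c a * (\<Sum>i<N. u a i * u b i))"
      unfolding coef_def f_def sum_distrib_left by (subst sum.swap) (simp add: mult_ac)
    also have "\<dots> = (\<Sum>a\<le>j. c a * (if a = b then 1 else 0))"
      using orth that j by (intro sum.cong) auto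
    finally show ?thesis by (simp add: if_distrib cong: if_cong)
  qed
  have sub: "(\<Sum>a<N. (if a \<le> j then g a else 0)) = (\<Sum>a\<le>j. g a)" for g :: "nat \<Rightarrow> real"
  proof -
    have "{..<N} \<inter> {..j} = {..j}" using j by auto
    then show ?thesis using sum.inter_restrict[of "{..<N}" g "{..j}"] by simp
  qed
  define s where "s = (\<Sum>a\<le>j. (c a)\<^sup>2)"
  have s: "s > 0" unfolding s_def using c(1) by (auto intro!: sum_pos2)
  have n: "(\<Sum>i<N. (f i)\<^sup>2) = s"
  proof -
    have "(\<Sum>i<N. (f i)\<^sup>2) = (\<Sum>a<N. (coef f a)\<^sup>2)"
      using inner_eq_coef[of f f] by (simp add: power2_eq_square)
    also have "\<dots> = (\<Sum>a<N. (if a \<le> j then (c a)\<^sup>2 else 0))" using coef by (intro sum.cong) auto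
    finally show ?thesis by (simp add: sub s_def)
  qed
  have "dirichlet N E f / \<delta> = (\<Sum>a<N. (if a \<le> j then (1 - \<mu> a) * (c a)\<^sup>2 else 0))"
    unfolding dirichlet_spectral using coef by (intro sum.cong) auto
  also have "\<dots> = (\<Sum>a\<le>j. (1 - \<mu> a) * (c a)\<^sup>2)" by (rule sub)
  also have "\<dots> \<le> (\<Sum>a\<le>j. (1 - \<mu> j) * (c a)\<^sup>2)"
    using desc j by (intro sum_mono mult_right_mono) auto
  also have "\<dots> = (1 - \<mu> j) * s" by (simp add: s_def sum_distrib_left)
  finally have "dirichlet N E f \<le> \<delta> * (1 - \<mu> j) * s" using dpos by (simp add: field_simps)
  then have "C * dirichlet N E f \<le> C * (\<delta> * (1 - \<mu> j) * s)" using C by (rule mult_left_mono)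
  moreover have "s \<le> C * dirichlet N E f" using poincare[of f] c(2) n by (simp add: f_def)
  ultimately have "1 * s \<le> (C * \<delta> * (1 - \<mu> j)) * s" by simp
  then show ?thesis using s by (simp only: mult_le_cancel_right_pos)
qed

lemma spectral_gap_upper_orth:
  assumes N: "N \<ge> 2" and g: "coef g 0 = 0"
  shows "(1 - \<mu> 1) * (\<Sum>i<N. (g i)\<^sup>2) \<le> dirichlet N E g / \<delta>"
proof -
  have "(\<Sum>i<N. (g i)\<^sup>2) = (\<Sum>a<N. (coef g a)\<^sup>2)"
    using inner_eq_coef[of g g] by (simp add: power2_eq_square)
  then have "(1 - \<mu> 1) * (\<Sum>i<N. (g i)\<^sup>2) = (\<Sum>a<N. (1 - \<mu> 1) * (coef g a)\<^sup>2)"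
    by (simp add: sum_distrib_left)
  also have "\<dots> \<le> (\<Sum>a<N. (1 - \<mu> a) * (coef g a)\<^sup>2)"
  proof (rule sum_mono)
    fix a assume "a \<in> {..<N}"
    then show "(1 - \<mu> 1) * (coef g a)\<^sup>2 \<le> (1 - \<mu> a) * (coef g a)\<^sup>2"
      using desc[of 1 a] g by (cases "a = 0") (auto intro!: mult_right_mono)
  qed
  finally show ?thesis by (simp add: dirichlet_spectral)
qed

text \<open>It is not necessary to know that \<open>u 0\<close> is constant. Subtracting a constant
  from \<open>f\<close> removes its component along \<open>u 0\<close>, leaves the energy unchanged,
  and can only enlarge the norm of a function with mean zero. If the constants have no component
  along \<open>u 0\<close>, they serve as test function and show that the gap vanishes.\<close>

lemma spectral_gap_upper:
  assumes N: "N \<ge> 2" and f: "(\<Sum>i<N. f i) = 0"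
  shows "(1 - \<mu> 1) * (\<Sum>i<N. (f i)\<^sup>2) \<le> dirichlet N E f / \<delta>"
proof (cases "coef (\<lambda>_. 1) 0 = 0")
  case True
  then have "(1 - \<mu> 1) * real N \<le> 0" using spectral_gap_upper_orth[OF N, of "\<lambda>_. 1"] by simp
  then have "1 - \<mu> 1 \<le> 0" using N by (simp add: mult_le_0_iff)
  then have "(1 - \<mu> 1) * (\<Sum>i<N. (f i)\<^sup>2) \<le> 0" by (intro mult_nonpos_nonneg sum_nonneg) auto
  also have "0 \<le> dirichlet N E f / \<delta>" by (simp add: dirichlet_nonneg)
  finally show ?thesis .
next
  case False
  define c where "c = coef f 0 / coef (\<lambda>_. 1) 0"
  have "coef (\<lambda>i. f i - c) 0 = coef f 0 - c * coef (\<lambda>_. 1) 0"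
    by (simp add: coef_def right_diff_distrib sum_subtractf sum_distrib_left mult.commute)
  then have "coef (\<lambda>i. f i - c) 0 = 0" using False by (simp add: c_def)
  from spectral_gap_upper_orth[OF N this]
  have *: "(1 - \<mu> 1) * (\<Sum>i<N. (f i - c)\<^sup>2) \<le> dirichlet N E f / \<delta>" by simp
  have "(\<Sum>i<N. (f i - c)\<^sup>2) = (\<Sum>i<N. (f i)\<^sup>2) + N * c\<^sup>2 - 2 * c * (\<Sum>i<N. f i)"
    by (simp add: power2_diff sum.distrib sum_subtractf sum_distrib_left mult_ac)
  then have "(\<Sum>i<N. (f i)\<^sup>2) \<le> (\<Sum>i<N. (f i - c)\<^sup>2)" using f by simp
  then have "(1 - \<mu> 1) * (\<Sum>i<N. (f i)\<^sup>2) \<le> (1 - \<mu> 1) * (\<Sum>i<N. (f i - c)\<^sup>2)"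
    using eigs_le_1[of 1] N by (intro mult_left_mono) auto
  then show ?thesis using * by linarith
qed

end

lemma walk_eigenbasis_exists:
  assumes "simple_graph N E" "max_deg N E > 0"
  obtains u where "walk_eigenbasis N E u"
proof -
  note sym = delayed_P_symmetric[OF assms(1)]
  obtain u where
    "length (eigs_desc (delayed_P N E)) = N"
    "\<And>a b. a \<le> b \<Longrightarrow> b < N \<Longrightarrow> eigs_desc (delayed_P N E) ! b \<le> eigs_desc (delayed_P N E) ! a"
    "\<And>a b. a < N \<Longrightarrow> b < N \<Longrightarrow> (\<Sum>i<N. u a i * u b i) = (if a = b then 1 else (0::real))"
    "\<And>a i. a < N \<Longrightarrow> i < N \<Longrightarrow>
      (\<Sum>k<N. delayed_P N E $$ (i,k) * u a k) = eigs_desc (delayed_P N E) ! a * u a i"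
    by (rule symmetric_mat_sorted_eigenbasis[OF delayed_P_carrier, of N E]) (use sym in blast)+
  then show ?thesis using assms by (intro that[of u]) (unfold_locales, auto)
qed

section \<open>Cutting a spanning tree\<close>

text \<open>The edge set is directed away from the root.\<close>

inductive rooted_tree :: "('a \<Rightarrow> 'a \<Rightarrow> bool) \<Rightarrow> 'a set \<Rightarrow> ('a \<times> 'a) set \<Rightarrow> 'a \<Rightarrow> bool" for E where
  leaf: "rooted_tree E {r} {} r"
| hang: "rooted_tree E V F r \<Longrightarrow> rooted_tree E W G s \<Longrightarrow> V \<inter> W = {} \<Longrightarrow> E r s
    \<Longrightarrow> rooted_tree E (V \<union> W) (insert (r,s) (F \<union> G)) r"

lemma rooted_tree_facts:
  assumes "rooted_tree E V F r"
  shows "finite V \<and> r \<in> V \<and> finite F \<and> F \<subseteq> V \<times> V \<and> F \<inter> F\<inverse> = {} \<and> (\<forall>(a,b)\<in>F. E a b)"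
  using assms by induction auto

lemma rooted_tree_add_leaf:
  assumes "rooted_tree E V F r" "v \<in> V" "w \<notin> V" "E v w"
  shows "\<exists>F'. rooted_tree E (insert w V) F' r"
  using assms
proof (induction arbitrary: v)
  case (leaf r)
  then show ?case using rooted_tree.hang[OF rooted_tree.leaf rooted_tree.leaf[of E w], of r] by fastforce
next
  case (hang V F r W G s)
  show ?case
  proof (cases "v \<in> V")
    case True
    then obtain F' where "rooted_tree E (insert w V) F' r"
      using hang.IH(1) hang.prems by blast
    from rooted_tree.hang[OF this hang(2) _ hang(4)] hang show ?thesis by auto
  next
    case False
    then obtain F' where "rooted_tree E (insert w W) F' s"
      using hang.IH(2) hang.prems by blast
    from rooted_tree.hang[OF hang(1) this _ hang(4)] hang show ?thesis by auto
  qed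
qed

lemma connected_graph_spanning_tree:
  assumes sg: "simple_graph N E" and cg: "connected_graph N E" and N: "N > 0"
  shows "\<exists>F. rooted_tree E {..<N} F 0"
proof -
  have "\<exists>V F. V \<subseteq> {..<N} \<and> card V = Suc m \<and> rooted_tree E V F 0" if "Suc m \<le> N" for m
    using that
  proof (induction m)
    case 0
    then show ?case using rooted_tree.leaf[of E 0] by (intro exI[of _ "{0}"] exI[of _ "{}"]) auto
  next
    case (Suc m)
    then obtain V F where V: "V \<subseteq> {..<N}" "card V = Suc m" "rooted_tree E V F 0" by auto
    have V0: "0 \<in> V" "finite V" using rooted_tree_facts[OF V(3)] by auto
    obtain x where x: "x < N" "x \<notin> V"
      using V(1,2) Suc.prems by (metis Suc_n_not_le_n card_lessThan lessThan_iff subset_antisym subsetI)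
    have "\<exists>v\<in>V. \<exists>w. w \<notin> V \<and> E v w"
    proof (rule ccontr)
      assume *: "\<not> (\<exists>v\<in>V. \<exists>w. w \<notin> V \<and> E v w)"
      have "E\<^sup>*\<^sup>* 0 y \<Longrightarrow> y \<in> V" for y
        by (induction rule: rtranclp_induct) (use * V0 in auto)
      then show False using cg x N by (auto simp: connected_graph_def)
    qed
    then obtain v w where vw: "v \<in> V" "w \<notin> V" "E v w" by auto
    then obtain F' where "rooted_tree E (insert w V) F' 0" using rooted_tree_add_leaf[OF V(3)] by blast
    moreover have "w < N" using sg vw by (auto simp: simple_graph_def)
    ultimately show ?case using V V0 vw by (intro exI[of _ "insert w V"] exI[of _ F']) auto
  qed
  from this[of "N - 1"] N obtain V F where V: "V \<subseteq> {..<N}" "card V = N" "rooted_tree E V F 0" by auto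
  then have "V = {..<N}" by (intro card_subset_eq) auto
  then show ?thesis using V by blast
qed

section \<open>Energy along tree edges and clusters anchored at zeros\<close>

definition edge_energy :: "('a \<times> 'a) set \<Rightarrow> ('a \<Rightarrow> real) \<Rightarrow> real" where
  "edge_energy F f = (\<Sum>(a,b)\<in>F. (f a - f b)\<^sup>2)"

lemma edge_energy_nonneg: "edge_energy F f \<ge> 0"
  by (auto simp: edge_energy_def intro!: sum_nonneg)

lemma edge_energy_union:
  "finite F \<Longrightarrow> finite G \<Longrightarrow> F \<inter> G = {} \<Longrightarrow> edge_energy (F \<union> G) f = edge_energy F f + edge_energy G f"
  by (simp add: edge_energy_def sum.union_disjoint)

lemma edge_energy_insert:
  "finite F \<Longrightarrow> (a,b) \<notin> F \<Longrightarrow> edge_energy (insert (a,b) F) f = (f a - f b)\<^sup>2 + edge_energy F f"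
  by (simp add: edge_energy_def)

lemma edge_energy_mono: "finite G \<Longrightarrow> F \<subseteq> G \<Longrightarrow> edge_energy F f \<le> edge_energy G f"
  unfolding edge_energy_def by (intro sum_mono2) auto

text \<open>As \<open>F\<close> contains no edge together with its reverse, adding all reverses
  exactly doubles its energy and matches the double counting in \<open>dirichlet\<close>.\<close>

lemma edge_energy_le_dirichlet:
  assumes sg: "simple_graph N E" and F: "F \<inter> F\<inverse> = {}" "\<And>a b. (a,b) \<in> F \<Longrightarrow> E a b"
  shows "edge_energy F f \<le> dirichlet N E f"
proof -
  let ?S = "Sigma {..<N} (\<lambda>v. {w. w < N \<and> E v w})"
  have "a < N \<and> b < N \<and> E a b \<and> E b a" if "(a,b) \<in> F" for a b
    using F(2)[OF that] sg unfolding simple_graph_def by blast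
  then have S: "F \<union> F\<inverse> \<subseteq> ?S" by auto
  have fS: "finite ?S" by auto
  have fF: "finite F" using S fS finite_subset by blast
  have eq: "edge_energy ?S f = 2 * dirichlet N E f"
    by (simp add: edge_energy_def dirichlet_def sum.Sigma)
  have conv: "edge_energy (F\<inverse>) f = edge_energy F f"
    unfolding edge_energy_def
    by (rule sum.reindex_bij_witness[of _ prod.swap prod.swap]) (auto simp: power2_commute)
  have "2 * edge_energy F f = edge_energy (F \<union> F\<inverse>) f"
    using fF F(1) conv by (simp add: edge_energy_union)
  also have "\<dots> \<le> edge_energy ?S f" by (rule edge_energy_mono[OF fS S])
  finally show ?thesis using eq by simp
qed

lemma sum_abs_squared_le:
  assumes "finite F"
  shows "(\<Sum>(a,b)\<in>F. \<bar>f a - f b\<bar>)\<^sup>2 \<le> card F * edge_energy F (f :: 'a \<Rightarrow> real)"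
proof -
  have "(\<Sum>e\<in>F. (case e of (a,b) \<Rightarrow> \<bar>f a - f b\<bar>) * 1)\<^sup>2
      \<le> (\<Sum>e\<in>F. (case e of (a,b) \<Rightarrow> \<bar>f a - f b\<bar>)\<^sup>2) * (\<Sum>e\<in>F. 1\<^sup>2)"
    by (rule Cauchy_Schwarz_ineq_sum)
  moreover have "(\<Sum>e\<in>F. (case e of (a,b) \<Rightarrow> \<bar>f a - f b\<bar>)\<^sup>2) = edge_energy F f"
    unfolding edge_energy_def by (intro sum.cong) auto
  ultimately show ?thesis by (simp add: mult.commute)
qed

text \<open>\<open>U\<close> is the cluster of the root that is still to be anchored at a zero of \<open>f\<close> above the root, and
  \<open>H\<close> are its tree edges.  A cluster is handed over to the parent as long as it has at most
  \<open>m\<close> vertices; otherwise its top vertex is put into \<open>Z\<close>.\<close>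

definition anchored_cut ::
    "nat \<Rightarrow> 'a set \<Rightarrow> ('a \<times> 'a) set \<Rightarrow> 'a \<Rightarrow> 'a set \<Rightarrow> 'a set \<Rightarrow> ('a \<times> 'a) set \<Rightarrow> bool" where
  "anchored_cut m V F r Z U H \<longleftrightarrow> Z \<subseteq> V \<and> U \<subseteq> V - Z \<and> r \<in> U \<and> card Z * Suc m + card U \<le> card V
    \<and> H \<subseteq> F \<and> Suc (card H) = card U
    \<and> (\<forall>f. (\<forall>z\<in>insert r Z. f z = 0) \<longrightarrow> (\<Sum>v\<in>V. (f v)\<^sup>2) \<le> (real m)\<^sup>2 * edge_energy F f)
    \<and> (card U \<le> m \<longrightarrow> (\<forall>f. (\<forall>z\<in>Z. f z = 0) \<longrightarrow>
        (\<Sum>v\<in>V-U. (f v)\<^sup>2) \<le> (real m)\<^sup>2 * edge_energy (F - H) f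
        \<and> (\<forall>v\<in>U. \<bar>f v - f r\<bar> \<le> (\<Sum>(a,b)\<in>H. \<bar>f a - f b\<bar>))))"

text \<open>Each vertex of \<open>Z\<close> is paid for by a finished cluster of at least m + 1
  vertices, which gives the counting clause. A child cluster of at most m vertices, extended by the
  edge to its parent, has at most m edges; Cauchy-Schwarz along paths bounds each squared value by m
  times the energy of these edges if f vanishes at the parent, and summing over at most m vertices
  gives the constant \<open>m\<^sup>2\<close>. Clusters of different children use disjoint edges, so
  the merged cluster may exceed m without harm: the last clause is then vacuous, and the root will
  be anchored itself.\<close>

lemma rooted_tree_cut:
  assumes "rooted_tree E V F r"
  shows "\<exists>Z U H. anchored_cut m V F r Z U H"
  using assms
proof induction
  case (leaf r)
  show ?case by (intro exI[of _ "{}"] exI[of _ "{r}"] exI[of _ "{}"]) (auto simp: edge_energy_def anchored_cut_def)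
next
  case (hang V F r W G s)
  note fV = rooted_tree_facts[OF hang(1)] and fW = rooted_tree_facts[OF hang(2)]
  have FG: "F \<inter> G = {}" "(r,s) \<notin> F \<union> G" using fV fW hang(3) by auto
  obtain Z U H where cut1: "anchored_cut m V F r Z U H" using hang.IH(1) by blast
  have A1: "Z \<subseteq> V" "U \<subseteq> V - Z" "r \<in> U" "card Z * Suc m + card U \<le> card V" "H \<subseteq> F" "Suc (card H) = card U"
    using cut1 by (simp_all add: anchored_cut_def)
  have A2: "(\<Sum>v\<in>V. (f v)\<^sup>2) \<le> (real m)\<^sup>2 * edge_energy F f" if "\<forall>z\<in>insert r Z. f z = 0" for f
    using cut1 that by (simp add: anchored_cut_def)
  have A3: "(\<Sum>v\<in>V-U. (f v)\<^sup>2) \<le> (real m)\<^sup>2 * edge_energy (F - H) f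
      \<and> (\<forall>v\<in>U. \<bar>f v - f r\<bar> \<le> (\<Sum>(a,b)\<in>H. \<bar>f a - f b\<bar>))"
    if "card U \<le> m" "\<forall>z\<in>Z. f z = 0" for f
    using cut1 that by (simp add: anchored_cut_def)
  obtain Z' U' H' where cut2: "anchored_cut m W G s Z' U' H'" using hang.IH(2) by blast
  have B1: "Z' \<subseteq> W" "U' \<subseteq> W - Z'" "s \<in> U'" "card Z' * Suc m + card U' \<le> card W" "H' \<subseteq> G" "Suc (card H') = card U'"
    using cut2 by (simp_all add: anchored_cut_def)
  have B2: "(\<Sum>v\<in>W. (f v)\<^sup>2) \<le> (real m)\<^sup>2 * edge_energy G f" if "\<forall>z\<in>insert s Z'. f z = 0" for f
    using cut2 that by (simp add: anchored_cut_def)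
  have B3: "(\<Sum>v\<in>W-U'. (f v)\<^sup>2) \<le> (real m)\<^sup>2 * edge_energy (G - H') f
      \<and> (\<forall>v\<in>U'. \<bar>f v - f s\<bar> \<le> (\<Sum>(a,b)\<in>H'. \<bar>f a - f b\<bar>))"
    if "card U' \<le> m" "\<forall>z\<in>Z'. f z = 0" for f
    using cut2 that by (simp add: anchored_cut_def)
  have fin: "finite Z" "finite U" "finite H" "finite Z'" "finite U'" "finite H'"
    using A1 B1 fV fW by (auto intro: finite_subset)
  have dj: "Z \<inter> Z' = {}" "U \<inter> U' = {}" "H \<inter> H' = {}" "(r,s) \<notin> H \<union> H'"
    using A1 B1 hang(3) FG by auto
  have cVW: "card (V \<union> W) = card V + card W" using fV fW hang(3) by (simp add: card_Un_disjoint)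
  have sVW: "(\<Sum>v\<in>V\<union>W. g v) = (\<Sum>v\<in>V. g v) + (\<Sum>v\<in>W. g v)" for g :: "'a \<Rightarrow> real"
    using fV fW hang(3) by (simp add: sum.union_disjoint)
  have en: "edge_energy (insert (r,s) (F \<union> G)) f = (f r - f s)\<^sup>2 + edge_energy F f + edge_energy G f" for f
    using FG fV fW by (simp add: edge_energy_insert edge_energy_union)
  show ?case
  proof (cases "card U' \<le> m")
    case True
    let ?H = "insert (r,s) (H \<union> H')"
    have a: "Z \<union> Z' \<subseteq> V \<union> W" "U \<union> U' \<subseteq> V \<union> W - (Z \<union> Z')" "r \<in> U \<union> U'"
      "?H \<subseteq> insert (r,s) (F \<union> G)" using A1 B1 hang(3) by auto
    have b: "card (Z \<union> Z') * Suc m + card (U \<union> U') \<le> card (V \<union> W)"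
      using A1(4) B1(4) fin dj by (simp add: card_Un_disjoint cVW algebra_simps)
    have c: "Suc (card ?H) = card (U \<union> U')"
      using A1(6) B1(6) fin dj by (simp add: card_Un_disjoint)
    have path: "\<bar>f v - f r\<bar> \<le> \<bar>f r - f s\<bar> + (\<Sum>(a,b)\<in>H'. \<bar>f a - f b\<bar>)"
      if "\<forall>z\<in>Z'. f z = 0" "v \<in> U'" for f :: "'a \<Rightarrow> real" and v
      using B3[OF True that(1)] that(2) by (smt (verit))
    have L1: "(\<Sum>(a,b)\<in>insert (r,s) H'. \<bar>f a - f b\<bar>) = \<bar>f r - f s\<bar> + (\<Sum>(a,b)\<in>H'. \<bar>f a - f b\<bar>)"
      for f :: "'a \<Rightarrow> real" using fin dj by simp
    have d: "(\<Sum>v\<in>V\<union>W. (f v)\<^sup>2) \<le> (real m)\<^sup>2 * edge_energy (insert (r,s) (F \<union> G)) f"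
      if f: "\<forall>z\<in>insert r (Z \<union> Z'). f z = 0" for f
    proof -
      have f0: "\<forall>z\<in>Z'. f z = 0" "f r = 0" using f by auto
      let ?e = "edge_energy (insert (r,s) H') f"
      have "(f v)\<^sup>2 \<le> real m * ?e" if "v \<in> U'" for v
      proof -
        have "\<bar>f v\<bar> \<le> (\<Sum>(a,b)\<in>insert (r,s) H'. \<bar>f a - f b\<bar>)"
          using path[OF f0(1) that] f0(2) unfolding L1 by simp
        then have "\<bar>f v\<bar>\<^sup>2 \<le> (\<Sum>(a,b)\<in>insert (r,s) H'. \<bar>f a - f b\<bar>)\<^sup>2" by (intro power_mono) auto
        \<comment> \<open>\<open>H'\<close> has one edge fewer than \<open>U'\<close> has vertices,
          so the edge to the parent brings the number to at most m.\<close>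
        also have "\<dots> \<le> card (insert (r,s) H') * ?e" using fin by (intro sum_abs_squared_le) auto
        also have "\<dots> \<le> real m * ?e"
          using B1(6) True fin dj by (intro mult_right_mono edge_energy_nonneg) auto
        finally show ?thesis by simp
      qed
      then have "(\<Sum>v\<in>U'. (f v)\<^sup>2) \<le> real (card U') * (real m * ?e)"
        using sum_bounded_above[of U' "\<lambda>v. (f v)\<^sup>2"] by auto
      also have "\<dots> \<le> real m * (real m * ?e)"
        using True by (intro mult_right_mono mult_nonneg_nonneg edge_energy_nonneg) auto
      finally have U': "(\<Sum>v\<in>U'. (f v)\<^sup>2) \<le> (real m)\<^sup>2 * ?e" by (simp add: power2_eq_square)
      have "(\<Sum>v\<in>W. (f v)\<^sup>2) = (\<Sum>v\<in>W-U'. (f v)\<^sup>2) + (\<Sum>v\<in>U'. (f v)\<^sup>2)"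
        using B1 fW by (intro sum.subset_diff) auto
      also have "\<dots> \<le> (real m)\<^sup>2 * edge_energy (G - H') f + (real m)\<^sup>2 * ?e"
        using B3[OF True f0(1)] U' by linarith
      also have "\<dots> = (real m)\<^sup>2 * ((f r - f s)\<^sup>2 + edge_energy G f)"
      proof -
        have "edge_energy (G - H' \<union> H') f = edge_energy (G - H') f + edge_energy H' f"
          using fW fin by (intro edge_energy_union) auto
        moreover have "G - H' \<union> H' = G" using B1 by auto
        moreover have "?e = (f r - f s)\<^sup>2 + edge_energy H' f" using dj fin by (simp add: edge_energy_insert)
        ultimately show ?thesis by (simp add: algebra_simps)
      qed
      finally have "(\<Sum>v\<in>W. (f v)\<^sup>2) \<le> (real m)\<^sup>2 * ((f r - f s)\<^sup>2 + edge_energy G f)" .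
      moreover have "(\<Sum>v\<in>V. (f v)\<^sup>2) \<le> (real m)\<^sup>2 * edge_energy F f" using f by (intro A2) auto
      ultimately show ?thesis unfolding sVW en by (simp add: algebra_simps)
    qed
    have e: "(\<Sum>v\<in>V\<union>W-(U\<union>U'). (f v)\<^sup>2) \<le> (real m)\<^sup>2 * edge_energy (insert (r,s) (F \<union> G) - ?H) f
        \<and> (\<forall>v\<in>U\<union>U'. \<bar>f v - f r\<bar> \<le> (\<Sum>(a,b)\<in>?H. \<bar>f a - f b\<bar>))"
      if cU: "card (U \<union> U') \<le> m" and f: "\<forall>z\<in>Z\<union>Z'. f z = 0" for f
    proof -
      have f0: "\<forall>z\<in>Z. f z = 0" "\<forall>z\<in>Z'. f z = 0" using f by auto
      have cU': "card U \<le> m" using cU fin dj by (simp add: card_Un_disjoint)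
      have "V \<union> W - (U \<union> U') = (V - U) \<union> (W - U')" "(V - U) \<inter> (W - U') = {}"
        using A1 B1 hang(3) by auto
      then have "(\<Sum>v\<in>V\<union>W-(U\<union>U'). (f v)\<^sup>2) = (\<Sum>v\<in>V-U. (f v)\<^sup>2) + (\<Sum>v\<in>W-U'. (f v)\<^sup>2)"
        using fV fW by (simp add: sum.union_disjoint)
      also have "\<dots> \<le> (real m)\<^sup>2 * edge_energy (F - H) f + (real m)\<^sup>2 * edge_energy (G - H') f"
        using A3[OF cU' f0(1)] B3[OF True f0(2)] by linarith
      also have "\<dots> = (real m)\<^sup>2 * edge_energy ((F - H) \<union> (G - H')) f"
        using fV fW FG by (subst edge_energy_union) (auto simp: algebra_simps)
      also have "(F - H) \<union> (G - H') = insert (r,s) (F \<union> G) - ?H"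
        using A1(5) B1(5) FG by auto
      finally have i: "(\<Sum>v\<in>V\<union>W-(U\<union>U'). (f v)\<^sup>2) \<le> (real m)\<^sup>2 * edge_energy (insert (r,s) (F \<union> G) - ?H) f" .
      have Hs: "(\<Sum>(a,b)\<in>?H. \<bar>f a - f b\<bar>) = \<bar>f r - f s\<bar> + (\<Sum>(a,b)\<in>H. \<bar>f a - f b\<bar>) + (\<Sum>(a,b)\<in>H'. \<bar>f a - f b\<bar>)"
        using fin dj by (simp add: sum.union_disjoint)
      have nn: "(\<Sum>(a,b)\<in>H. \<bar>f a - f b\<bar>) \<ge> 0" "(\<Sum>(a,b)\<in>H'. \<bar>f a - f b\<bar>) \<ge> 0"
        by (auto intro!: sum_nonneg)
      have "\<bar>f v - f r\<bar> \<le> (\<Sum>(a,b)\<in>?H. \<bar>f a - f b\<bar>)" if "v \<in> U \<union> U'" for v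
      proof (cases "v \<in> U")
        case True
        then have "\<bar>f v - f r\<bar> \<le> (\<Sum>(a,b)\<in>H. \<bar>f a - f b\<bar>)" using A3[OF cU' f0(1)] by blast
        then show ?thesis unfolding Hs using nn by linarith
      next
        case False
        then have "v \<in> U'" using that by auto
        from path[OF f0(2) this] show ?thesis unfolding Hs using nn by linarith
      qed
      then show ?thesis using i by blast
    qed
    have "anchored_cut m (V \<union> W) (insert (r,s) (F \<union> G)) r (Z \<union> Z') (U \<union> U') ?H"
      unfolding anchored_cut_def
      by (intro conjI allI impI a b c d conjunct1[OF e] conjunct2[OF e]; assumption)
    then show ?thesis by blast
  next
    case False
    \<comment> \<open>The child's cluster has more than m vertices and pays for anchoring
      \<open>s\<close>. The subtree of \<open>s\<close> is then self-contained, and the energy of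
      the edge from \<open>r\<close> is given away.\<close>
    let ?Z = "insert s (Z \<union> Z')"
    have a: "?Z \<subseteq> V \<union> W" "U \<subseteq> V \<union> W - ?Z" "r \<in> U" "H \<subseteq> insert (r,s) (F \<union> G)"
      using A1 B1 hang(3) fW by auto
    have sZ: "s \<notin> Z \<union> Z'" using A1 B1 hang(3) fW by auto
    have b: "card ?Z * Suc m + card U \<le> card (V \<union> W)"
      using A1(4) B1(4) fin dj sZ False by (simp add: card_Un_disjoint cVW algebra_simps)
    have Wb: "(\<Sum>v\<in>W. (f v)\<^sup>2) \<le> (real m)\<^sup>2 * edge_energy G f" if "\<forall>z\<in>?Z. f z = 0" for f
      using that by (intro B2) auto
    have d: "(\<Sum>v\<in>V\<union>W. (f v)\<^sup>2) \<le> (real m)\<^sup>2 * edge_energy (insert (r,s) (F \<union> G)) f"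
      if f: "\<forall>z\<in>insert r ?Z. f z = 0" for f
    proof -
      have "(\<Sum>v\<in>V. (f v)\<^sup>2) \<le> (real m)\<^sup>2 * edge_energy F f" using f by (intro A2) auto
      moreover have "0 \<le> (real m)\<^sup>2 * (f r - f s)\<^sup>2" by simp
      ultimately show ?thesis using Wb[of f] f unfolding sVW en by (simp add: algebra_simps)
    qed
    have e: "(\<Sum>v\<in>V\<union>W-U. (f v)\<^sup>2) \<le> (real m)\<^sup>2 * edge_energy (insert (r,s) (F \<union> G) - H) f
        \<and> (\<forall>v\<in>U. \<bar>f v - f r\<bar> \<le> (\<Sum>(a,b)\<in>H. \<bar>f a - f b\<bar>))"
      if cU: "card U \<le> m" and f: "\<forall>z\<in>?Z. f z = 0" for f
    proof -
      have f0: "\<forall>z\<in>Z. f z = 0" using f by auto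
      have "V \<union> W - U = (V - U) \<union> W" "(V - U) \<inter> W = {}" using A1 hang(3) by auto
      then have "(\<Sum>v\<in>V\<union>W-U. (f v)\<^sup>2) = (\<Sum>v\<in>V-U. (f v)\<^sup>2) + (\<Sum>v\<in>W. (f v)\<^sup>2)"
        using fV fW by (simp add: sum.union_disjoint)
      also have "\<dots> \<le> (real m)\<^sup>2 * edge_energy (F - H) f + (real m)\<^sup>2 * edge_energy G f"
        using A3[OF cU f0] Wb[OF f] by linarith
      also have "\<dots> = (real m)\<^sup>2 * edge_energy ((F - H) \<union> G) f"
        using fV fW FG by (subst edge_energy_union) (auto simp: algebra_simps)
      also have "\<dots> \<le> (real m)\<^sup>2 * edge_energy (insert (r,s) (F \<union> G) - H) f"
        using fV fW FG A1(5) by (intro mult_left_mono edge_energy_mono) auto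
      finally show ?thesis using A3[OF cU f0] by blast
    qed
    have "anchored_cut m (V \<union> W) (insert (r,s) (F \<union> G)) r ?Z U H"
      unfolding anchored_cut_def
      by (intro conjI allI impI a b A1(6) d conjunct1[OF e] conjunct2[OF e]; assumption)
    then show ?thesis by blast
  qed
qed

text \<open>With m = N div j the root's cluster is nonempty, so |Z| (m + 1) < N < j (m + 1). The
  strict inequality leaves room for the root as one more anchor.\<close>

lemma connected_graph_poincare:
  assumes sg: "simple_graph N E" and cg: "connected_graph N E" and N: "N > 0" and j: "j > 0"
  obtains Z where "finite Z" "card Z \<le> j"
    "\<And>f. (\<And>z. z \<in> Z \<Longrightarrow> f z = 0) \<Longrightarrow> (\<Sum>i<N. (f i)\<^sup>2) \<le> (real (N div j))\<^sup>2 * dirichlet N E f"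
proof -
  obtain F where F: "rooted_tree E {..<N} F 0" using connected_graph_spanning_tree[OF sg cg N] by auto
  note f = rooted_tree_facts[OF F]
  let ?m = "N div j"
  from rooted_tree_cut[OF F, of ?m] obtain Z U where
    Z: "Z \<subseteq> {..<N}" "U \<subseteq> {..<N}" "0 \<in> U" "card Z * Suc ?m + card U \<le> N"
    "\<forall>f. (\<forall>z\<in>insert 0 Z. f z = 0) \<longrightarrow> (\<Sum>v\<in>{..<N}. (f v)\<^sup>2) \<le> (real ?m)\<^sup>2 * edge_energy F f"
    unfolding anchored_cut_def by auto
  have fin: "finite Z" "finite U" using Z finite_subset by blast+
  have "card U > 0" using Z fin by (auto simp: card_gt_0_iff)
  then have "card Z * Suc ?m < N" using Z by linarith
  also have "N < j * Suc ?m" using j by (metis dividend_less_div_times mult.commute mult_Suc_right)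
  finally have "card Z < j" using mult_less_cancel2 by blast
  then have "card (insert 0 Z) \<le> j" using fin by (simp add: card_insert_if)
  moreover have "(\<Sum>i<N. (f i)\<^sup>2) \<le> (real ?m)\<^sup>2 * dirichlet N E f" if "\<And>z. z \<in> insert 0 Z \<Longrightarrow> f z = 0" for f
  proof -
    have "(\<Sum>i<N. (f i)\<^sup>2) \<le> (real ?m)\<^sup>2 * edge_energy F f" using Z(5) that by blast
    also have "\<dots> \<le> (real ?m)\<^sup>2 * dirichlet N E f"
      using f by (intro mult_left_mono edge_energy_le_dirichlet[OF sg]) auto
    finally show ?thesis .
  qed
  ultimately show ?thesis using that[of "insert 0 Z"] fin by auto
qed

section \<open>Gaussian tails and the upper bounds\<close>

lemma integral_gaussian_le:
  "integral {0..b} (\<lambda>x::real. exp (- x\<^sup>2)) \<le> sqrt pi / 2"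
proof -
  let ?g = "\<lambda>x::real. indicator {0..} x *\<^sub>R exp (- x\<^sup>2)"
  have "integrable lborel ?g" "integral\<^sup>L lborel ?g = sqrt pi / 2"
    using gaussian_moment_0 by (simp_all only: has_bochner_integral_iff)
  then have g: "(?g has_integral sqrt pi / 2) UNIV"
    using has_integral_integral_lborel[of ?g] by metis
  have "integral {0..b} (\<lambda>x::real. exp (- x\<^sup>2)) = integral {0..b} ?g"
    by (intro integral_cong) auto
  also have "\<dots> \<le> integral UNIV ?g"
  proof (intro integral_subset_le)
    have "(\<lambda>x::real. exp (- x\<^sup>2)) integrable_on {0..b}"
      by (intro integrable_continuous_real continuous_intros)
    then show "?g integrable_on {0..b}"
      by (rule integrable_eq) auto
  qed (use g in \<open>auto intro: has_integral_integrable\<close>)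
  also have "\<dots> = sqrt pi / 2" using g by (rule integral_unique)
  finally show ?thesis .
qed

text \<open>Right-endpoint Riemann sum of a decreasing function with step sqrt c, compared with the
  integral over the half-line; hence the index starts at 1.\<close>

lemma sum_gaussian_le:
  assumes c: "c > 0"
  shows "(\<Sum>i=1..n. exp (- c * (real i)\<^sup>2)) \<le> sqrt (pi / c) / 2"
proof -
  define s where "s = sqrt c"
  have s: "s > 0" "s\<^sup>2 = c" using c by (auto simp: s_def)
  let ?f = "\<lambda>x::real. exp (- x\<^sup>2)"
  have int: "?f integrable_on {a..b}" for a b
    by (intro integrable_continuous_real continuous_intros)
  have "s * (\<Sum>i=1..n. exp (- c * (real i)\<^sup>2)) \<le> integral {0..s * n} ?f"
  proof (induction n)
    case (Suc n)
    let ?a = "s * n" and ?b = "s * Suc n"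
    have ab: "0 \<le> ?a" "?a \<le> ?b" using s by auto
    have "integral {?a..?b} (\<lambda>_. exp (- ?b\<^sup>2)) \<le> integral {?a..?b} ?f"
    proof (rule integral_le)
      fix x assume "x \<in> {?a..?b}"
      then have "x\<^sup>2 \<le> ?b\<^sup>2" using ab by (intro power_mono) auto
      then show "exp (- ?b\<^sup>2) \<le> exp (- x\<^sup>2)" by simp
    qed (use int in auto)
    moreover have "integral {?a..?b} (\<lambda>_. exp (- ?b\<^sup>2)) = s * exp (- c * (real (Suc n))\<^sup>2)"
      using ab s(1) unfolding s(2)[symmetric] by (simp add: power_mult_distrib right_diff_distrib[symmetric])
    moreover have "integral {0..?a} ?f + integral {?a..?b} ?f = integral {0..?b} ?f"
      using ab int by (intro Henstock_Kurzweil_Integration.integral_combine) auto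
    ultimately show ?case using Suc by (simp add: distrib_left)
  qed auto
  also have "\<dots> \<le> sqrt pi / 2" by (rule integral_gaussian_le)
  finally show ?thesis using s c by (simp add: s_def real_sqrt_divide field_simps)
qed

text \<open>Shifting the index by \<open>K\<close> and using (i + K)^2 >= i^2 + K^2 splits off the
  value at \<open>K\<close>.\<close>

lemma gaussian_tail_sum_le:
  assumes c: "c > 0"
  shows "(\<Sum>j\<in>{K<..n}. exp (- c * (real j)\<^sup>2)) \<le> sqrt (pi / c) / 2 * exp (- c * (real K)\<^sup>2)"
proof (cases "K \<le> n")
  case True
  have "(\<Sum>j\<in>{K<..n}. exp (- c * (real j)\<^sup>2)) = (\<Sum>i=1..n-K. exp (- c * (real (i + K))\<^sup>2))"
    using True by (intro sum.reindex_bij_witness[of _ "\<lambda>i. i + K" "\<lambda>j. j - K"]) auto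
  also have "\<dots> \<le> (\<Sum>i=1..n-K. exp (- c * (real K)\<^sup>2) * exp (- c * (real i)\<^sup>2))"
  proof (rule sum_mono)
    fix i
    have "c * ((real K)\<^sup>2 + (real i)\<^sup>2) \<le> c * (real (i + K))\<^sup>2"
      using c by (intro mult_left_mono) (auto simp: power2_eq_square algebra_simps)
    then show "exp (- c * (real (i + K))\<^sup>2) \<le> exp (- c * (real K)\<^sup>2) * exp (- c * (real i)\<^sup>2)"
      unfolding exp_add[symmetric] by (simp add: algebra_simps)
  qed
  also have "\<dots> = exp (- c * (real K)\<^sup>2) * (\<Sum>i=1..n-K. exp (- c * (real i)\<^sup>2))"
    by (simp add: sum_distrib_left)
  also have "\<dots> \<le> exp (- c * (real K)\<^sup>2) * (sqrt (pi / c) / 2)"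
    using c by (intro mult_left_mono sum_gaussian_le) auto
  finally show ?thesis by (simp add: mult.commute)
qed (use c in auto)

text \<open>Telescoping: the quotient of consecutive terms is exp (c (2 j + 1)), and exp x - 1 >= x
  bounds 2 c K times each term by the drop from the preceding term.\<close>

lemma gaussian_tail_sum_le':
  assumes c: "c > 0" and K: "K > 0"
  shows "(\<Sum>j\<in>{K<..n}. exp (- c * (real j)\<^sup>2)) \<le> exp (- c * (real K)\<^sup>2) / (2 * c * real K)"
proof -
  let ?e = "\<lambda>j. exp (- c * (real j)\<^sup>2)"
  have step: "2 * c * real K * ?e (Suc j) \<le> ?e j - ?e (Suc j)" if "K \<le> j" for j
  proof -
    have "2 * c * real K \<le> c * (2 * real j + 1)" using c that by (simp add: mult.commute)
    also have "\<dots> \<le> exp (c * (2 * real j + 1)) - 1"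
      using exp_ge_add_one_self[of "c * (2 * real j + 1)"] by linarith
    finally have "2 * c * real K * ?e (Suc j) \<le> (exp (c * (2 * real j + 1)) - 1) * ?e (Suc j)"
      by (intro mult_right_mono) auto
    also have "\<dots> = ?e j - ?e (Suc j)"
      by (simp add: left_diff_distrib exp_add[symmetric] power2_eq_square algebra_simps)
    finally show ?thesis .
  qed
  have "2 * c * real K * (\<Sum>j\<in>{K<..n}. ?e j) \<le> ?e K - ?e n" if "K \<le> n" for n
    using that
  proof (induction n rule: dec_induct)
    case (step n)
    have "{K<..Suc n} = insert (Suc n) {K<..n}" using step by auto
    then show ?case using step \<open>\<And>j. K \<le> j \<Longrightarrow> _\<close>[of n] by (simp add: distrib_left)
  qed simp
  moreover have "?e n > 0" by simp
  ultimately have "2 * c * real K * (\<Sum>j\<in>{K<..n}. ?e j) \<le> ?e K" if "K \<le> n"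
    using that by (smt (verit))
  then show ?thesis using c K by (cases "K \<le> n") (auto simp: field_simps)
qed

section \<open>From eigenvalue growth to the two upper bounds\<close>

text \<open>If all degrees are at most 1, everything reachable from 0 lies in 0 and its only
  possible neighbour.\<close>

lemma max_deg_ge_2:
  assumes sg: "simple_graph N E" and cg: "connected_graph N E" and N: "N \<ge> 3"
  shows "max_deg N E \<ge> 2"
proof (rule ccontr)
  assume "\<not> max_deg N E \<ge> 2"
  then have d: "gdeg N E v \<le> 1" if "v < N" for v using gdeg_le_max_deg[OF that, of E] by simp
  have uniq: "a = b" if "E v a" "E v b" for v a b
  proof -
    have "v < N" "a < N" "b < N" using sg that by (auto simp: simple_graph_def)
    then have "{a,b} \<subseteq> {w. w < N \<and> E v w}" using that by auto
    then have "card {a,b} \<le> gdeg N E v" unfolding gdeg_def by (intro card_mono) auto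
    then show ?thesis using d[OF \<open>v < N\<close>] by (cases "a = b") auto
  qed
  \<comment> \<open>If 0 has no neighbour, \<open>b\<close> is an arbitrary number; the invariant
    below survives because no step leaves 0.\<close>
  define b where "b = (SOME w. E 0 w)"
  have closed: "E\<^sup>*\<^sup>* 0 y \<Longrightarrow> y \<in> {0,b}" for y
  proof (induction rule: rtranclp_induct)
    case (step y z)
    show ?case
    proof (cases "y = 0")
      case True
      then show ?thesis using step someI[of "E 0" z] uniq by (auto simp: b_def)
    next
      case False
      then have "y = b" "y \<noteq> 0" using step by auto
      then have "E 0 b" using step(1) someI[of "E 0"] by (metis b_def converse_rtranclpE)
      then have "E b 0" using sg by (auto simp: simple_graph_def)
      then show ?thesis using uniq step \<open>y = b\<close> by auto
    qed
  qed simp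
  have "y \<in> {0,b}" if "y < N" for y using closed cg that N by (auto simp: connected_graph_def)
  then have "{..<N} \<subseteq> {0,b}" by auto
  then have "card {..<N} \<le> card {0,b}" by (intro card_mono) auto
  also have "\<dots> \<le> 2" by (simp add: card_insert_if)
  finally show False using N by simp
qed

context walk_eigenbasis
begin

lemma eigs_quadratic_growth:
  assumes cg: "connected_graph N E" and j: "0 < j" "j < N"
  shows "(real j)\<^sup>2 / (\<delta> * (real N)\<^sup>2) \<le> 1 - \<mu> j"
proof -
  obtain Z where Z: "finite Z" "card Z \<le> j"
    "\<And>f. (\<And>z. z \<in> Z \<Longrightarrow> f z = 0) \<Longrightarrow> (\<Sum>i<N. (f i)\<^sup>2) \<le> (real (N div j))\<^sup>2 * dirichlet N E f"
    using connected_graph_poincare[OF sg cg _ j(1)] j by auto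
  have "1 \<le> (real (N div j))\<^sup>2 * \<delta> * (1 - \<mu> j)"
    by (rule eigs_gap_lower[OF j(2) Z]) auto
  also have "\<dots> \<le> (real N / real j)\<^sup>2 * \<delta> * (1 - \<mu> j)"
    using eigs_le_1[OF j(2)] by (intro mult_right_mono power_mono) (auto simp: of_nat_div_le_of_nat)
  finally show ?thesis using j dpos by (simp add: field_simps power_divide)
qed

lemma return_prob_split:
  assumes cg: "connected_graph N E" and N: "N \<ge> 3" and t: "t > 0"
  defines "c \<equiv> t / (\<delta> * (real N)\<^sup>2)"
  shows "return_prob N E t \<le> 1 / N + (real K / N) * exp (- t * (1 - \<mu> 1))
      + (\<Sum>j\<in>{K<..N-1}. exp (- c * (real j)\<^sup>2)) / N"
proof -
  let ?e = "\<lambda>a. exp (- t * (1 - \<mu> a))"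
  have "{..<N} = insert 0 {0<..N-1}" using N by auto
  then have "(\<Sum>a<N. ?e a) = 1 + (\<Sum>a\<in>{0<..N-1}. ?e a)" using eigs_0 N by simp
  \<comment> \<open>\<open>K\<close> may exceed N - 1, hence the intersection with the index
    range.\<close>
  also have "(\<Sum>a\<in>{0<..N-1}. ?e a) \<le> (\<Sum>a\<in>{0<..N-1}\<inter>{..K}. ?e a) + (\<Sum>a\<in>{K<..N-1}. ?e a)"
  proof -
    have "(\<Sum>a\<in>{0<..N-1}. ?e a) \<le> (\<Sum>a\<in>({0<..N-1}\<inter>{..K}) \<union> {K<..N-1}. ?e a)"
      by (intro sum_mono2) auto
    also have "\<dots> = (\<Sum>a\<in>{0<..N-1}\<inter>{..K}. ?e a) + (\<Sum>a\<in>{K<..N-1}. ?e a)"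
      by (intro sum.union_disjoint) auto
    finally show ?thesis .
  qed
  also have "(\<Sum>a\<in>{0<..N-1}\<inter>{..K}. ?e a) \<le> real K * ?e 1"
  proof -
    have "(\<Sum>a\<in>{0<..N-1}\<inter>{..K}. ?e a) \<le> real (card ({0<..N-1}\<inter>{..K})) * ?e 1"
    proof (rule sum_bounded_above)
      fix a assume "a \<in> {0<..N-1}\<inter>{..K}"
      then have "\<mu> a \<le> \<mu> 1" using N by (intro desc) auto
      then show "?e a \<le> ?e 1" using t by simp
    qed
    also have "card ({0<..N-1}\<inter>{..K}) \<le> card {0<..K}" by (intro card_mono) auto
    finally show ?thesis by simp
  qed
  also have "(\<Sum>a\<in>{K<..N-1}. ?e a) \<le> (\<Sum>j\<in>{K<..N-1}. exp (- c * (real j)\<^sup>2))"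
  proof (rule sum_mono)
    fix a assume "a \<in> {K<..N-1}"
    then have a: "0 < a" "a < N" using N by auto
    have "t * ((real a)\<^sup>2 / (\<delta> * (real N)\<^sup>2)) \<le> t * (1 - \<mu> a)"
      using t by (intro mult_left_mono eigs_quadratic_growth[OF cg a]) auto
    then show "?e a \<le> exp (- c * (real a)\<^sup>2)" by (simp add: c_def)
  qed
  finally have "(\<Sum>a<N. ?e a) \<le> 1 + real K * ?e 1 + (\<Sum>j\<in>{K<..N-1}. exp (- c * (real j)\<^sup>2))" by simp
  then have "(\<Sum>a<N. ?e a) / N \<le> (1 + real K * ?e 1 + (\<Sum>j\<in>{K<..N-1}. exp (- c * (real j)\<^sup>2))) / N"
    by (intro divide_right_mono) auto
  then show ?thesis by (simp add: return_prob_eq add_divide_distrib)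
qed

text \<open>Cutting the spectrum at K = \<delta> k produces the second term as stated, and c K^2 = t
  \<delta> k^2 / N^2. The rest compares constants for \<delta> >= 2: the exponent needs 32 <=
  \<delta>^3 (\<delta> + 2), the first prefactor 8 <= \<delta> (\<delta> + 2), both with equality at
  \<delta> = 2, and the second prefactor 8 <= \<delta>^2 (\<delta> + 2).\<close>

lemma return_prob_upper:
  assumes cg: "connected_graph N E" and N: "N \<ge> 3" and t: "t > 0" and k: "k \<ge> 1"
  defines "g \<equiv> exp (- (32 * t * real k ^ 2) / ((\<delta> + 2) * \<delta> ^ 2 * real N ^ 2))"
  shows "return_prob N E t \<le> 1 / real N + \<delta> * (real k / real N) * exp (- t * (1 - \<mu> 1))
           + sqrt (pi / 32) * (\<delta> * sqrt (\<delta> + 2) / sqrt t) * g" (is ?A)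
    and "return_prob N E t \<le> 1 / real N + \<delta> * (real k / real N) * exp (- t * (1 - \<mu> 1))
           + (\<delta> ^ 2 * (\<delta> + 2) / (16 * t)) * (real N / real k) * g" (is ?B)
proof -
  have d: "\<delta> \<ge> 2" using max_deg_ge_2[OF sg cg N] by simp
  define c where "c = t / (\<delta> * (real N)\<^sup>2)"
  define K where "K = max_deg N E * k"
  have c: "c > 0" using d t N by (simp add: c_def)
  have K: "K > 0" "real K = \<delta> * real k" using d k by (auto simp: K_def)
  have expo: "exp (- c * (real K)\<^sup>2) \<le> g"
  proof -
    have "8 * 4 \<le> \<delta> ^ 3 * (\<delta> + 2)"
      using d power_mono[of 2 "\<delta>" 3] by (intro mult_mono) auto
    then have "32 / ((\<delta> + 2) * \<delta> ^ 2) \<le> \<delta>"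
      using d by (simp add: divide_le_eq power3_eq_cube power2_eq_square mult_ac)
    then have "32 / ((\<delta> + 2) * \<delta> ^ 2) * (t * (real k)\<^sup>2 / (real N)\<^sup>2) \<le> \<delta> * (t * (real k)\<^sup>2 / (real N)\<^sup>2)"
      using t by (intro mult_right_mono) auto
    also have "\<dots> = c * (real K)\<^sup>2"
      using d by (simp add: c_def K power2_eq_square field_simps)
    finally show ?thesis by (simp add: g_def mult_ac)
  qed
  have split: "return_prob N E t \<le> 1 / N + \<delta> * (real k / real N) * exp (- t * (1 - \<mu> 1))
      + (\<Sum>j\<in>{K<..N-1}. exp (- c * (real j)\<^sup>2)) / N"
    using return_prob_split[OF cg N t, of K] by (simp add: c_def K)
  have "(\<Sum>j\<in>{K<..N-1}. exp (- c * (real j)\<^sup>2)) / N \<le> (sqrt (pi / c) / 2 * exp (- c * (real K)\<^sup>2)) / N"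
    by (intro divide_right_mono gaussian_tail_sum_le[OF c]) auto
  also have "\<dots> = sqrt (pi * \<delta> / t) / 2 * exp (- c * (real K)\<^sup>2)"
  proof -
    have "sqrt (pi / c) = sqrt (pi * \<delta> / t) * N"
      using N by (simp add: c_def real_sqrt_mult real_sqrt_divide)
    then show ?thesis using N by simp
  qed
  also have "\<dots> \<le> sqrt (pi / 32) * (\<delta> * sqrt (\<delta> + 2) / sqrt t) * g"
  proof (rule mult_mono[OF _ expo])
    have "2 * 4 \<le> \<delta> * (\<delta> + 2)" using d by (intro mult_mono) auto
    then have "pi / t * \<delta> / 4 * 8 \<le> pi / t * \<delta> / 4 * (\<delta> * (\<delta> + 2))"
      using t by (intro mult_left_mono) auto
    then have "pi * \<delta> / t / 4 \<le> (pi / 32) * (\<delta>\<^sup>2 * (\<delta> + 2) / t)"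
      by (simp add: power2_eq_square field_simps)
    then have "sqrt (pi * \<delta> / t / 4) \<le> sqrt ((pi / 32) * (\<delta>\<^sup>2 * (\<delta> + 2) / t))" by simp
    moreover have "sqrt (pi * \<delta> / t / 4) = sqrt (pi * \<delta> / t) / 2"
      by (simp only: real_sqrt_divide real_sqrt_four)
    moreover have "sqrt ((pi / 32) * (\<delta>\<^sup>2 * (\<delta> + 2) / t)) = sqrt (pi / 32) * (\<delta> * sqrt (\<delta> + 2) / sqrt t)"
      by (simp add: real_sqrt_mult real_sqrt_divide)
    ultimately show "sqrt (pi * \<delta> / t) / 2 \<le> sqrt (pi / 32) * (\<delta> * sqrt (\<delta> + 2) / sqrt t)" by linarith
  qed (use d t in auto)
  finally show ?A using split by linarith
  have "(\<Sum>j\<in>{K<..N-1}. exp (- c * (real j)\<^sup>2)) / N \<le> (exp (- c * (real K)\<^sup>2) / (2 * c * real K)) / N"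
    by (intro divide_right_mono gaussian_tail_sum_le'[OF c K(1)]) auto
  also have "\<dots> = N / (2 * t * k) * exp (- c * (real K)\<^sup>2)"
    using d t N k by (simp add: c_def K power2_eq_square field_simps)
  also have "\<dots> \<le> (\<delta> ^ 2 * (\<delta> + 2) / (16 * t)) * (real N / real k) * g"
  proof (rule mult_mono[OF _ expo])
    have "4 * 2 \<le> \<delta>\<^sup>2 * (\<delta> + 2)" using d power_mono[of 2 "\<delta>" 2] by (intro mult_mono) auto
    then have "8 * (N / (16 * t * k)) \<le> (\<delta>\<^sup>2 * (\<delta> + 2)) * (N / (16 * t * k))"
      using t by (intro mult_right_mono) auto
    then show "N / (2 * t * k) \<le> (\<delta> ^ 2 * (\<delta> + 2) / (16 * t)) * (real N / real k)"
      by (simp add: field_simps)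
  qed (use d t in auto)
  finally show ?B using split by linarith
qed

end

section \<open>Separators of graphs without a complete minor\<close>

text \<open>Connectedness phrased as an induction principle: for symmetric \<open>E\<close>, a
  nonempty part of \<open>S\<close> that no edge within \<open>S\<close> leaves is all of
  \<open>S\<close>.\<close>

definition conn :: "('a \<Rightarrow> 'a \<Rightarrow> bool) \<Rightarrow> 'a set \<Rightarrow> bool" where
  "conn E S \<longleftrightarrow> S \<noteq> {} \<and> (\<forall>A. A \<subseteq> S \<longrightarrow> A \<noteq> {} \<longrightarrow> (\<forall>a\<in>A. \<forall>b\<in>S. E a b \<longrightarrow> b \<in> A) \<longrightarrow> A = S)"

text \<open>For \<open>v\<close> outside \<open>S\<close> this is the singleton of \<open>v\<close>,
  by reflexivity; hence the assumption \<open>v \<in> S\<close> in the facts below.\<close>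

definition component :: "('a \<Rightarrow> 'a \<Rightarrow> bool) \<Rightarrow> 'a set \<Rightarrow> 'a \<Rightarrow> 'a set" where
  "component E S v = {w. (\<lambda>a b. a \<in> S \<and> b \<in> S \<and> E a b)\<^sup>*\<^sup>* v w}"

lemma connD:
  "conn E S \<Longrightarrow> A \<subseteq> S \<Longrightarrow> x \<in> A \<Longrightarrow> (\<And>a b. a \<in> A \<Longrightarrow> b \<in> S \<Longrightarrow> E a b \<Longrightarrow> b \<in> A) \<Longrightarrow> S \<subseteq> A"
  unfolding conn_def by blast

lemma conn_singleton: "conn E {v}"
  by (auto simp: conn_def)

lemma component_self: "v \<in> component E S v"
  by (simp add: component_def)

lemma component_subset: "v \<in> S \<Longrightarrow> component E S v \<subseteq> S"
proof
  fix w assume v: "v \<in> S" and "w \<in> component E S v"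
  then have "(\<lambda>a b. a \<in> S \<and> b \<in> S \<and> E a b)\<^sup>*\<^sup>* v w" by (simp add: component_def)
  then show "w \<in> S" using v by induction auto
qed

lemma component_closed:
  "v \<in> S \<Longrightarrow> a \<in> component E S v \<Longrightarrow> b \<in> S \<Longrightarrow> E a b \<Longrightarrow> b \<in> component E S v"
proof -
  assume *: "v \<in> S" "a \<in> component E S v" "b \<in> S" "E a b"
  then have "a \<in> S" using component_subset by fast
  then show ?thesis using * unfolding component_def by (auto intro: rtranclp.rtrancl_into_rtrancl)
qed

text \<open>The invariant of the argument of Alon, Seymour and Thomas, in which \<open>U\<close> is the large part that
  has not been separated yet.\<close>

definition covey :: "('a \<Rightarrow> 'a \<Rightarrow> bool) \<Rightarrow> 'a set \<Rightarrow> nat \<Rightarrow> 'a set set \<Rightarrow> 'a set \<Rightarrow> 'a set \<Rightarrow> bool" where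
  "covey E V r \<C> X U \<longleftrightarrow> finite \<C> \<and> (\<forall>C\<in>\<C>. conn E C \<and> C \<subseteq> V \<and> card (X \<inter> C) \<le> r \<and> U \<inter> C = {})
    \<and> (\<forall>C\<in>\<C>. \<forall>C'\<in>\<C>. C \<noteq> C' \<longrightarrow> C \<inter> C' = {} \<and> (\<exists>a\<in>C. \<exists>b\<in>C'. E a b))
    \<and> X \<subseteq> \<Union>\<C> \<and> conn E U \<and> U \<subseteq> V \<and> (\<forall>u\<in>U. \<forall>w\<in>V. E u w \<longrightarrow> w \<in> U \<union> X)"

definition complete_minor :: "('a \<Rightarrow> 'a \<Rightarrow> bool) \<Rightarrow> nat \<Rightarrow> 'a set \<Rightarrow> bool" where
  "complete_minor E h V \<longleftrightarrow> (\<exists>B :: nat \<Rightarrow> 'a set. (\<forall>i<h. conn E (B i) \<and> B i \<subseteq> V)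
    \<and> (\<forall>i<h. \<forall>j<h. i \<noteq> j \<longrightarrow> B i \<inter> B j = {} \<and> (\<exists>a\<in>B i. \<exists>b\<in>B j. E a b)))"

context
  fixes E :: "'a \<Rightarrow> 'a \<Rightarrow> bool"
  assumes sym: "\<And>a b. E a b \<Longrightarrow> E b a"
begin

lemma conn_component:
  assumes v: "v \<in> S"
  shows "conn E (component E S v)"
  unfolding conn_def
proof (intro conjI allI impI)
  show "component E S v \<noteq> {}" using component_self by fast
  fix A assume A: "A \<subseteq> component E S v" "A \<noteq> {}" "\<forall>a\<in>A. \<forall>b\<in>component E S v. E a b \<longrightarrow> b \<in> A"
  let ?R = "\<lambda>a b. a \<in> S \<and> b \<in> S \<and> E a b"
  obtain a where a: "a \<in> A" using A by auto
  have "symp ?R" using sym by (auto simp: symp_def)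
  then have "symp ?R\<^sup>*\<^sup>*" by (rule symp_rtranclp)
  then have av: "?R\<^sup>*\<^sup>* a v" using a A(1) by (auto simp: component_def symp_def)
  have "w \<in> A" if "w \<in> component E S v" for w
  proof -
    have "?R\<^sup>*\<^sup>* a w" using av that by (auto simp: component_def)
    then show ?thesis
    proof induction
      case (step y z)
      then have "z \<in> component E S v" using component_closed[OF v] A(1) by blast
      then show ?case using step A(3) by blast
    qed (use a in simp)
  qed
  then show "A = component E S v" using A by auto
qed

lemma conn_subset_component:
  assumes v: "v \<in> S" and W: "conn E W" "W \<subseteq> S" "x \<in> W" "x \<in> component E S v"
  shows "W \<subseteq> component E S v"
proof -
  have "W \<subseteq> W \<inter> component E S v"
    by (rule connD[OF W(1), of _ x]) (use W component_closed[OF v] in auto)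
  then show ?thesis by auto
qed

lemma conn_Union:
  assumes C: "conn E C" and W: "\<And>i. i \<in> I \<Longrightarrow> conn E (W i)"
    and adj: "\<And>i. i \<in> I \<Longrightarrow> \<exists>c\<in>C. \<exists>w\<in>W i. E c w"
  shows "conn E (C \<union> (\<Union>i\<in>I. W i))"
  unfolding conn_def
proof (intro conjI allI impI)
  let ?U = "C \<union> (\<Union>i\<in>I. W i)"
  show "?U \<noteq> {}" using C by (auto simp: conn_def)
  fix A assume A: "A \<subseteq> ?U" "A \<noteq> {}" "\<forall>a\<in>A. \<forall>b\<in>?U. E a b \<longrightarrow> b \<in> A"
  have CA: "C \<subseteq> A" if "x \<in> A" "x \<in> C" for x
    using connD[OF C, of "A \<inter> C" x] that A(3) by auto
  have WA: "W i \<subseteq> A" if "x \<in> A" "x \<in> W i" "i \<in> I" for x i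
    using connD[OF W[OF that(3)], of "A \<inter> W i" x] that A(3) by auto
  have "C \<subseteq> A"
  proof -
    obtain x where x: "x \<in> A" using A by auto
    show ?thesis
    proof (cases "x \<in> C")
      case True then show ?thesis using CA x by blast
    next
      case False
      then obtain i where i: "i \<in> I" "x \<in> W i" using x A(1) by auto
      then have "W i \<subseteq> A" using WA x by blast
      moreover obtain c w where "c \<in> C" "w \<in> W i" "E c w" using adj[OF i(1)] by auto
      ultimately have "c \<in> A" using A(3) sym by blast
      then show ?thesis using CA \<open>c \<in> C\<close> by blast
    qed
  qed
  moreover have "W i \<subseteq> A" if i: "i \<in> I" for i
  proof -
    obtain c w where "c \<in> C" "w \<in> W i" "E c w" using adj[OF i] by auto
    then have "w \<in> A" using A(3) \<open>C \<subseteq> A\<close> i by blast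
    then show ?thesis using WA \<open>w \<in> W i\<close> i by blast
  qed
  ultimately show "A = ?U" using A(1) by auto
qed

lemma conn_insert:
  assumes T: "conn E T" and uv: "u \<in> T" "E u v"
  shows "conn E (insert v T)"
  using conn_Union[OF T, of "{()}" "\<lambda>_. {v}"] conn_singleton[of E v] uv by auto

section \<open>The separator argument of Alon, Seymour and Thomas\<close>

text \<open>A breadth-first search in k - 1 copies of \<open>U\<close>. \<open>D n i\<close>
  collects the vertices lying in a connected set of at most n vertices that meets
  \<open>A 0\<close>, ..., \<open>A i\<close>. The r layers \<open>L n\<close> are disjoint subsets
  of the copies, so one of them is small, and its projection is \<open>Z\<close>. A connected
  \<open>W\<close> avoiding \<open>Z\<close> and meeting every \<open>A i\<close> cannot cross that
  layer: it stays in level n - 1 of each copy, changing from copy i to copy i + 1 at a vertex of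
  \<open>A (Suc i)\<close>, and ends with a hitting set of fewer than n vertices.\<close>

lemma hitting_set_or_separator:
  fixes A :: "nat \<Rightarrow> 'a set"
  assumes fin: "finite U" and ne: "U \<noteq> {}" and A: "\<And>i. i < k \<Longrightarrow> A i \<subseteq> U" "\<And>i. i < k \<Longrightarrow> A i \<noteq> {}"
    and r: "r \<ge> 1"
  shows "(\<exists>T\<subseteq>U. conn E T \<and> card T \<le> r \<and> (\<forall>i<k. T \<inter> A i \<noteq> {}))
    \<or> (\<exists>Z\<subseteq>U. card Z * r \<le> (k - 1) * card U \<and> (\<forall>W\<subseteq>U-Z. conn E W \<longrightarrow> (\<exists>i<k. W \<inter> A i = {})))"
proof (cases "k \<le> 1")
  case True
  obtain u where "u \<in> U" "\<forall>i<k. u \<in> A i"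
  proof (cases "k = 0")
    case True then show ?thesis using that ne by auto
  next
    case False
    then have "k = 1" using True by simp
    then obtain a where "a \<in> A 0" using A(2)[of 0] by auto
    then show ?thesis using that[of a] A(1)[of 0] \<open>k = 1\<close> by auto
  qed
  then show ?thesis using conn_singleton[of E u] r by (intro disjI1 exI[of _ "{u}"]) auto
next
  case k: False
  show ?thesis
  proof (rule disj_imp[THEN iffD2, rule_format])
    assume noT: "\<not> (\<exists>T\<subseteq>U. conn E T \<and> card T \<le> r \<and> (\<forall>i<k. T \<inter> A i \<noteq> {}))"
    define D where "D n i = {v\<in>U. \<exists>T\<subseteq>U. conn E T \<and> v \<in> T \<and> card T \<le> n \<and> (\<forall>j\<le>i. T \<inter> A j \<noteq> {})}" for n i
    define L where "L n = {(v,i). i < k - 1 \<and> v \<in> D n i - D (n - 1) i}" for n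
    have Dmono: "D n i \<subseteq> D n' i" if "n \<le> n'" for n n' i
      using that unfolding D_def by (auto dest: order_trans)
    have LU: "L n \<subseteq> U \<times> {..<k-1}" for n by (auto simp: L_def D_def)
    have Ldj: "L n \<inter> L n' = {}" if "n < n'" for n n'
    proof -
      have "n \<le> n' - 1" using that by simp
      then have "D n i \<subseteq> D (n' - 1) i" for i by (rule Dmono)
      then show ?thesis by (auto simp: L_def)
    qed
    have finL: "finite (L n)" for n using LU fin finite_subset[of "L n" "U \<times> {..<k-1}"] by auto
    have "(\<Sum>n=1..r. card (L n)) = card (\<Union>n\<in>{1..r}. L n)"
      using finL Ldj by (intro card_UN_disjoint[symmetric]) (auto simp: neq_iff Int_commute)
    also have "\<dots> \<le> card (U \<times> {..<k-1})" using LU fin by (intro card_mono) auto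
    also have "\<dots> = (k - 1) * card U" by (simp add: card_cartesian_product)
    finally have sum: "(\<Sum>n=1..r. card (L n)) \<le> (k - 1) * card U" .
    have "\<exists>n\<in>{1..r}. card (L n) * r \<le> (k - 1) * card U"
    proof (rule ccontr)
      assume "\<not> (\<exists>n\<in>{1..r}. card (L n) * r \<le> (k - 1) * card U)"
      then have "\<forall>n\<in>{1..r}. (k - 1) * card U < card (L n) * r" by (meson not_le)
      then have "(\<Sum>n=1..r. (k - 1) * card U) < (\<Sum>n=1..r. card (L n) * r)"
        using r by (intro sum_strict_mono) auto
      also have "\<dots> = (\<Sum>n=1..r. card (L n)) * r" by (simp add: sum_distrib_right)
      also have "\<dots> \<le> (k - 1) * card U * r" by (intro mult_right_mono sum) auto
      finally show False by (simp add: mult_ac)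
    qed
    then obtain n where n: "1 \<le> n" "n \<le> r" "card (L n) * r \<le> (k - 1) * card U" by auto
    define Z where "Z = fst ` L n"
    have "card Z \<le> card (L n)" unfolding Z_def by (rule card_image_le[OF finL])
    then have "card Z * r \<le> (k - 1) * card U" using n(3) by (meson le_trans mult_le_mono1)
    moreover have "Z \<subseteq> U" using LU[of n] by (force simp: Z_def)
    moreover have "\<exists>i<k. W \<inter> A i = {}" if W: "W \<subseteq> U - Z" "conn E W" for W
    proof (rule ccontr)
      assume "\<not> (\<exists>i<k. W \<inter> A i = {})"
      then have hit: "W \<inter> A i \<noteq> {}" if "i < k" for i using that by auto
      have skip: "v \<in> D (n - 1) i" if "v \<in> W" "v \<in> D n i" "i < k - 1" for v i
        using that W(1) by (force simp: Z_def L_def)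
      \<comment> \<open>Adding a neighbour enlarges the witness from n - 1 to at most n vertices; as
        \<open>W\<close> misses layer n, the neighbour is already in level n - 1.\<close>
      have spread: "W \<subseteq> D (n - 1) i" if x: "x \<in> W" "x \<in> D n i" and i: "i < k - 1" for x i
      proof -
        have "W \<subseteq> W \<inter> D (n - 1) i"
        proof (rule connD[OF W(2), of _ x])
          show "x \<in> W \<inter> D (n - 1) i" using skip x i by auto
          fix a b assume ab: "a \<in> W \<inter> D (n - 1) i" "b \<in> W" "E a b"
          then obtain T where T: "T \<subseteq> U" "conn E T" "a \<in> T" "card T \<le> n - 1" "\<forall>j\<le>i. T \<inter> A j \<noteq> {}"
            by (auto simp: D_def)
          have "finite T" using T fin finite_subset by auto
          then have "card (insert b T) \<le> n"
            using T(4) n(1) by (simp add: card_insert_if) linarith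
          moreover have "conn E (insert b T)" using conn_insert[OF T(2,3) ab(3)] .
          moreover have "b \<in> U" using ab W by auto
          ultimately have "b \<in> D n i" using T unfolding D_def
            by (auto intro!: exI[of _ "insert b T"])
          then show "b \<in> W \<inter> D (n - 1) i" using skip ab i by auto
        qed auto
        then show ?thesis by auto
      qed
      have "W \<subseteq> D (n - 1) i" if "i < k - 1" for i
        using that
      proof (induction i)
        case 0
        obtain v where v: "v \<in> W" "v \<in> A 0" using hit[of 0] k by auto
        have "v \<in> D n 0" using v W(1) n conn_singleton[of E v]
          by (auto simp: D_def intro!: exI[of _ "{v}"])
        then show ?case using spread v 0 by blast
      next
        case (Suc i)
        then have IH: "W \<subseteq> D (n - 1) i" by simp
        have "Suc i < k" using Suc.prems by linarith
        then obtain v where v: "v \<in> W" "v \<in> A (Suc i)" using hit[of "Suc i"] by auto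
        then obtain T where T: "T \<subseteq> U" "conn E T" "v \<in> T" "card T \<le> n - 1" "\<forall>j\<le>i. T \<inter> A j \<noteq> {}"
          using IH by (auto simp: D_def)
        have "\<forall>j\<le>Suc i. T \<inter> A j \<noteq> {}" using T(3,5) v(2) by (auto simp: le_Suc_eq)
        moreover have "card T \<le> n" using T(4) by linarith
        ultimately have "v \<in> D n (Suc i)" using T unfolding D_def by blast
        then show ?case using spread v Suc by blast
      qed
      then have D: "W \<subseteq> D (n - 1) (k - 2)" using k by simp
      obtain v where v: "v \<in> W" "v \<in> A (k - 1)" using hit[of "k - 1"] k by auto
      then obtain T where T: "T \<subseteq> U" "conn E T" "v \<in> T" "card T \<le> n - 1" "\<forall>j\<le>k-2. T \<inter> A j \<noteq> {}"
        using D by (auto simp: D_def)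
      have "T \<inter> A i \<noteq> {}" if "i < k" for i
      proof (cases "i = k - 1")
        case False
        then have "i \<le> k - 2" using that by simp
        then show ?thesis using T by blast
      qed (use v T in auto)
      then show False using noT T n by (meson diff_le_self le_trans)
    qed
    ultimately show "\<exists>Z\<subseteq>U. card Z * r \<le> (k - 1) * card U \<and> (\<forall>W\<subseteq>U-Z. conn E W \<longrightarrow> (\<exists>i<k. W \<inter> A i = {}))"
      by blast
  qed
qed

text \<open>The remaining part \<open>U\<close> serves as the last branch set.\<close>

lemma covey_complete_minor:
  assumes cv: "covey E V r \<C> X U" and card: "card \<C> = h"
    and adj: "\<And>C. C \<in> \<C> \<Longrightarrow> \<exists>u\<in>U. \<exists>c\<in>C. E u c"
  shows "complete_minor E (Suc h) V"
proof -
  have fin: "finite \<C>" and Une: "U \<noteq> {}" using cv by (auto simp: covey_def conn_def)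
  then have notin: "U \<notin> \<C>" using cv by (auto simp: covey_def)
  let ?\<C> = "insert U \<C>"
  have props: "conn E C \<and> C \<subseteq> V" if "C \<in> ?\<C>" for C
    using cv that by (auto simp: covey_def)
  have pw: "C \<inter> C' = {} \<and> (\<exists>a\<in>C. \<exists>b\<in>C'. E a b)" if CC: "C \<in> ?\<C>" "C' \<in> ?\<C>" "C \<noteq> C'" for C C'
  proof (cases "C = U \<or> C' = U")
    case True
    then show ?thesis
    proof
      assume "C = U"
      then have "C' \<in> \<C>" using CC by auto
      then show ?thesis using adj[of C'] cv \<open>C = U\<close> by (auto simp: covey_def)
    next
      assume "C' = U"
      then have "C \<in> \<C>" using CC by auto
      then have "U \<inter> C = {}" using cv by (auto simp: covey_def)
      moreover obtain u c where "u \<in> U" "c \<in> C" "E u c" using adj[OF \<open>C \<in> \<C>\<close>] by auto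
      ultimately show ?thesis using sym[of u c] \<open>C' = U\<close> by blast
    qed
  next
    case False
    then show ?thesis using CC cv by (auto simp: covey_def)
  qed
  have "card ?\<C> = Suc h" using fin notin card by simp
  then obtain B where B: "bij_betw B {0..<Suc h} ?\<C>"
    using ex_bij_betw_nat_finite[of ?\<C>] fin by auto
  have Bin: "B i \<in> ?\<C>" if "i < Suc h" for i using B that by (auto simp: bij_betw_def)
  have Bne: "B i \<noteq> B j" if "i < Suc h" "j < Suc h" "i \<noteq> j" for i j
    using B that by (auto simp: bij_betw_def inj_on_def)
  show ?thesis unfolding complete_minor_def
  proof (intro exI[of _ B] conjI allI impI)
    fix i assume i: "i < Suc h"
    show "conn E (B i)" "B i \<subseteq> V" using props[OF Bin[OF i]] by simp_all
    fix j assume "j < Suc h" "i \<noteq> j"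
    then show "B i \<inter> B j = {}" "\<exists>a\<in>B i. \<exists>b\<in>B j. E a b"
      using pw[OF Bin[OF i] Bin Bne[OF i]] by simp_all
  qed
qed

text \<open>Apply the dichotomy to the sets \<open>A i\<close> of neighbours in \<open>U\<close> of
  the branch sets. A hitting set \<open>T\<close> touches every branch set, becomes a new one, and
  lies entirely in the new boundary. A separator \<open>Z\<close> leaves a large component
  \<open>D\<close> with no neighbour in some branch set \<open>C0\<close>; then \<open>C0\<close>
  can absorb everything between it and \<open>D\<close>, and its old boundary is replaced by
  vertices of \<open>Z\<close>. In both cases \<open>U\<close> shrinks.\<close>

lemma covey_refine:
  assumes V: "finite V"
    and big: "\<And>S. S \<subseteq> V \<Longrightarrow> card S \<le> 5 * r \<Longrightarrow> \<exists>v\<in>V-S. card V < 2 * card (component E (V - S) v)"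
    and r: "r \<ge> 1" "3 * card V \<le> r * r"
    and cv: "covey E V r \<C> X U" "card \<C> \<le> 4" "card V < 2 * card U"
    and adj: "\<And>C. C \<in> \<C> \<Longrightarrow> \<exists>u\<in>U. \<exists>c\<in>C. E u c"
  shows "\<exists>\<C>' X' U'. covey E V r \<C>' X' U' \<and> card \<C>' \<le> Suc (card \<C>) \<and> card V < 2 * card U' \<and> card U' < card U"
proof -
  have fin: "finite \<C>" and U: "conn E U" "U \<subseteq> V" and XC: "X \<subseteq> \<Union>\<C>"
    and nbr: "\<And>u w. u \<in> U \<Longrightarrow> w \<in> V \<Longrightarrow> E u w \<Longrightarrow> w \<in> U \<union> X"
    and C: "\<And>C. C \<in> \<C> \<Longrightarrow> conn E C" "\<And>C. C \<in> \<C> \<Longrightarrow> C \<subseteq> V" "\<And>C. C \<in> \<C> \<Longrightarrow> card (X \<inter> C) \<le> r"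
      "\<And>C. C \<in> \<C> \<Longrightarrow> U \<inter> C = {}"
    and pw: "\<And>C C'. C \<in> \<C> \<Longrightarrow> C' \<in> \<C> \<Longrightarrow> C \<noteq> C' \<Longrightarrow> C \<inter> C' = {} \<and> (\<exists>a\<in>C. \<exists>b\<in>C'. E a b)"
    using cv(1) by (auto simp: covey_def)
  have fU: "finite U" using U V finite_subset by auto
  have XV: "X \<subseteq> V" using XC C by auto
  have fX: "finite X" using XV V finite_subset by auto
  have XU: "X \<inter> U = {}" using XC C(4) by auto
  have cX: "card X \<le> 4 * r"
  proof -
    have "X = (\<Union>C\<in>\<C>. X \<inter> C)" using XC by auto
    then have "card X \<le> (\<Sum>C\<in>\<C>. card (X \<inter> C))" using card_UN_le[OF fin, of "\<lambda>C. X \<inter> C"] by simp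
    also have "\<dots> \<le> card \<C> * r" using sum_bounded_above[of \<C> "\<lambda>C. card (X \<inter> C)" r] C(3) by simp
    also have "\<dots> \<le> 4 * r" using cv(2) by simp
    finally show ?thesis .
  qed
  have bigcomp: "\<exists>D d. d \<in> D \<and> D \<subseteq> U - Z \<and> conn E D \<and> card V < 2 * card D
      \<and> (\<forall>a\<in>D. \<forall>w\<in>V. E a w \<longrightarrow> w \<in> D \<union> X \<union> Z)" if Z: "Z \<subseteq> U" "card Z \<le> r" for Z
  proof -
    let ?S = "X \<union> Z"
    \<comment> \<open>The origin of the bound 5 r: at most r boundary vertices in each of four
      branch sets, and r for the set removed next.\<close>
    have "card ?S \<le> 5 * r" using card_Un_le[of X Z] cX Z by simp
    moreover have SV: "?S \<subseteq> V" using XV Z U by auto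
    ultimately obtain v where v: "v \<in> V - ?S" "card V < 2 * card (component E (V - ?S) v)"
      using big by blast
    let ?D = "component E (V - ?S) v"
    have DV: "?D \<subseteq> V - ?S" by (rule component_subset[OF v(1)])
    have fD: "finite ?D" using DV V finite_subset[of ?D V] by auto
    \<comment> \<open>Two sets that each contain more than half of \<open>V\<close> must meet; as
      \<open>D\<close> avoids \<open>X\<close>, it then cannot leave \<open>U\<close>.\<close>
    have "?D \<inter> U \<noteq> {}"
    proof
      assume "?D \<inter> U = {}"
      then have "card ?D + card U = card (?D \<union> U)" using fD fU by (simp add: card_Un_disjoint)
      also have "\<dots> \<le> card V" using DV U V by (intro card_mono) auto
      finally show False using v(2) cv(3) by linarith
    qed
    then obtain d where d: "d \<in> ?D" "d \<in> U" by auto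
    have cD: "conn E ?D" by (rule conn_component[OF v(1)])
    have "?D \<subseteq> ?D \<inter> U"
      by (rule connD[OF cD, of _ d]) (use d DV nbr in blast)+
    then have "?D \<subseteq> U - Z" using DV by auto
    moreover have "w \<in> ?D \<union> X \<union> Z" if "a \<in> ?D" "w \<in> V" "E a w" for a w
      using component_closed[OF v(1) that(1)] that by auto
    ultimately show ?thesis using v(2) cD d by (intro exI[of _ ?D] exI[of _ d]) blast
  qed
  define k where "k = card \<C>"
  obtain e where e: "bij_betw e {0..<k} \<C>"
    using ex_bij_betw_nat_finite[OF fin] by (auto simp: k_def)
  have e\<C>: "e i \<in> \<C>" if "i < k" for i using e that by (auto simp: bij_betw_def)
  have esurj: "\<exists>i<k. C = e i" if "C \<in> \<C>" for C using e that by (force simp: bij_betw_def)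
  define A where "A i = {u\<in>U. \<exists>c\<in>e i. E u c}" for i
  have Ane: "A i \<noteq> {}" if "i < k" for i using adj[OF e\<C>[OF that]] by (auto simp: A_def)
  have "U \<noteq> {}" using U by (auto simp: conn_def)
  then consider (T) T where "T \<subseteq> U" "conn E T" "card T \<le> r" "\<forall>i<k. T \<inter> A i \<noteq> {}"
    | (Z) Z where "Z \<subseteq> U" "card Z * r \<le> (k - 1) * card U"
        "\<forall>W\<subseteq>U-Z. conn E W \<longrightarrow> (\<exists>i<k. W \<inter> A i = {})"
  proof -
    have "(\<exists>T\<subseteq>U. conn E T \<and> card T \<le> r \<and> (\<forall>i<k. T \<inter> A i \<noteq> {}))
      \<or> (\<exists>Z\<subseteq>U. card Z * r \<le> (k - 1) * card U \<and> (\<forall>W\<subseteq>U-Z. conn E W \<longrightarrow> (\<exists>i<k. W \<inter> A i = {})))"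
      using \<open>U \<noteq> {}\<close> Ane by (intro hitting_set_or_separator[OF fU _ _ _ r(1)]) (auto simp: A_def)
    then show ?thesis
    proof (elim disjE exE conjE)
      fix T assume "T \<subseteq> U" "conn E T" "card T \<le> r" "\<forall>i<k. T \<inter> A i \<noteq> {}"
      then show ?thesis by (rule that(1))
    next
      fix Z assume "Z \<subseteq> U" "card Z * r \<le> (k - 1) * card U"
        "\<forall>W\<subseteq>U-Z. conn E W \<longrightarrow> (\<exists>i<k. W \<inter> A i = {})"
      then show ?thesis by (rule that(2))
    qed
  qed
  then show ?thesis
  proof cases
    case T
    obtain D d where D: "d \<in> D" "D \<subseteq> U - T" "conn E D" "card V < 2 * card D"
      "\<forall>a\<in>D. \<forall>w\<in>V. E a w \<longrightarrow> w \<in> D \<union> X \<union> T"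
      using bigcomp[OF T(1,3)] by (elim exE conjE) (rule that)
    have Tadj: "\<exists>a\<in>T. \<exists>c\<in>C. E a c" if "C \<in> \<C>" for C
      using esurj[OF that] T(4) by (force simp: A_def)
    have TC: "T \<inter> C = {}" if "C \<in> \<C>" for C using C(4)[OF that] T(1) by auto
    have "covey E V r (insert T \<C>) (X \<union> T) D"
      unfolding covey_def
    proof (intro conjI ballI impI)
      fix C0 assume C0: "C0 \<in> insert T \<C>"
      show "conn E C0" using C0 T(2) C(1) by auto
      show "C0 \<subseteq> V" using C0 T(1) U(2) C(2)[of C0] by blast
      show "card ((X \<union> T) \<inter> C0) \<le> r"
      proof (cases "C0 = T")
        case True
        have "(X \<union> T) \<inter> T = T" by auto
        then show ?thesis using True T by simp
      next
        case False
        then have "(X \<union> T) \<inter> C0 = X \<inter> C0" using TC C0 by auto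
        then show ?thesis using False C0 C by simp
      qed
      show "D \<inter> C0 = {}" using C0 D(2) C(4)[of C0] by blast
      fix C1 assume C1: "C1 \<in> insert T \<C>" "C0 \<noteq> C1"
      have or: "C0 = T \<and> C1 \<in> \<C> \<or> C1 = T \<and> C0 \<in> \<C> \<or> C0 \<in> \<C> \<and> C1 \<in> \<C>" using C0 C1 by auto
      have Tadj': "\<exists>a\<in>C. \<exists>b\<in>T. E a b" if "C \<in> \<C>" for C using Tadj[OF that] sym by fast
      show "C0 \<inter> C1 = {}" using or TC Int_commute[of T] pw[OF _ _ C1(2)]
        by (elim disjE conjE) simp_all
      show "\<exists>a\<in>C0. \<exists>b\<in>C1. E a b"
        using or Tadj Tadj' pw[OF _ _ C1(2)] by (elim disjE conjE) simp_all
    next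
      fix a w assume "a \<in> D" "w \<in> V" "E a w"
      then show "w \<in> D \<union> (X \<union> T)" using D(5) by blast
    qed (use fin XC D U in auto)
    moreover have "card (insert T \<C>) \<le> Suc (card \<C>)" by (simp add: card_insert_if fin)
    moreover have "card D < card U"
    proof -
      have "T \<noteq> {}" using T(2) by (auto simp: conn_def)
      then have "D \<subset> U" using D(2) T(1) by auto
      then show ?thesis using fU by (rule psubset_card_mono[rotated])
    qed
    ultimately show ?thesis using D(4) by blast
  next
    case Z
    have "card Z * r \<le> r * r"
    proof -
      \<comment> \<open>With at most four branch sets the separator has at most 3 |V| / r vertices;
        this is why r is required to satisfy 3 |V| <= r^2.\<close>
      have "k - 1 \<le> 3" using cv(2) by (simp add: k_def)
      then have "(k - 1) * card U \<le> 3 * card V" using U V by (intro mult_mono card_mono) auto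
      then show ?thesis using Z(2) r(2) by linarith
    qed
    then have cZ: "card Z \<le> r" using r(1) by simp
    obtain D d where D: "d \<in> D" "D \<subseteq> U - Z" "conn E D" "card V < 2 * card D"
      "\<forall>a\<in>D. \<forall>w\<in>V. E a w \<longrightarrow> w \<in> D \<union> X \<union> Z"
      using bigcomp[OF Z(1) cZ] by (elim exE conjE) (rule that)
    obtain i where i: "i < k" "D \<inter> A i = {}" using Z(3)[rule_format, OF D(2,3)] by auto
    define C0 where "C0 = e i"
    have C0: "C0 \<in> \<C>" using e\<C> i by (simp add: C0_def)
    define W where "W = (\<Union>a\<in>A i. component E (U - D) a)"
    have AU: "A i \<subseteq> U - D" using i by (auto simp: A_def)
    have "component E (U - D) a \<subseteq> U - D" if "a \<in> A i" for a
      using that AU by (intro component_subset) auto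
    then have WU: "W \<subseteq> U - D" unfolding W_def by blast
    have AW: "A i \<subseteq> W" unfolding W_def using component_self[of _ E "U - D"] by blast
    define U' where "U' = component E (U - W) d"
    have dU: "d \<in> U - W" using D WU by auto
    have DU': "D \<subseteq> U'" unfolding U'_def
      by (rule conn_subset_component[OF dU D(3), of d]) (use D WU component_self in auto)
    have U'U: "U' \<subseteq> U - W" unfolding U'_def by (rule component_subset[OF dU])
    have cU': "conn E U'" unfolding U'_def by (rule conn_component[OF dU])
    define C' where "C' = C0 \<union> W"
    have conC': "conn E C'" unfolding C'_def W_def
    proof (rule conn_Union)
      fix a assume a: "a \<in> A i"
      then show "conn E (component E (U - D) a)" using AU by (intro conn_component) auto
      obtain c where "c \<in> C0" "E a c" using a by (auto simp: A_def C0_def)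
      then show "\<exists>c\<in>C0. \<exists>w\<in>component E (U - D) a. E c w"
        using sym[of a c] component_self[of a E "U - D"] by blast
    qed (use C C0 in auto)
    have WC: "W \<inter> C = {}" if "C \<in> \<C>" for C using C(4)[OF that] WU by auto
    have XW: "X \<inter> W = {}" using XU WU by auto
    let ?\<C> = "insert C' (\<C> - {C0})" and ?X = "(X - C0) \<union> (Z \<inter> W)"
    have "covey E V r ?\<C> ?X U'"
      unfolding covey_def
    proof (intro conjI ballI impI)
      fix C1 assume C1: "C1 \<in> ?\<C>"
      have or1: "C1 = C' \<or> (C1 \<in> \<C> \<and> C1 \<noteq> C0)" using C1 by auto
      show "conn E C1" using or1 conC' C(1) by auto
      show "C1 \<subseteq> V" using or1 C(2)[of C1] C(2)[OF C0] WU U(2) unfolding C'_def by blast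
      show "card (?X \<inter> C1) \<le> r"
        using or1
      proof
        assume "C1 = C'"
        then have "?X \<inter> C1 \<subseteq> Z" using XW by (auto simp: C'_def)
        then have "card (?X \<inter> C1) \<le> card Z"
          by (rule card_mono[OF finite_subset[OF Z(1) fU]])
        then show ?thesis using cZ by simp
      next
        assume *: "C1 \<in> \<C> \<and> C1 \<noteq> C0"
        then have "?X \<inter> C1 \<subseteq> X \<inter> C1" using WC by auto
        then have "card (?X \<inter> C1) \<le> card (X \<inter> C1)" using fX by (intro card_mono) auto
        then show ?thesis using C(3)[of C1] * by simp
      qed
      show "U' \<inter> C1 = {}" using or1 C(4)[OF C0] C(4)[of C1] U'U unfolding C'_def by blast
      fix C2 assume C2: "C2 \<in> ?\<C>" "C1 \<noteq> C2"
      have or2: "C2 = C' \<or> (C2 \<in> \<C> \<and> C2 \<noteq> C0)" using C2 by auto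
      have dj: "C' \<inter> C = {}" "C \<inter> C' = {}" "\<exists>a\<in>C'. \<exists>b\<in>C. E a b" if "C \<in> \<C>" "C \<noteq> C0" for C
        using pw[OF C0 that(1)] that WC[OF that(1)] unfolding C'_def by blast+
      have dj': "\<exists>a\<in>C. \<exists>b\<in>C'. E a b" if "C \<in> \<C>" "C \<noteq> C0" for C
        using dj(3)[OF that] sym by fast
      show "C1 \<inter> C2 = {}"
        using or1 or2 dj(1,2) pw[OF _ _ C2(2)] C2(2) by (elim disjE conjE) simp_all
      show "\<exists>a\<in>C1. \<exists>b\<in>C2. E a b"
        using or1 or2 dj(3) dj' pw[OF _ _ C2(2)] C2(2) by (elim disjE conjE) simp_all
    next
      fix a w assume a: "a \<in> U'" and w: "w \<in> V" and aw: "E a w"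
      have aU: "a \<in> U" "a \<notin> W" using a U'U by auto
      have "w \<notin> C0" using aU AW aw by (auto simp: A_def C0_def)
      moreover have "w \<in> Z" if wW: "w \<in> W"
      proof (rule ccontr)
        assume wZ: "w \<notin> Z"
        have wU: "w \<in> U" "w \<notin> D" "w \<notin> X" using wW WU XU by auto
        show False
        proof (cases "a \<in> D")
          case True
          then show False using D(5) w aw wU wZ by blast
        next
          case False
          obtain b where b: "b \<in> A i" "w \<in> component E (U - D) b" using wW by (auto simp: W_def)
          have "a \<in> component E (U - D) b"
            by (rule component_closed[OF _ b(2)]) (use b AU False aU sym[OF aw] in auto)
          then show False using aU b by (auto simp: W_def)
        qed
      qed
      moreover have "w \<in> U'" if "w \<in> U" "w \<notin> W"
        using component_closed[OF dU, of a E w] a aw that by (auto simp: U'_def)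
      ultimately show "w \<in> U' \<union> ?X" using nbr[OF aU(1) w aw] by blast
    next
      show "?X \<subseteq> \<Union>?\<C>" using XC by (auto simp: C'_def)
    qed (use fin U cU' U'U in auto)
    moreover have "card ?\<C> \<le> Suc (card \<C>)"
      using card_insert_le_m1 fin by (metis card_Diff1_le card_insert_if finite_Diff le_SucI not_less_eq_eq)
    moreover have "card V < 2 * card U'"
    proof -
      have "card D \<le> card U'" using DU' U'U fU finite_subset[of U' U] by (intro card_mono) auto
      then show ?thesis using D(4) by simp
    qed
    moreover have "card U' < card U"
    proof -
      have "U' \<subset> U" using U'U AW Ane[OF i(1)] WU by blast
      then show ?thesis using fU by (rule psubset_card_mono[rotated])
    qed
    ultimately show ?thesis by blast
  qed
qed

text \<open>If no small set separates, every family of at most five branch sets with a large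
  remainder can be continued for ever: refine it while there are at most four sets, and discard a
  set as soon as it has no neighbour in \<open>U\<close>. Five sets all adjacent to \<open>U\<close>
  would give a minor on six vertices.\<close>

theorem complete_minor_free_separator:
  assumes V: "finite V" and minor: "\<not> complete_minor E 6 V"
    and r: "r \<ge> 1" "3 * card V \<le> r * r"
  shows "\<exists>S\<subseteq>V. card S \<le> 5 * r \<and> (\<forall>v\<in>V-S. 2 * card (component E (V - S) v) \<le> card V)"
proof (rule ccontr)
  assume "\<not> ?thesis"
  then have big: "\<exists>v\<in>V-S. card V < 2 * card (component E (V - S) v)" if "S \<subseteq> V" "card S \<le> 5 * r" for S
    using that by (meson not_le)
  \<comment> \<open>In the measure a drop of |U| by one outweighs the possible gain of one branch
    set; a discarded branch set lowers the measure at fixed \<open>U\<close>.\<close>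
  have no: False if "covey E V r \<C> X U" "card \<C> \<le> 5" "card V < 2 * card U" for \<C> X U
    using that
  proof (induction "7 * card U + card \<C>" arbitrary: \<C> X U rule: less_induct)
    case less
    have fin: "finite \<C>" using less.prems(1) by (simp add: covey_def)
    show ?case
    proof (cases "\<forall>C\<in>\<C>. \<exists>u\<in>U. \<exists>c\<in>C. E u c")
      case True
      show ?thesis
      proof (cases "card \<C> = 5")
        case True
        then have "complete_minor E (Suc 5) V"
          using covey_complete_minor[OF less.prems(1) True] \<open>\<forall>C\<in>\<C>. _\<close> by blast
        then show False using minor by (simp add: eval_nat_numeral)
      next
        case False
        then have "card \<C> \<le> 4" using less.prems(2) by simp
        then obtain \<C>' X' U' where *: "covey E V r \<C>' X' U'" "card \<C>' \<le> Suc (card \<C>)"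
          "card V < 2 * card U'" "card U' < card U"
          using covey_refine[OF V big r less.prems(1) _ less.prems(3)] True by blast
        show False
          by (rule less.hyps[OF _ *(1) _ *(3)]) (use * \<open>card \<C> \<le> 4\<close> in auto)
      qed
    next
      case False
      then obtain C where C: "C \<in> \<C>" "\<forall>u\<in>U. \<forall>c\<in>C. \<not> E u c" by auto
      have "card (\<C> - {C}) < card \<C>" using C fin by (intro psubset_card_mono) auto
      moreover have "covey E V r (\<C> - {C}) (X - C) U"
      proof -
        have U: "conn E U" "U \<subseteq> V" and XC: "X \<subseteq> \<Union>\<C>"
          and nbr: "\<And>u w. u \<in> U \<Longrightarrow> w \<in> V \<Longrightarrow> E u w \<Longrightarrow> w \<in> U \<union> X"
          and C': "\<And>C. C \<in> \<C> \<Longrightarrow> conn E C" "\<And>C. C \<in> \<C> \<Longrightarrow> C \<subseteq> V" "\<And>C. C \<in> \<C> \<Longrightarrow> card (X \<inter> C) \<le> r"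
            "\<And>C. C \<in> \<C> \<Longrightarrow> U \<inter> C = {}"
          and pw: "\<And>C C'. C \<in> \<C> \<Longrightarrow> C' \<in> \<C> \<Longrightarrow> C \<noteq> C' \<Longrightarrow> C \<inter> C' = {} \<and> (\<exists>a\<in>C. \<exists>b\<in>C'. E a b)"
          using less.prems(1) by (auto simp: covey_def)
        have cX: "card ((X - C) \<inter> C1) \<le> r" if "C1 \<in> \<C>" for C1
        proof -
          have "finite (X \<inter> C1)" using finite_subset[OF C'(2)[OF that] V] by simp
          then have "card ((X - C) \<inter> C1) \<le> card (X \<inter> C1)" by (intro card_mono) auto
          then show ?thesis using C'(3)[OF that] by simp
        qed
        have nbr': "w \<in> U \<union> (X - C)" if "u \<in> U" "w \<in> V" "E u w" for u w
          using nbr[OF that] C(2) that by auto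
        show ?thesis unfolding covey_def
        proof (intro conjI ballI impI)
          fix C1 assume "C1 \<in> \<C> - {C}"
          then have C1: "C1 \<in> \<C>" by simp
          show "conn E C1" "C1 \<subseteq> V" "card ((X - C) \<inter> C1) \<le> r" "U \<inter> C1 = {}"
            by (rule C'(1,2,4)[OF C1] cX[OF C1])+
          fix C2 assume "C2 \<in> \<C> - {C}" "C1 \<noteq> C2"
          then show "C1 \<inter> C2 = {}" "\<exists>a\<in>C1. \<exists>b\<in>C2. E a b" using pw[OF C1, of C2] by simp_all
        next
          show "X - C \<subseteq> \<Union>(\<C> - {C})" using XC by blast
        qed (use fin U nbr' in simp_all)
      qed
      ultimately show False
        using less.hyps[of U "\<C> - {C}" "X - C"] less.prems by simp
    qed
  qed
  obtain v where v: "v \<in> V" "card V < 2 * card (component E V v)" using big[of "{}"] by auto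
  have "covey E V r {} {} (component E V v)"
    unfolding covey_def using conn_component[OF v(1)] component_subset[OF v(1)] component_closed[OF v(1)] by auto
  from no[OF this] v(2) show False by simp
qed

text \<open>Take a smallest union \<open>Q\<close> of components with at least |V| / 5 vertices. If
  the other components had fewer than |V| / 5, then |Q| > 7/10 |V| - 1/5 |V| = |V| / 2. By
  minimality, removing one component K leaves less than |V| / 5, so K alone has more than 3/10 |V|
  and is admissible itself; minimality then gives |Q| <= |K| <= |V| / 2.\<close>

theorem balanced_separation:
  assumes V: "finite V" and S: "S \<subseteq> V" "10 * card S \<le> 3 * card V"
    and comp: "\<And>v. v \<in> V - S \<Longrightarrow> 2 * card (component E (V - S) v) \<le> card V"
  shows "\<exists>A\<subseteq>V-S. card V \<le> 5 * card A \<and> card V \<le> 5 * card (V - S - A)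
    \<and> (\<forall>a\<in>A. \<forall>b\<in>V-S-A. \<not> E a b)"
proof -
  let ?M = "V - S"
  have fM: "finite ?M" using V by simp
  have cM: "card ?M + card S = card V" using S(1) V by (simp add: card_Diff_subset finite_subset card_mono)
  define closed where "closed Q \<longleftrightarrow> Q \<subseteq> ?M \<and> (\<forall>a\<in>Q. \<forall>b\<in>?M. E a b \<longrightarrow> b \<in> Q)" for Q
  define good where "good Q \<longleftrightarrow> closed Q \<and> card V \<le> 5 * card Q" for Q
  have "good ?M" using cM S(2) by (auto simp: good_def closed_def)
  then obtain Q where Q: "good Q" "\<And>Q'. good Q' \<Longrightarrow> card Q \<le> card Q'"
    using ex_has_least_nat[of good ?M card] by blast
  have QM: "Q \<subseteq> ?M" using Q by (simp add: good_def closed_def)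
  have fQ: "finite Q" using QM fM finite_subset by auto
  have "card V \<le> 5 * card (?M - Q)"
  proof (rule ccontr)
    assume "\<not> card V \<le> 5 * card (?M - Q)"
    moreover have "card (?M - Q) + card Q = card ?M"
      using QM fM by (metis card_Diff_subset card_mono fQ le_add_diff_inverse2)
    ultimately have Qbig: "5 * card ?M < card V + 5 * card Q" by linarith
    have "card Q > 0"
      using Q(1) S(2) Qbig cM by (auto simp: good_def)
    then obtain v where v: "v \<in> Q" by fastforce
    then have vM: "v \<in> ?M" using QM by auto
    let ?K = "component E ?M v"
    have "conn E ?K" by (rule conn_component[OF vM])
    then have "?K \<subseteq> ?K \<inter> Q"
    proof (rule connD)
      show "v \<in> ?K \<inter> Q" using v component_self by auto
      fix a b assume "a \<in> ?K \<inter> Q" "b \<in> ?K" "E a b"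
      then show "b \<in> ?K \<inter> Q"
        using Q(1) component_subset[OF vM] unfolding good_def closed_def by blast
    qed auto
    then have KQ: "?K \<subseteq> Q" by auto
    have Kc: "closed ?K" using component_subset[OF vM] component_closed[OF vM] by (auto simp: closed_def)
    have K2: "2 * card ?K \<le> card V" by (rule comp[OF vM])
    have cK: "card (Q - ?K) + card ?K = card Q"
      using KQ fQ by (metis card_Diff_subset card_mono finite_subset le_add_diff_inverse2)
    have Kpos: "card ?K > 0" using component_self[of v E ?M] finite_subset[OF KQ fQ] by (auto simp: card_gt_0_iff)
    have "closed (Q - ?K)"
      unfolding closed_def
    proof (intro conjI ballI impI)
      fix a b assume ab: "a \<in> Q - ?K" "b \<in> ?M" "E a b"
      have "b \<in> Q" using ab Q(1) by (auto simp: good_def closed_def)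
      moreover have "b \<notin> ?K" using Kc ab QM sym[OF ab(3)] unfolding closed_def by blast
      ultimately show "b \<in> Q - ?K" by simp
    qed (use QM in auto)
    then have "5 * card (Q - ?K) < card V"
      using Q(2)[of "Q - ?K"] cK Kpos by (force simp: good_def)
    then have "card V \<le> 5 * card ?K" using cK Qbig cM S(2) by linarith
    then have "card Q \<le> card ?K" using Kc Q(2) by (simp add: good_def)
    then show False using K2 Qbig cM S(2) by linarith
  qed
  then show ?thesis
    using Q(1) QM unfolding good_def closed_def by (intro exI[of _ Q]) blast
qed

end

section \<open>Planar graphs have no complete minor on six vertices\<close>

text \<open>Provides the limit points at which an open chord touches the closed curve.\<close>

lemma arc_endpoints_in_closure:
  fixes d :: "real \<Rightarrow> complex"
  assumes "arc d"
  shows "path_image d \<subseteq> closure (path_image d - {pathstart d, pathfinish d})"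
proof -
  have eq: "path_image d - {pathstart d, pathfinish d} = d ` {0<..<1}"
    using simple_path_endless[OF arc_imp_simple_path[OF assms]] .
  have "continuous_on (closure {0<..<1::real}) d"
    using arc_imp_path[OF assms] by (simp add: path_def)
  then have "d ` closure {0<..<1} \<subseteq> closure (d ` {0<..<1})"
    by (rule image_closure_subset) (auto simp: closure_subset)
  then show ?thesis unfolding eq by (simp add: path_image_def)
qed

lemma closed_two_arcs:
  fixes c1 c2 :: "real \<Rightarrow> complex"
  shows "arc c1 \<Longrightarrow> arc c2 \<Longrightarrow> closed (path_image c1 \<union> path_image c2)"
  by (intro closed_Un closed_path_image arc_imp_path)

lemma simple_closed_two_arcs:
  fixes c1 c2 :: "real \<Rightarrow> complex"
  assumes "arc c1" "pathstart c1 = a" "pathfinish c1 = b" "arc c2" "pathstart c2 = a" "pathfinish c2 = b"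
    and "path_image c1 \<inter> path_image c2 = {a,b}"
  shows "simple_path (c1 +++ reversepath c2)"
    "pathfinish (c1 +++ reversepath c2) = pathstart (c1 +++ reversepath c2)"
    "path_image (c1 +++ reversepath c2) = path_image c1 \<union> path_image c2"
  using assms by (auto simp: path_image_join arc_reversepath intro!: simple_path_join_loop)

text \<open>By the theta-curve form of the Jordan curve theorem, the chord \<open>c\<close> splits
  the inside into two regions bounded by \<open>c1\<close> with \<open>c\<close> and by
  \<open>c2\<close> with \<open>c\<close>. A connected set off \<open>c\<close> lies in one of them,
  whose closure misses the interior of the other boundary arc.\<close>

lemma no_crossing_inside:
  fixes c1 c2 c :: "real \<Rightarrow> complex"
  assumes c1: "arc c1" "pathstart c1 = a" "pathfinish c1 = b"
    and c2: "arc c2" "pathstart c2 = a" "pathfinish c2 = b"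
    and c: "arc c" "pathstart c = a" "pathfinish c = b"
    and i12: "path_image c1 \<inter> path_image c2 = {a,b}"
    and i1: "path_image c1 \<inter> path_image c = {a,b}"
    and i2: "path_image c2 \<inter> path_image c = {a,b}"
    and cin: "path_image c - {a,b} \<subseteq> inside (path_image c1 \<union> path_image c2)"
    and D: "connected D" "D \<subseteq> inside (path_image c1 \<union> path_image c2)" "D \<inter> path_image c = {}"
    and p: "p \<in> path_image c1 - {a,b}" "p \<in> closure D"
    and q: "q \<in> path_image c2 - {a,b}" "q \<in> closure D"
  shows False
proof -
  note sp = arc_imp_simple_path[OF c1(1)] arc_imp_simple_path[OF c2(1)] arc_imp_simple_path[OF c(1)]
  have ab: "a \<noteq> b" using arc_distinct_ends[OF c1(1)] c1 by auto
  have "path_image c - {a,b} \<noteq> {}" using nonempty_simple_path_endless[OF sp(3)] c by simp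
  then have ne: "path_image c \<inter> inside (path_image c1 \<union> path_image c2) \<noteq> {}" using cin by auto
  let ?I1 = "inside (path_image c1 \<union> path_image c)" and ?I2 = "inside (path_image c2 \<union> path_image c)"
  from split_inside_simple_closed_curve[OF sp(1) c1(2,3) sp(2) c2(2,3) sp(3) c(2,3) ab i12 i1 i2 ne]
  have dj: "?I1 \<inter> ?I2 = {}"
    and un: "?I1 \<union> ?I2 \<union> (path_image c - {a,b}) = inside (path_image c1 \<union> path_image c2)"
    by (metis, metis)
  have "open ?I1" "open ?I2" using closed_two_arcs c1(1) c2(1) c(1) by (auto intro!: open_inside)
  moreover have "D \<subseteq> ?I1 \<union> ?I2" using D un by auto
  ultimately have "?I1 \<inter> D = {} \<or> ?I2 \<inter> D = {}" using dj by (intro connectedD[OF D(1)]) auto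
  then have "D \<subseteq> ?I1 \<or> D \<subseteq> ?I2" using \<open>D \<subseteq> ?I1 \<union> ?I2\<close> by auto
  then show False
  proof
    assume "D \<subseteq> ?I1"
    then have "q \<in> closure ?I1" using q closure_mono by blast
    then have "q \<in> path_image c1 \<union> path_image c \<union> ?I1"
      using closure_inside_subset[OF closed_two_arcs[OF c1(1) c(1)]] by auto
    moreover have "q \<notin> path_image c1" "q \<notin> path_image c" using q i12 i2 by auto
    ultimately have "q \<in> inside (path_image c1 \<union> path_image c2)" using un by auto
    then show False using q inside_no_overlap[of "path_image c1 \<union> path_image c2"] by blast
  next
    assume "D \<subseteq> ?I2"
    then have "p \<in> closure ?I2" using p closure_mono by blast
    then have "p \<in> path_image c2 \<union> path_image c \<union> ?I2"
      using closure_inside_subset[OF closed_two_arcs[OF c2(1) c(1)]] by auto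
    moreover have "p \<notin> path_image c2" "p \<notin> path_image c" using p i12 i1 by auto
    ultimately have "p \<in> inside (path_image c1 \<union> path_image c2)" using un by auto
    then show False using p inside_no_overlap[of "path_image c1 \<union> path_image c2"] by blast
  qed
qed

text \<open>The inversion sends the punctured inside to an unbounded connected set, which must lie
  outside the image curve. If the image of the outside lay there too, the inside of the image curve
  could contain only 0, the one point not attained away from \<open>w\<close>; but it is open and
  nonempty.\<close>

lemma inversion_outside_subset_inside:
  fixes g :: "real \<Rightarrow> complex"
  assumes g: "simple_path g" "pathfinish g = pathstart g" and w: "w \<in> inside (path_image g)"
  defines "h \<equiv> \<lambda>z. inverse (z - w)"
  shows "h ` outside (path_image g) \<subseteq> inside (h ` path_image g)"
proof -
  let ?S = "path_image g"
  have wS: "w \<notin> ?S" "w \<notin> outside ?S"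
    using w inside_no_overlap[of ?S] inside_Int_outside[of ?S] by blast+
  \<comment> \<open>Because \<open>inverse 0 = 0\<close>, \<open>h\<close> is injective on the whole
    plane, with \<open>h w = 0\<close>.\<close>
  have inj: "inj h" by (auto simp: h_def inj_on_def)
  have cont: "continuous_on A h" if "w \<notin> A" for A
    unfolding h_def using that by (intro continuous_intros) auto
  have J: "connected (inside ?S)" "open (inside ?S)" "connected (outside ?S)"
    "inside ?S \<union> outside ?S = - ?S"
    using Jordan_inside_outside[OF g] by auto
  have hg: "simple_path (h \<circ> g)" "pathfinish (h \<circ> g) = pathstart (h \<circ> g)"
    using simple_path_continuous_image[OF g(1) cont[OF wS(1)]] inj g(2) inj_on_subset[OF inj, of ?S]
    by (auto simp: pathfinish_def pathstart_def)
  have im: "path_image (h \<circ> g) = h ` ?S" by (simp add: path_image_compose)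
  let ?T = "h ` ?S"
  have J': "open (inside ?T)" "open (outside ?T)" "inside ?T \<noteq> {}" "bounded (inside ?T)"
    using Jordan_inside_outside[OF hg] unfolding im by auto
  have side: "A \<subseteq> inside ?T \<or> A \<subseteq> outside ?T" if "connected A" "A \<inter> ?T = {}" for A
  proof -
    have sub: "A \<subseteq> inside ?T \<union> outside ?T" using that(2) by (auto simp: inside_Un_outside)
    have "inside ?T \<inter> A = {} \<or> outside ?T \<inter> A = {}"
      by (rule connectedD[OF that(1) J'(1,2) _ sub]) (simp add: Int_assoc[symmetric])
    then show ?thesis using sub by blast
  qed
  have O: "connected (h ` outside ?S)" "h ` outside ?S \<inter> ?T = {}"
    using connected_continuous_image[OF cont[OF wS(2)] J(3)] image_Int[OF inj, of "outside ?S" ?S]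
      outside_no_overlap[of ?S] by simp_all
  have I: "connected (h ` (inside ?S - {w}))" "h ` (inside ?S - {w}) \<inter> ?T = {}"
  proof -
    have "connected (inside ?S - {w})" by (rule connected_open_delete[OF J(2,1)]) simp
    then show "connected (h ` (inside ?S - {w}))" by (intro connected_continuous_image cont) auto
    show "h ` (inside ?S - {w}) \<inter> ?T = {}"
      using image_Int[OF inj, of "inside ?S - {w}" ?S] inside_no_overlap[of ?S] by blast
  qed
  have unb: "\<not> bounded (h ` (inside ?S - {w}))"
  proof
    assume "bounded (h ` (inside ?S - {w}))"
    then obtain B where B: "B > 0" "\<And>z. z \<in> inside ?S - {w} \<Longrightarrow> norm (h z) \<le> B"
      unfolding bounded_pos by blast
    obtain e where e: "e > 0" "ball w e \<subseteq> inside ?S" using J(2) w open_contains_ball by blast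
    define s where "s = min (e / 2) (1 / (B + 1))"
    have s: "s > 0" "s < e" "s \<le> 1 / (B + 1)" using e B by (auto simp: s_def min_def)
    define z where "z = w + of_real s"
    have "z \<in> inside ?S - {w}" using s e by (auto simp: z_def dist_norm subset_iff)
    then have "norm (h z) \<le> B" by (rule B)
    moreover have "norm (h z) = 1 / s" using s by (simp add: h_def z_def norm_inverse divide_inverse)
    moreover have "1 / s \<ge> B + 1" using s B by (simp add: field_simps)
    ultimately show False by simp
  qed
  show ?thesis
  proof (rule ccontr)
    assume "\<not> h ` outside ?S \<subseteq> inside ?T"
    then have Oout: "h ` outside ?S \<subseteq> outside ?T" using side[OF O] by blast
    have Iout: "h ` (inside ?S - {w}) \<subseteq> outside ?T" using side[OF I] unb J'(4) bounded_subset by blast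
    have "inside ?T \<subseteq> {0}"
    proof
      fix y assume y: "y \<in> inside ?T"
      show "y \<in> {0}"
      proof (rule ccontr)
        assume "y \<notin> {0}"
        define z where "z = w + inverse y"
        have z: "h z = y" "z \<noteq> w" using \<open>y \<notin> {0}\<close> by (auto simp: h_def z_def)
        have "z \<notin> ?S" using y z inside_no_overlap[of ?T] by blast
        then have "z \<in> inside ?S - {w} \<or> z \<in> outside ?S" using J(4) z(2) by blast
        then have "y \<in> outside ?T" using z Oout Iout by blast
        then show False using y inside_Int_outside[of ?T] by blast
      qed
    qed
    then have "inside ?T = {0}" using J'(3) by blast
    then show False using J'(1) not_open_singleton by metis
  qed
qed

text \<open>Inversion about a point inside the curve carries the configuration to the previous
  situation. The centre avoids the chord and the closure of \<open>D\<close>, so continuity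
  transports arcs and limit points.\<close>

lemma no_crossing_outside:
  fixes c1 c2 c :: "real \<Rightarrow> complex"
  assumes c1: "arc c1" "pathstart c1 = a" "pathfinish c1 = b"
    and c2: "arc c2" "pathstart c2 = a" "pathfinish c2 = b"
    and c: "arc c" "pathstart c = a" "pathfinish c = b"
    and i12: "path_image c1 \<inter> path_image c2 = {a,b}"
    and i1: "path_image c1 \<inter> path_image c = {a,b}"
    and i2: "path_image c2 \<inter> path_image c = {a,b}"
    and cout: "path_image c - {a,b} \<subseteq> outside (path_image c1 \<union> path_image c2)"
    and D: "connected D" "D \<subseteq> outside (path_image c1 \<union> path_image c2)" "D \<inter> path_image c = {}"
    and p: "p \<in> path_image c1 - {a,b}" "p \<in> closure D"
    and q: "q \<in> path_image c2 - {a,b}" "q \<in> closure D"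
  shows False
proof -
  note g = simple_closed_two_arcs[OF c1 c2 i12]
  let ?S = "path_image c1 \<union> path_image c2"
  have J: "inside ?S \<noteq> {}" "open (inside ?S)" using Jordan_inside_outside[OF g(1,2)] unfolding g(3) by auto
  obtain w where w: "w \<in> inside ?S" using J by auto
  have wS: "w \<notin> ?S" "w \<notin> outside ?S"
    using w inside_no_overlap[of ?S] inside_Int_outside[of ?S] by blast+
  define h where "h = (\<lambda>z. inverse (z - w))"
  have inj: "inj h" by (auto simp: h_def inj_on_def)
  have cont: "continuous_on A h" if "w \<notin> A" for A
    unfolding h_def using that by (intro continuous_intros) auto
  have out: "h ` outside ?S \<subseteq> inside (h ` ?S)"
    using inversion_outside_subset_inside[OF g(1,2)] w unfolding g(3) h_def by simp
  have wc: "w \<notin> path_image c" using wS cout i1 by (cases "w \<in> {a,b}") auto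
  have arc: "arc (h \<circ> d) \<and> pathstart (h \<circ> d) = h a \<and> pathfinish (h \<circ> d) = h b \<and> path_image (h \<circ> d) = h ` path_image d"
    if "arc d" "pathstart d = a" "pathfinish d = b" "w \<notin> path_image d" for d
  proof -
    have "simple_path (h \<circ> d)"
      by (rule simple_path_continuous_image[OF arc_imp_simple_path[OF that(1)] cont[OF that(4)]])
        (rule inj_on_subset[OF inj], simp)
    moreover have "h a \<noteq> h b" using arc_distinct_ends[OF that(1)] that injD[OF inj] by auto
    moreover have se: "pathstart (h \<circ> d) = h a" "pathfinish (h \<circ> d) = h b"
      using that(2,3) by (auto simp: pathstart_def pathfinish_def)
    ultimately have "arc (h \<circ> d)" by (metis simple_path_imp_arc)
    then show ?thesis using se by (simp add: path_image_compose)
  qed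
  have w12: "w \<notin> path_image c1" "w \<notin> path_image c2" using wS by auto
  note a1 = arc[OF c1 w12(1)] and a2 = arc[OF c2 w12(2)] and a3 = arc[OF c wc]
  have int: "h ` A \<inter> h ` B = h ` (A \<inter> B)" for A B using image_Int[OF inj] by simp
  have "w \<notin> closure D"
  proof
    assume "w \<in> closure D"
    moreover have "inside ?S \<inter> D = {}" using D(2) inside_Int_outside[of ?S] by blast
    ultimately show False using w J(2) open_Int_closure_eq_empty by blast
  qed
  then have cl: "h ` closure D \<subseteq> closure (h ` D)"
    by (intro image_closure_subset cont) (auto simp: closure_subset)
  have wD: "w \<notin> D" using \<open>w \<notin> closure D\<close> closure_subset by blast
  have S': "path_image (h \<circ> c1) \<union> path_image (h \<circ> c2) = h ` ?S" using a1 a2 by auto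
  have diff: "h ` A - {h a, h b} = h ` (A - {a,b})" for A using injD[OF inj] by auto
  show False
  proof (rule no_crossing_inside[of "h \<circ> c1" "h a" "h b" "h \<circ> c2" "h \<circ> c" "h ` D" "h p" "h q"])
    show "path_image (h \<circ> c) - {h a, h b} \<subseteq> inside (path_image (h \<circ> c1) \<union> path_image (h \<circ> c2))"
      unfolding S' using a3 cout out by (auto simp: diff)
    show "h ` D \<subseteq> inside (path_image (h \<circ> c1) \<union> path_image (h \<circ> c2))"
      unfolding S' using D(2) out by auto
    show "connected (h ` D)" using D(1) wD by (intro connected_continuous_image cont)
    show "h ` D \<inter> path_image (h \<circ> c) = {}" using a3 D(3) by (simp add: int)
    show "h p \<in> closure (h ` D)" "h q \<in> closure (h ` D)" using p q cl by auto
    show "h p \<in> path_image (h \<circ> c1) - {h a, h b}" "h q \<in> path_image (h \<circ> c2) - {h a, h b}"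
      using p q a1 a2 by (auto simp: diff)
  qed (use a1 a2 a3 i12 i1 i2 in \<open>auto simp: int\<close>)
qed

section \<open>Non-planarity of K_{3,3}\<close>

definition K33_drawing :: "(nat \<Rightarrow> nat \<Rightarrow> real \<Rightarrow> complex) \<Rightarrow> (nat \<Rightarrow> complex) \<Rightarrow> (nat \<Rightarrow> complex) \<Rightarrow> bool" where
  "K33_drawing P x y \<longleftrightarrow>
    (\<forall>i<3. \<forall>j<3. arc (P i j) \<and> pathstart (P i j) = x i \<and> pathfinish (P i j) = y j)
    \<and> (\<forall>i<3. \<forall>j<3. \<forall>i'<3. \<forall>j'<3. (i,j) \<noteq> (i',j') \<longrightarrow> path_image (P i j) \<inter> path_image (P i' j')
        \<subseteq> (if i = i' then {x i} else {}) \<union> (if j = j' then {y j} else {}))"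

text \<open>The 6-cycle x0 y0 x1 y1 x2 y2, grouped as two arcs from x0 to y1. The other three edges,
  \<open>P 0 1\<close>, \<open>P 1 2\<close> and \<open>P 2 0\<close>, are its long
  diagonals.\<close>

abbreviation hexagon :: "(nat \<Rightarrow> nat \<Rightarrow> real \<Rightarrow> complex) \<Rightarrow> complex set" where
  "hexagon P \<equiv> (path_image (P 0 0) \<union> (path_image (P 1 0) \<union> path_image (P 1 1)))
    \<union> (path_image (P 0 2) \<union> (path_image (P 2 2) \<union> path_image (P 2 1)))"

abbreviation open_arc :: "(real \<Rightarrow> complex) \<Rightarrow> complex set" where
  "open_arc d \<equiv> path_image d - {pathstart d, pathfinish d}"

text \<open>The diagonal \<open>P 0 1\<close> joins the ends of the two arcs. The ends x1 and y2 of
  \<open>P 1 2\<close> are interior to different arcs, so the two diagonals cannot lie on the same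
  side of the hexagon.\<close>

lemma K33_chords:
  assumes K: "K33_drawing P x y"
  shows "\<not> (open_arc (P 0 1) \<subseteq> inside (hexagon P) \<and> open_arc (P 1 2) \<subseteq> inside (hexagon P))"
    and "\<not> (open_arc (P 0 1) \<subseteq> outside (hexagon P) \<and> open_arc (P 1 2) \<subseteq> outside (hexagon P))"
    and "open_arc (P 0 1) \<subseteq> inside (hexagon P) \<or> open_arc (P 0 1) \<subseteq> outside (hexagon P)"
proof -
  have A: "arc (P i j)" "pathstart (P i j) = x i" "pathfinish (P i j) = y j" if "i < 3" "j < 3" for i j
    using K that by (auto simp: K33_drawing_def)
  have ends: "x i \<in> path_image (P i j)" "y j \<in> path_image (P i j)" if "i < 3" "j < 3" for i j
    using A[OF that] by (metis pathstart_in_path_image, metis pathfinish_in_path_image)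
  have I: "path_image (P i j) \<inter> path_image (P i' j')
      \<subseteq> (if i = i' then {x i} else {}) \<union> (if j = j' then {y j} else {})"
    if "i < 3" "j < 3" "i' < 3" "j' < 3" "(i,j) \<noteq> (i',j')" for i j i' j'
    using K that unfolding K33_drawing_def by blast
  have Ii: "path_image (P i j) \<inter> path_image (P i j') = {x i}" if "i < 3" "j < 3" "j' < 3" "j \<noteq> j'" for i j j'
    using I[of i j i j'] that ends[of i j] ends[of i j'] by auto
  have Ij: "path_image (P i j) \<inter> path_image (P i' j) = {y j}" if "i < 3" "i' < 3" "j < 3" "i \<noteq> i'" for i i' j
    using I[of i j i' j] that ends[of i j] ends[of i' j] by auto
  have I0: "path_image (P i j) \<inter> path_image (P i' j') = {}"
    if "i < 3" "j < 3" "i' < 3" "j' < 3" "i \<noteq> i'" "j \<noteq> j'" for i j i' j'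
    using I[of i j i' j'] that by simp
  have xx: "x i \<noteq> x i'" if "i < 3" "i' < 3" "i \<noteq> i'" for i i'
    using I0[of i 0 i' 1] ends[of i 0] ends[of i' 1] that by auto
  have yy: "y j \<noteq> y j'" if "j < 3" "j' < 3" "j \<noteq> j'" for j j'
    using I0[of 0 j 1 j'] ends[of 0 j] ends[of 1 j'] that by auto
  have xy: "x i \<noteq> y j" if "i < 3" "j < 3" for i j
    using A[OF that] arc_distinct_ends by metis
  define c1 where "c1 = P 0 0 +++ (reversepath (P 1 0) +++ P 1 1)"
  define c2 where "c2 = P 0 2 +++ (reversepath (P 2 2) +++ P 2 1)"
  have im1: "path_image c1 = path_image (P 0 0) \<union> (path_image (P 1 0) \<union> path_image (P 1 1))"
    and im2: "path_image c2 = path_image (P 0 2) \<union> (path_image (P 2 2) \<union> path_image (P 2 1))"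
    unfolding c1_def c2_def by (simp_all add: path_image_join A)
  have c1: "arc c1" "pathstart c1 = x 0" "pathfinish c1 = y 1"
    unfolding c1_def
    using Ij[of 0 1 0] I0[of 0 0 1 1] Ii[of 1 0 1]
    by (auto intro!: arc_join simp: A arc_reversepath path_image_join)
  have c2: "arc c2" "pathstart c2 = x 0" "pathfinish c2 = y 1"
    unfolding c2_def
    using Ij[of 0 2 2] I0[of 0 2 2 1] Ii[of 2 2 1]
    by (auto intro!: arc_join simp: A arc_reversepath path_image_join)
  have i12: "path_image c1 \<inter> path_image c2 = {x 0, y 1}"
    unfolding im1 im2 Int_Un_distrib Int_Un_distrib2 by (simp add: Ii Ij I0) blast
  have i1: "path_image c1 \<inter> path_image (P 0 1) = {x 0, y 1}"
    unfolding im1 Int_Un_distrib Int_Un_distrib2 by (auto simp: Ii Ij I0)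
  have i2: "path_image c2 \<inter> path_image (P 0 1) = {x 0, y 1}"
    unfolding im2 Int_Un_distrib Int_Un_distrib2 by (auto simp: Ii Ij I0)
  have H: "hexagon P = path_image c1 \<union> path_image c2" unfolding im1 im2 by simp
  let ?D = "open_arc (P 1 2)"
  have D: "connected ?D" by (intro connected_simple_path_endless arc_imp_simple_path A) auto
  have Dc: "?D \<inter> path_image (P 0 1) = {}" using I0[of 1 2 0 1] by auto
  have p: "x 1 \<in> path_image c1 - {x 0, y 1}" "x 1 \<in> closure ?D"
    using ends[of 1 0] xx[of 1 0] xy[of 1 1] arc_endpoints_in_closure[OF A(1)[of 1 2]] ends[of 1 2]
    by (auto simp: im1)
  have q: "y 2 \<in> path_image c2 - {x 0, y 1}" "y 2 \<in> closure ?D"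
    using ends[of 0 2] yy[of 2 1] xy[of 0 2] arc_endpoints_in_closure[OF A(1)[of 1 2]] ends[of 1 2]
    by (auto simp: im2)
  have a01: "arc (P 0 1)" "pathstart (P 0 1) = x 0" "pathfinish (P 0 1) = y 1" by (simp_all add: A)
  show "\<not> (open_arc (P 0 1) \<subseteq> inside (hexagon P) \<and> ?D \<subseteq> inside (hexagon P))"
    unfolding H a01
    using no_crossing_inside[OF c1 c2 a01 i12 i1 i2 _ D _ Dc p q] by blast
  show "\<not> (open_arc (P 0 1) \<subseteq> outside (hexagon P) \<and> ?D \<subseteq> outside (hexagon P))"
    unfolding H a01
    using no_crossing_outside[OF c1 c2 a01 i12 i1 i2 _ D _ Dc p q] by blast
  have con: "connected (open_arc (P 0 1))" using connected_simple_path_endless arc_imp_simple_path a01(1) by blast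
  note g = simple_closed_two_arcs[OF c1 c2 i12]
  have op: "open (inside (hexagon P))" "open (outside (hexagon P))"
    using Jordan_inside_outside[OF g(1,2)] unfolding g(3) H by auto
  have "open_arc (P 0 1) \<inter> hexagon P = {}" unfolding H using i1 i2 a01 by auto
  then have sub: "open_arc (P 0 1) \<subseteq> inside (hexagon P) \<union> outside (hexagon P)"
    by (auto simp: inside_Un_outside)
  have "inside (hexagon P) \<inter> open_arc (P 0 1) = {} \<or> outside (hexagon P) \<inter> open_arc (P 0 1) = {}"
    by (rule connectedD[OF con op _ sub]) (simp add: Int_assoc[symmetric])
  then show "open_arc (P 0 1) \<subseteq> inside (hexagon P) \<or> open_arc (P 0 1) \<subseteq> outside (hexagon P)"
    using sub by blast
qed

text \<open>The hexagon has two sides and three diagonals, no two of which share a side. Shifting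
  both index sets cyclically by \<open>s\<close> preserves the hexagon and permutes the diagonals,
  so one pair suffices.\<close>

theorem no_K33_drawing: "\<not> K33_drawing P x y"
proof
  assume K: "K33_drawing P x y"
  define s :: "nat \<Rightarrow> nat" where "s i = (if i = 2 then 0 else i + 1)" for i
  have s: "s i = s j \<longleftrightarrow> i = j" if "i < 3" "j < 3" for i j
    using that by (auto simp: s_def)
  have sl: "s i < 3" if "i < 3" for i using that by (auto simp: s_def)
  have rot: "K33_drawing (\<lambda>i j. P (s i) (s j)) (\<lambda>i. x (s i)) (\<lambda>j. y (s j))" if "K33_drawing P x y" for P x y
    unfolding K33_drawing_def
  proof (intro conjI allI impI)
    fix i j :: nat assume ij: "i < 3" "j < 3"
    show "arc (P (s i) (s j))" "pathstart (P (s i) (s j)) = x (s i)" "pathfinish (P (s i) (s j)) = y (s j)"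
      using that sl ij by (auto simp: K33_drawing_def)
    fix i' j' assume ij': "i' < (3::nat)" "j' < (3::nat)" "(i,j) \<noteq> (i',j')"
    then have "(s i, s j) \<noteq> (s i', s j')" using s ij by auto
    then have "path_image (P (s i) (s j)) \<inter> path_image (P (s i') (s j'))
        \<subseteq> (if s i = s i' then {x (s i)} else {}) \<union> (if s j = s j' then {y (s j)} else {})"
      using conjunct2[OF that[unfolded K33_drawing_def], rule_format,
          of "s i" "s j" "s i'" "s j'"] sl ij ij' by simp
    then show "path_image (P (s i) (s j)) \<inter> path_image (P (s i') (s j'))
        \<subseteq> (if i = i' then {x (s i)} else {}) \<union> (if j = j' then {y (s j)} else {})"
      using s[OF ij(1) ij'(1)] s[OF ij(2) ij'(2)] by simp
  qed
  have sv: "s 0 = 1" "s 1 = 2" "s 2 = 0" by (auto simp: s_def)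
  note K1 = rot[OF K] and K2 = rot[OF rot[OF K]]
  define H where "H = hexagon P"
  have H1: "H = hexagon (\<lambda>i j. P (s i) (s j))" and H2: "H = hexagon (\<lambda>i j. P (s (s i)) (s (s j)))"
    unfolding H_def sv by auto
  note C0 = K33_chords[OF K, folded H_def] and C1 = K33_chords[OF K1, folded H1, unfolded sv]
    and C2 = K33_chords[OF K2, folded H2, unfolded sv]
  show False using C0 C1 C2 by argo
qed

section \<open>From a K_6 minor to a subdivided K_{3,3}\<close>

definition walk :: "('a \<Rightarrow> 'a \<Rightarrow> bool) \<Rightarrow> 'a set \<Rightarrow> 'a list \<Rightarrow> 'a \<Rightarrow> 'a \<Rightarrow> bool" where
  "walk E B l s t \<longleftrightarrow> l \<noteq> [] \<and> distinct l \<and> successively E l \<and> set l \<subseteq> B \<and> hd l = s \<and> last l = t"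

lemma walk_split:
  assumes l: "walk E B (xs @ z # ys) s t"
  shows "walk E B (xs @ [z]) s z" "walk E B (z # ys) z t"
proof -
  have "successively E ((xs @ [z]) @ ys)" "successively E (xs @ z # ys)"
    using l by (simp_all add: walk_def)
  then have "successively E (xs @ [z])" "successively E (z # ys)"
    by (simp_all only: successively_append_iff)
  then show "walk E B (xs @ [z]) s z" "walk E B (z # ys) z t"
    using l by (cases xs; auto simp: walk_def)+
qed

lemma conn_walk:
  assumes B: "conn E B" and st: "s \<in> B" "t \<in> B"
  shows "\<exists>l. walk E B l s t"
proof -
  have "B \<subseteq> {t\<in>B. \<exists>l. walk E B l s t}"
  proof (rule connD[OF B])
    show "s \<in> {t\<in>B. \<exists>l. walk E B l s t}"
      using st by (auto simp: walk_def intro!: exI[of _ "[s]"])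
    fix a b assume "a \<in> {t\<in>B. \<exists>l. walk E B l s t}" "b \<in> B" "E a b"
    then obtain l where l: "walk E B l s a" by auto
    show "b \<in> {t\<in>B. \<exists>l. walk E B l s t}"
    proof (cases "b \<in> set l")
      case True
      then obtain xs ys where "l = xs @ b # ys" by (meson split_list)
      then have "walk E B (xs @ [b]) s b" using l walk_split(1) by metis
      then show ?thesis using \<open>b \<in> B\<close> by auto
    next
      case False
      then have "walk E B (l @ [b]) s b" using l \<open>b \<in> B\<close> \<open>E a b\<close>
        by (auto simp: walk_def successively_append_iff)
      then show ?thesis using \<open>b \<in> B\<close> by auto
    qed
  qed auto
  then show ?thesis using st by auto
qed

lemma walk_rev:
  assumes "\<And>a b. E a b \<Longrightarrow> E b a" and l: "walk E B l s t"
  shows "walk E B (rev l) t s"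
proof -
  have "successively (\<lambda>a b. E b a) l"
    by (rule successively_mono[of E l]) (use l assms(1) in \<open>auto simp: walk_def\<close>)
  then show ?thesis using l by (auto simp: walk_def hd_rev last_rev)
qed

text \<open>Join \<open>a 0\<close> to \<open>a 1\<close> by a path and follow a path from
  \<open>a 2\<close> until it first meets the former; the meeting point \<open>z\<close> is the
  centre.\<close>

lemma conn_tripod:
  fixes a :: "nat \<Rightarrow> 'a"
  assumes sym: "\<And>a b. E a b \<Longrightarrow> E b a" and B: "conn E B" and a: "\<And>j. j < 3 \<Longrightarrow> a j \<in> B"
  shows "\<exists>z L. (\<forall>j<3. walk E B (L j) z (a j))
    \<and> (\<forall>j<3. \<forall>j'<3. j \<noteq> j' \<longrightarrow> set (L j) \<inter> set (L j') \<subseteq> {z})"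
proof -
  obtain l where l: "walk E B l (a 0) (a (1::nat))" using conn_walk[OF B] a by force
  obtain m where m: "walk E B m (a 2) (a 0)" using conn_walk[OF B] a by force
  have "a 0 \<in> set m" "a 0 \<in> set l"
    using l m hd_in_set[of l] last_in_set[of m] by (auto simp: walk_def)
  then obtain m1 z m2 where m12: "m = m1 @ z # m2" "z \<in> set l" "\<forall>y\<in>set m1. y \<notin> set l"
    using split_list_first_prop[of m "\<lambda>x. x \<in> set l"] by auto
  obtain l1 l2 where l12: "l = l1 @ z # l2" using m12(2) by (meson split_list)
  have w: "walk E B (rev (l1 @ [z])) z (a 0)" "walk E B (z # l2) z (a 1)" "walk E B (rev (m1 @ [z])) z (a 2)"
    using walk_split[OF l[unfolded l12]] walk_split[OF m[unfolded m12(1)]] walk_rev[of E, OF sym] by blast+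
  have dist: "distinct l" using l by (simp add: walk_def)
  define L where "L j = (if j = 0 then rev (l1 @ [z]) else if j = 1 then z # l2 else rev (m1 @ [z]))" for j :: nat
  have "\<forall>j<3. walk E B (L j) z (a j)"
    using w by (auto simp: L_def less_Suc_eq numeral_3_eq_3 numeral_2_eq_2)
  moreover have "set (L j) \<inter> set (L j') \<subseteq> {z}" if "j < 3" "j' < 3" "j \<noteq> j'" for j j'
    using that dist m12(3) unfolding l12 by (auto simp: L_def split: if_splits)
  ultimately show ?thesis by blast
qed

text \<open>A set of three legs in each branch set, joined along the connecting edges, subdivides \<open>K\<^bsub>3,3\<^esub>\<close>.\<close>

lemma K6_minor_imp_K33_walks:
  assumes symE: "symp E" and K6: "complete_minor E 6 V"
  shows "\<exists>(Q :: nat \<Rightarrow> nat \<Rightarrow> 'a list) z y. (\<forall>i<3. \<forall>j<3. walk E V (Q i j) (z i) (y j) \<and> 2 \<le> length (Q i j))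
    \<and> (\<forall>i<3. \<forall>j<3. \<forall>i'<3. \<forall>j'<3. (i,j) \<noteq> (i',j') \<longrightarrow> set (Q i j) \<inter> set (Q i' j')
        \<subseteq> (if i = i' then {z i} else {}) \<union> (if j = j' then {y j} else {}))"
proof -
  have sym: "E a b \<Longrightarrow> E b a" for a b using symE by (rule sympD)
  obtain B :: "nat \<Rightarrow> 'a set" where B0: "\<forall>i<6. conn E (B i) \<and> B i \<subseteq> V"
    and pw0: "\<forall>i<6. \<forall>j<6. i \<noteq> j \<longrightarrow> B i \<inter> B j = {} \<and> (\<exists>a\<in>B i. \<exists>b\<in>B j. E a b)"
    using K6 unfolding complete_minor_def by (elim exE conjE)
  have B: "conn E (B i) \<and> B i \<subseteq> V" if "i < 6" for i using B0 that by simp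
  have pw: "B i \<inter> B j = {} \<and> (\<exists>a\<in>B i. \<exists>b\<in>B j. E a b)" if "i < 6" "j < 6" "i \<noteq> j" for i j
    using pw0 that by simp
  \<comment> \<open>Branch sets 0, 1, 2 form one colour class and 3, 4, 5 the other; adjacencies
    within a class are ignored.\<close>
  have "\<exists>a b. a \<in> B i \<and> b \<in> B (3 + j) \<and> E a b" if "i < 3" "j < 3" for i j
    using pw[of i "3 + j"] that by auto
  then obtain a b where ab: "\<And>i j. i < 3 \<Longrightarrow> j < 3 \<Longrightarrow> a i j \<in> B i \<and> b i j \<in> B (3 + j) \<and> E (a i j) (b i j)"
    by metis
  have "\<exists>z L. (\<forall>j<3. walk E (B i) (L j) z (a i j))
    \<and> (\<forall>j<3. \<forall>j'<3. j \<noteq> j' \<longrightarrow> set (L j) \<inter> set (L j') \<subseteq> {z})" if "i < 3" for i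
    using B[of i] ab that by (intro conn_tripod[of E, OF sym]) auto
  then obtain z L where L: "\<And>i j. i < 3 \<Longrightarrow> j < 3 \<Longrightarrow> walk E (B i) (L i j) (z i) (a i j)"
    and Lz: "\<And>i j j'. i < 3 \<Longrightarrow> j < 3 \<Longrightarrow> j' < 3 \<Longrightarrow> j \<noteq> j' \<Longrightarrow> set (L i j) \<inter> set (L i j') \<subseteq> {z i}"
    by metis
  have "\<exists>y M. (\<forall>i<3. walk E (B (3 + j)) (M i) y (b i j))
    \<and> (\<forall>i<3. \<forall>i'<3. i \<noteq> i' \<longrightarrow> set (M i) \<inter> set (M i') \<subseteq> {y})" if "j < 3" for j
    using B[of "3 + j"] ab that by (intro conn_tripod[of E, OF sym]) auto
  then obtain y M where M: "\<And>i j. i < 3 \<Longrightarrow> j < 3 \<Longrightarrow> walk E (B (3 + j)) (M j i) (y j) (b i j)"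
    and My: "\<And>i i' j. i < 3 \<Longrightarrow> i' < 3 \<Longrightarrow> j < 3 \<Longrightarrow> i \<noteq> i' \<Longrightarrow> set (M j i) \<inter> set (M j i') \<subseteq> {y j}"
    by metis
  define Q where "Q i j = L i j @ rev (M j i)" for i j
  have LB: "set (L i j) \<subseteq> B i" "set (M j i) \<subseteq> B (3 + j)" if "i < 3" "j < 3" for i j
    using L[OF that] M[OF that] by (auto simp: walk_def)
  have LM: "set (L i j) \<inter> set (M j' i') = {}" if "i < 3" "j < 3" "i' < 3" "j' < 3" for i j i' j'
    using LB(1)[OF that(1,2)] LB(2)[OF that(3,4)] pw[of i "3 + j'"] that by auto
  have LL: "set (L i j) \<inter> set (L i' j') = {}" if "i < 3" "j < 3" "i' < 3" "j' < 3" "i \<noteq> i'" for i j i' j'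
    using LB(1)[OF that(1,2)] LB(1)[OF that(3,4)] pw[of i i'] that by auto
  have MM: "set (M j i) \<inter> set (M j' i') = {}" if "i < 3" "j < 3" "i' < 3" "j' < 3" "j \<noteq> j'" for i j i' j'
    using LB(2)[OF that(1,2)] LB(2)[OF that(3,4)] pw[of "3 + j" "3 + j'"] that by auto
  have Qw: "walk E V (Q i j) (z i) (y j) \<and> 2 \<le> length (Q i j)" if "i < 3" "j < 3" for i j
  proof -
    note w1 = L[OF that] and w2 = walk_rev[of E, OF sym M[OF that]]
    have "B i \<subseteq> V" "B (3 + j) \<subseteq> V" using B that by auto
    then have "walk E V (Q i j) (z i) (y j)"
      using w1 w2 ab[OF that] LM[OF that that] unfolding walk_def Q_def
      by (auto simp: successively_append_iff)
    moreover have "length (L i j) \<ge> 1" "length (M j i) \<ge> 1"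
      using w1 M[OF that] by (auto simp: walk_def Suc_le_eq)
    ultimately show ?thesis by (simp add: Q_def)
  qed
  have Qi: "set (Q i j) \<inter> set (Q i' j') \<subseteq> (if i = i' then {z i} else {}) \<union> (if j = j' then {y j} else {})"
    if "i < 3" "j < 3" "i' < 3" "j' < 3" "(i,j) \<noteq> (i',j')" for i j i' j'
  proof -
    have 1: "set (L i j) \<inter> set (L i' j') \<subseteq> (if i = i' then {z i} else {})"
      using LL[of i j i' j'] Lz[of i j j'] that by auto
    have 2: "set (M j i) \<inter> set (M j' i') \<subseteq> (if j = j' then {y j} else {})"
      using MM[of i j i' j'] My[of i i' j] that by auto
    show ?thesis
      using 1 2 LM[OF that(1,2,3,4)] LM[OF that(3,4,1,2)] unfolding Q_def set_append set_rev by blast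
  qed
  show ?thesis
    by (intro exI[of _ Q] exI[of _ z] exI[of _ y] conjI allI impI Qi; (rule Qw[THEN conjunct1] Qw[THEN conjunct2])?; assumption)
qed

section \<open>Drawing paths of a planar graph as arcs\<close>

text \<open>Every edge has a curve in each orientation, so that a path can traverse it either way;
  crossings are therefore restricted only for distinct unordered edges.\<close>

locale planar_drawing =
  fixes E :: "'a \<Rightarrow> 'a \<Rightarrow> bool" and V :: "'a set" and f :: "'a \<Rightarrow> complex" and g :: "'a \<Rightarrow> 'a \<Rightarrow> real \<Rightarrow> complex"
  assumes EV: "\<And>u v. E u v \<Longrightarrow> u \<in> V \<and> v \<in> V \<and> u \<noteq> v"
    and g: "\<And>u v. E u v \<Longrightarrow> arc (g u v) \<and> pathstart (g u v) = f u \<and> pathfinish (g u v) = f v"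
    and cross: "\<And>u v u' v'. E u v \<Longrightarrow> E u' v' \<Longrightarrow> {u,v} \<noteq> {u',v'} \<Longrightarrow>
      path_image (g u v) \<inter> path_image (g u' v') \<subseteq> f ` ({u,v} \<inter> {u',v'})"
begin

fun draw :: "'a list \<Rightarrow> real \<Rightarrow> complex" where
  "draw (u # v # w # l) = g u v +++ draw (v # w # l)"
| "draw [u, v] = g u v"
| "draw l = linepath 0 0"

abbreviation edges :: "'a list \<Rightarrow> ('a \<times> 'a) set" where
  "edges l \<equiv> set (zip l (tl l))"

lemma edgesD: "successively E l \<Longrightarrow> (u,v) \<in> edges l \<Longrightarrow> E u v \<and> u \<in> set l \<and> v \<in> set l"
proof (induction l rule: draw.induct)
  case (1 a b c l)
  then show ?case by auto
qed auto

lemma draw_walk: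
  assumes "distinct l" "successively E l" "2 \<le> length l"
  shows "arc (draw l) \<and> pathstart (draw l) = f (hd l) \<and> pathfinish (draw l) = f (last l)
    \<and> path_image (draw l) = (\<Union>(u,v)\<in>edges l. path_image (g u v))"
  using assms
proof (induction l rule: draw.induct)
  case (1 u v w l)
  let ?l = "v # w # l"
  have IH: "arc (draw ?l)" "pathstart (draw ?l) = f v" "pathfinish (draw ?l) = f (last ?l)"
    "path_image (draw ?l) = (\<Union>(u,v)\<in>edges ?l. path_image (g u v))"
    using 1 by auto
  have uv: "E u v" and sl: "successively E ?l" using 1 by auto
  have int: "path_image (g u v) \<inter> path_image (draw ?l) \<subseteq> {f v}"
  proof
    fix x assume x: "x \<in> path_image (g u v) \<inter> path_image (draw ?l)"
    then obtain a b where ab: "(a,b) \<in> edges ?l" "x \<in> path_image (g a b)" unfolding IH(4) by blast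
    have "E a b" "a \<in> set ?l" "b \<in> set ?l" using edgesD[OF sl ab(1)] by auto
    \<comment> \<open>The first vertex does not recur, so the first edge differs from all later ones
      and meets them only at \<open>f v\<close>.\<close>
    then have "u \<notin> {a,b}" using 1(2) by auto
    then have "{u,v} \<noteq> {a,b}" by blast
    then have "x \<in> f ` ({u,v} \<inter> {a,b})" using cross[OF uv \<open>E a b\<close>] x ab by blast
    then show "x \<in> {f v}" using \<open>u \<notin> {a,b}\<close> by auto
  qed
  note guv = g[OF uv]
  have "arc (draw (u # ?l))" using guv IH int by (auto intro!: arc_join)
  moreover have "path_image (draw (u # ?l)) = (\<Union>(u,v)\<in>edges (u # ?l). path_image (g u v))"
    using guv IH by (simp add: path_image_join)
  ultimately show ?case using guv IH by simp
next
  case (2 u v)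
  then show ?case using g by auto
qed auto

text \<open>Two paths with at most one common vertex share no edge, so the crossing condition
  applies to every pair of their edges.\<close>

lemma draw_cross:
  assumes "distinct l" "successively E l" "2 \<le> length l"
    and "distinct l'" "successively E l'" "2 \<le> length l'"
    and sub: "set l \<inter> set l' \<subseteq> {c}"
  shows "path_image (draw l) \<inter> path_image (draw l') \<subseteq> f ` (set l \<inter> set l')"
proof
  fix x assume "x \<in> path_image (draw l) \<inter> path_image (draw l')"
  then obtain a b a' b' where x: "(a,b) \<in> edges l" "x \<in> path_image (g a b)"
      "(a',b') \<in> edges l'" "x \<in> path_image (g a' b')"
    using draw_walk[of l] draw_walk[of l'] assms by blast
  have e: "E a b" "a \<in> set l" "b \<in> set l" "E a' b'" "a' \<in> set l'" "b' \<in> set l'"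
    using edgesD x assms by blast+
  have "{a,b} \<noteq> {a',b'}"
  proof
    assume "{a,b} = {a',b'}"
    then have "{a,b} \<subseteq> set l \<inter> set l'" using e by auto
    then show False using sub EV[OF e(1)] by auto
  qed
  then have "x \<in> f ` ({a,b} \<inter> {a',b'})" using cross[OF e(1,4)] x by blast
  then show "x \<in> f ` (set l \<inter> set l')" using e by auto
qed

lemma no_K6_minor:
  assumes sym: "\<And>a b. E a b \<Longrightarrow> E b a"
  shows "\<not> complete_minor E 6 V"
proof
  assume "complete_minor E 6 V"
  have "symp E" using sym by (rule sympI)
  from K6_minor_imp_K33_walks[OF this \<open>complete_minor E 6 V\<close>] obtain Q :: "nat \<Rightarrow> nat \<Rightarrow> 'a list" and z y where
    Q: "\<forall>i<3. \<forall>j<3. walk E V (Q i j) (z i) (y j) \<and> 2 \<le> length (Q i j)"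
    and Qi: "\<forall>i<3. \<forall>j<3. \<forall>i'<3. \<forall>j'<3. (i,j) \<noteq> (i',j') \<longrightarrow> set (Q i j) \<inter> set (Q i' j')
        \<subseteq> (if i = i' then {z i} else {}) \<union> (if j = j' then {y j} else {})"
    by (elim exE conjE)
  have W: "distinct (Q i j)" "successively E (Q i j)" "2 \<le> length (Q i j)" "hd (Q i j) = z i" "last (Q i j) = y j"
    if "i < 3" "j < 3" for i j using Q[rule_format, OF that] by (auto simp: walk_def)
  have "K33_drawing (\<lambda>i j. draw (Q i j)) (\<lambda>i. f (z i)) (\<lambda>j. f (y j))"
    unfolding K33_drawing_def
  proof (intro conjI allI impI)
    fix i j :: nat assume ij: "i < 3" "j < 3"
    show "arc (draw (Q i j))" "pathstart (draw (Q i j)) = f (z i)" "pathfinish (draw (Q i j)) = f (y j)"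
      using draw_walk[OF W(1-3)[OF ij]] W(4,5)[OF ij] by auto
    fix i' j' assume ij': "i' < (3::nat)" "j' < (3::nat)" "(i,j) \<noteq> (i',j')"
    have sub: "set (Q i j) \<inter> set (Q i' j') \<subseteq> (if i = i' then {z i} else {}) \<union> (if j = j' then {y j} else {})"
      using Qi[rule_format, of i j i' j'] ij ij' by blast
    \<comment> \<open>Distinct index pairs agree in at most one coordinate, so the two paths have at
      most one common vertex.\<close>
    also have "\<dots> \<subseteq> {if i = i' then z i else y j}" using ij'(3) by auto
    finally have "path_image (draw (Q i j)) \<inter> path_image (draw (Q i' j')) \<subseteq> f ` (set (Q i j) \<inter> set (Q i' j'))"
      by (intro draw_cross[OF W(1-3)[OF ij] W(1-3)[OF ij'(1,2)]])
    also have "\<dots> \<subseteq> f ` ((if i = i' then {z i} else {}) \<union> (if j = j' then {y j} else {}))"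
      by (rule image_mono[OF sub])
    also have "\<dots> \<subseteq> (if i = i' then {f (z i)} else {}) \<union> (if j = j' then {f (y j)} else {})" by auto
    finally show "path_image (draw (Q i j)) \<inter> path_image (draw (Q i' j'))
        \<subseteq> (if i = i' then {f (z i)} else {}) \<union> (if j = j' then {f (y j)} else {})" .
  qed
  then show False using no_K33_drawing by blast
qed

end

text \<open>\<open>planar_graph\<close> constrains only the curves for v < w; the opposite
  orientation is drawn by the reversed curve, which has the same image.\<close>

lemma planar_graph_no_K6_minor:
  assumes sg: "simple_graph N E" and pl: "planar_graph N E"
  shows "\<not> complete_minor E 6 {..<N}"
proof -
  obtain f :: "nat \<Rightarrow> complex" and \<gamma> where "inj_on f {..<N}"
    and arcs0: "\<forall>v w. E v w \<and> v < w \<longrightarrow> arc (\<gamma> v w) \<and> pathstart (\<gamma> v w) = f v \<and>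
         pathfinish (\<gamma> v w) = f w \<and> path_image (\<gamma> v w) \<inter> f ` {..<N} = {f v, f w}"
    and cross0: "\<forall>v w v' w'. E v w \<and> v < w \<and> E v' w' \<and> v' < w' \<and> (v, w) \<noteq> (v', w') \<longrightarrow>
         path_image (\<gamma> v w) \<inter> path_image (\<gamma> v' w') \<subseteq> f ` ({v, w} \<inter> {v', w'})"
    using pl unfolding planar_graph_def by (elim exE conjE)
  have arcs: "arc (\<gamma> v w) \<and> pathstart (\<gamma> v w) = f v \<and> pathfinish (\<gamma> v w) = f w" if "E v w" "v < w" for v w
    using arcs0 that by simp
  have cross: "path_image (\<gamma> v w) \<inter> path_image (\<gamma> v' w') \<subseteq> f ` ({v, w} \<inter> {v', w'})"
    if "E v w" "v < w" "E v' w'" "v' < w'" "(v, w) \<noteq> (v', w')" for v w v' w'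
    using cross0[rule_format, of v w v' w'] that by blast
  define g where "g u v = (if u < v then \<gamma> u v else reversepath (\<gamma> v u))" for u v
  have sym: "\<And>u v. E u v \<Longrightarrow> E v u" and EV: "\<And>u v. E u v \<Longrightarrow> u < N \<and> v < N \<and> u \<noteq> v"
    using sg by (auto simp: simple_graph_def)
  have im: "path_image (g u v) = path_image (\<gamma> (min u v) (max u v))" if "E u v" for u v
    using EV[OF that] by (auto simp: g_def min_def max_def)
  interpret planar_drawing E "{..<N}" f g
  proof
    fix u v assume uv: "E u v"
    show "arc (g u v) \<and> pathstart (g u v) = f u \<and> pathfinish (g u v) = f v"
      using arcs[OF uv] arcs[OF sym[OF uv]] EV[OF uv] by (auto simp: g_def arc_reversepath)
    fix u' v' assume uv': "E u' v'" and ne: "{u,v} \<noteq> {u',v'}"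
    have mm: "{min a b, max a b} = {a,b}" for a b :: nat by (auto simp: min_def max_def)
    have E: "E (min u v) (max u v)" "min u v < max u v" "E (min u' v') (max u' v')" "min u' v' < max u' v'"
      using uv uv' sym EV[OF uv] EV[OF uv'] by (auto simp: min_def max_def)
    have "(min u v, max u v) \<noteq> (min u' v', max u' v')" using ne mm by (metis prod.inject)
    from cross[OF E this] show "path_image (g u v) \<inter> path_image (g u' v') \<subseteq> f ` ({u,v} \<inter> {u',v'})"
      by (simp only: mm im[OF uv] im[OF uv'])
  qed (use EV in auto)
  show ?thesis by (rule no_K6_minor[OF sym])
qed

section \<open>The spectral gap of planar graphs\<close>

text \<open>The energy counts the edges leaving \<open>A\<close>. Counting them from their ends in
  \<open>S\<close> lets two sets separated by \<open>S\<close> share the degrees of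
  \<open>S\<close>.\<close>

lemma dirichlet_indicator_cut:
  assumes sg: "simple_graph N E" and S: "S \<subseteq> {..<N}" "S \<inter> A = {}"
    and nbr: "\<And>a b. a \<in> A \<Longrightarrow> E a b \<Longrightarrow> b \<in> A \<union> S"
  shows "dirichlet N E (indicator A) = (\<Sum>v\<in>S. \<Sum>w<N. if E v w \<and> w \<in> A then 1 else 0)"
proof -
  have sym: "E v w \<Longrightarrow> E w v" for v w using sg by (auto simp: simple_graph_def)
  define c :: "nat \<Rightarrow> nat \<Rightarrow> real" where "c v w = (if E v w \<and> v \<notin> A \<and> w \<in> A then 1 else 0)" for v w
  have "2 * dirichlet N E (indicator A) = (\<Sum>v<N. \<Sum>w<N. if E v w then (indicator A v - indicator A w)\<^sup>2 else 0)"
    unfolding dirichlet_def by (simp add: sum.If_cases Int_def)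
  also have "\<dots> = (\<Sum>v<N. \<Sum>w<N. c v w + c w v)"
    using sym by (intro sum.cong refl) (auto simp: c_def indicator_def)
  also have "\<dots> = (\<Sum>v<N. \<Sum>w<N. c v w) + (\<Sum>v<N. \<Sum>w<N. c w v)"
    by (simp add: sum.distrib)
  also have "(\<Sum>v<N. \<Sum>w<N. c w v) = (\<Sum>v<N. \<Sum>w<N. c v w)" by (rule sum.swap)
  finally have "dirichlet N E (indicator A) = (\<Sum>v<N. \<Sum>w<N. c v w)" by simp
  also have "\<dots> = (\<Sum>v\<in>S. \<Sum>w<N. c v w)"
  proof -
    have "c v w = 0" if "v \<notin> S" for v w
      using nbr[of w v] sym[of v w] that by (auto simp: c_def)
    then show ?thesis using S(1) by (intro sum.mono_neutral_right) auto
  qed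
  also have "\<dots> = (\<Sum>v\<in>S. \<Sum>w<N. if E v w \<and> w \<in> A then 1 else 0)"
    using S by (intro sum.cong refl) (auto simp: c_def)
  finally show ?thesis .
qed

lemma sum_neighbours: "(\<Sum>w<N. if E v w then 1 else (0::real)) = gdeg N E v"
  by (simp add: gdeg_def sum.If_cases Int_def)

context walk_eigenbasis
begin

text \<open>The test function is the indicator minus its mean; the bracket on the left is its
  squared norm.\<close>

lemma spectral_gap_le_cut:
  assumes N: "N \<ge> 2" and A: "A \<subseteq> {..<N}"
  shows "(1 - \<mu> 1) * (card A * (real N - card A) / N) \<le> dirichlet N E (indicator A) / \<delta>"
proof -
  define f where "f v = indicator A v - card A / N" for v :: nat
  have sA: "(\<Sum>v<N. indicator A v) = real (card A)"
    using A by (simp add: sum.inter_restrict[symmetric] indicator_def Int_absorb1 sum.If_cases)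
  have "(\<Sum>v<N. f v) = 0" using N by (simp add: f_def sum_subtractf sA)
  from spectral_gap_upper[OF N this]
  have "(1 - \<mu> 1) * (\<Sum>v<N. (f v)\<^sup>2) \<le> dirichlet N E (indicator A) / \<delta>"
    by (simp add: f_def[abs_def])
  moreover have "(\<Sum>v<N. (f v)\<^sup>2) = card A * (real N - card A) / N"
  proof -
    have "(f v)\<^sup>2 = indicator A v * (1 - 2 * card A / N) + (card A / N)\<^sup>2" for v
      by (simp add: f_def indicator_def power2_eq_square algebra_simps)
    then have "(\<Sum>v<N. (f v)\<^sup>2) = card A * (1 - 2 * card A / N) + N * (card A / N)\<^sup>2"
      by (simp add: sum.distrib sA flip: sum_distrib_right)
    also have "\<dots> = card A * (real N - card A) / N"
      using N by (simp add: power2_eq_square field_simps)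
    finally show ?thesis .
  qed
  ultimately show ?thesis by simp
qed

text \<open>The two sides receive different edges from \<open>S\<close>, at most \<delta> |S| in
  total, so one of them has energy at most \<delta> |S| / 2. Its squared norm after centring is at
  least 4 N / 25, whence (|S| / 2) / (4 N / 25) = 25 |S| / (8 N).\<close>

lemma spectral_gap_le_separator:
  assumes N: "N \<ge> 2" and S: "S \<subseteq> {..<N}" and A: "A \<subseteq> {..<N} - S"
    and bal: "N \<le> 5 * card A" "N \<le> 5 * card ({..<N} - S - A)"
    and sep: "\<And>a b. a \<in> A \<Longrightarrow> b \<in> {..<N} - S - A \<Longrightarrow> \<not> E a b"
  shows "1 - \<mu> 1 \<le> 25 * card S / (8 * N)"
proof -
  let ?B = "{..<N} - S - A"
  have EN: "b < N" "E b a" if "E a b" for a b using sg that by (auto simp: simple_graph_def)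
  have dA: "dirichlet N E (indicator A) = (\<Sum>v\<in>S. \<Sum>w<N. if E v w \<and> w \<in> A then 1 else 0)"
  proof (rule dirichlet_indicator_cut[OF sg S])
    show "S \<inter> A = {}" using A by auto
    fix a b assume "a \<in> A" "E a b"
    then show "b \<in> A \<union> S" using sep[of a b] EN(1)[of a b] by auto
  qed
  have dB: "dirichlet N E (indicator ?B) = (\<Sum>v\<in>S. \<Sum>w<N. if E v w \<and> w \<in> ?B then 1 else 0)"
  proof (rule dirichlet_indicator_cut[OF sg S])
    fix a b assume "a \<in> ?B" "E a b"
    then show "b \<in> ?B \<union> S" using sep[of b a] EN[of a b] by auto
  qed auto
  have "dirichlet N E (indicator A) + dirichlet N E (indicator ?B)
      = (\<Sum>v\<in>S. \<Sum>w<N. (if E v w \<and> w \<in> A then 1 else 0) + (if E v w \<and> w \<in> ?B then 1 else 0))"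
    unfolding dA dB by (simp add: sum.distrib)
  also have "\<dots> \<le> (\<Sum>v\<in>S. \<Sum>w<N. if E v w then 1 else 0)"
    by (intro sum_mono) auto
  also have "\<dots> \<le> (\<Sum>v\<in>S. \<delta>)"
    unfolding sum_neighbours
  proof (rule sum_mono)
    fix v assume "v \<in> S"
    then have "v < N" using S by auto
    then show "real (gdeg N E v) \<le> \<delta>" using gdeg_le_max_deg[of v N E] by simp
  qed
  finally have dAB: "dirichlet N E (indicator A) + dirichlet N E (indicator ?B) \<le> card S * \<delta>" by simp
  have cAB: "card A + card ?B \<le> N"
  proof -
    have "card A + card ?B = card (A \<union> ?B)"
      using A finite_subset[of A "{..<N}"] by (intro card_Un_disjoint[symmetric]) auto
    also have "\<dots> \<le> card {..<N}" using A by (intro card_mono) auto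
    finally show ?thesis by simp
  qed
  have key: ?thesis if C: "C \<subseteq> {..<N}" "N \<le> 5 * card C" "5 * card C \<le> 4 * N"
    and dC: "dirichlet N E (indicator C) \<le> card S * \<delta> / 2" for C
  proof -
    \<comment> \<open>x (N - x) is concave, and on the interval from N/5 to 4N/5 it is smallest at
      the ends, with value 4 N^2 / 25.\<close>
    have "(5 * real (card C) - real N) * (4 * real N - 5 * real (card C)) \<ge> 0"
      using C(2,3) by (intro mult_nonneg_nonneg) linarith+
    then have "4 * real N * real N \<le> 25 * (real (card C) * (real N - card C))" by (simp add: algebra_simps)
    then have m: "4 * real N / 25 \<le> card C * (real N - card C) / N"
      using N by (simp add: field_simps)
    have "(1 - \<mu> 1) * (4 * real N / 25) \<le> (1 - \<mu> 1) * (card C * (real N - card C) / N)"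
      using eigs_le_1[of 1] N by (intro mult_left_mono m) auto
    also have "\<dots> \<le> dirichlet N E (indicator C) / \<delta>" by (rule spectral_gap_le_cut[OF N C(1)])
    also have "\<dots> \<le> (card S * \<delta> / 2) / \<delta>" by (intro divide_right_mono dC) simp
    also have "\<dots> = card S / 2" using dpos by simp
    finally show ?thesis using N by (simp add: field_simps)
  qed
  have or: "dirichlet N E (indicator A) \<le> card S * \<delta> / 2 \<or> dirichlet N E (indicator ?B) \<le> card S * \<delta> / 2"
    using dAB by linarith
  show ?thesis
  proof (rule disjE[OF or])
    assume "dirichlet N E (indicator A) \<le> card S * \<delta> / 2"
    then show ?thesis using A bal cAB by (intro key[of A]) auto
  next
    assume "dirichlet N E (indicator ?B) \<le> card S * \<delta> / 2"
    then show ?thesis using bal cAB by (intro key[of ?B]) auto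
  qed
qed

text \<open>The test function is 1 at \<open>u'\<close> and -1 at \<open>v'\<close>, of squared norm
  2. Without an edge between them its energy is the sum of the two degrees.\<close>

lemma spectral_gap_le_pair:
  assumes uv: "u' < N" "v' < N" "u' \<noteq> v'"
    and C: "C = (if E u' v' then 2 else 1)"
  shows "1 - \<mu> 1 \<le> C"
proof -
  have N: "N \<ge> 2" using uv by auto
  define f :: "nat \<Rightarrow> real" where "f x = (if x = u' then 1 else if x = v' then - 1 else 0)" for x
  define p :: "nat \<Rightarrow> real" where "p x = (if x = u' \<or> x = v' then 1 else 0)" for x
  have EE: "E x y \<Longrightarrow> E y x" "\<not> E x x" for x y using sg by (auto simp: simple_graph_def)
  have sums: "(\<Sum>x<N. f x * h x) = h u' - h v'" "(\<Sum>x<N. p x * h x) = h u' + h v'" for h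
  proof -
    have 1: "(\<Sum>x<N. f x * h x) = (\<Sum>x\<in>{u',v'}. f x * h x)"
      by (rule sum.mono_neutral_right) (use uv in \<open>auto simp: f_def\<close>)
    have 2: "(\<Sum>x<N. p x * h x) = (\<Sum>x\<in>{u',v'}. p x * h x)"
      by (rule sum.mono_neutral_right) (use uv in \<open>auto simp: p_def\<close>)
    show "(\<Sum>x<N. f x * h x) = h u' - h v'" unfolding 1 using uv by (simp add: f_def)
    show "(\<Sum>x<N. p x * h x) = h u' + h v'" unfolding 2 using uv by (simp add: p_def)
  qed
  have "(\<Sum>x<N. f x) = 0" using sums(1)[of "\<lambda>_. 1"] by simp
  from spectral_gap_upper[OF N this]
  have gap: "(1 - \<mu> 1) * (\<Sum>x<N. (f x)\<^sup>2) \<le> dirichlet N E f / \<delta>" .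
  have "(\<Sum>x<N. (f x)\<^sup>2) = 2"
    using sums(1)[of f] uv by (simp add: power2_eq_square) (simp add: f_def)
  then have "(1 - \<mu> 1) * 2 \<le> dirichlet N E f / \<delta>" using gap by simp
  also have "dirichlet N E f / \<delta> \<le> C * (2 * \<delta>) / \<delta>"
  proof (rule divide_right_mono)
    show "dirichlet N E f \<le> C * (2 * \<delta>)"
    proof -
      let ?e = "\<lambda>x y. if E x y then 1 else (0::real)"
      have "2 * dirichlet N E f = (\<Sum>x<N. \<Sum>y<N. ?e x y * (f x - f y)\<^sup>2)"
        unfolding dirichlet_def by (simp add: if_distrib[of "\<lambda>x. x * _"] sum.If_cases Int_def cong: if_cong)
      \<comment> \<open>An edge with one end in the pair contributes 1 on both sides before scaling;
        the edge joining the pair contributes 4 against 2, which forces C = 2 in the adjacent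
        case.\<close>
      also have "\<dots> \<le> (\<Sum>x<N. \<Sum>y<N. C * (p x * ?e x y + p y * ?e x y))"
        using EE uv by (intro sum_mono) (auto simp: C f_def p_def)
      also have "\<dots> = C * ((\<Sum>x<N. \<Sum>y<N. p x * ?e x y) + (\<Sum>x<N. \<Sum>y<N. p y * ?e x y))"
        by (simp only: sum_distrib_left sum.distrib distrib_left)
      also have "(\<Sum>x<N. \<Sum>y<N. p y * ?e x y) = (\<Sum>y<N. \<Sum>x<N. p y * ?e y x)"
        using EE by (subst sum.swap) (intro sum.cong refl, auto)
      also have "(\<Sum>x<N. \<Sum>y<N. p x * ?e x y) = (\<Sum>x<N. p x * gdeg N E x)"
        by (simp only: sum_distrib_left[symmetric] sum_neighbours)
      also have "\<dots> = gdeg N E u' + gdeg N E v'" using sums(2)[of "\<lambda>x. gdeg N E x"] by simp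
      also have "\<dots> \<le> \<delta> + \<delta>"
        using gdeg_le_max_deg[OF uv(1), of E] gdeg_le_max_deg[OF uv(2), of E] by simp
      finally show ?thesis using C by (simp add: mult_left_mono split: if_splits)
    qed
  qed simp
  finally show ?thesis using dpos by simp
qed

text \<open>Since 288 = (12 sqrt 2)^2, the claimed bound is at least 1 as long as N <= 288
  \<delta>^2, and a non-adjacent pair settles this range. A complete graph has \<delta> >= N - 1,
  which makes the bound exceed 2. Otherwise \<delta> >= 2 yields N > 1152 > 33^2, large enough for
  the rounding terms of the separator to be absorbed.\<close>

lemma spectral_gap_planar:
  assumes cg: "connected_graph N E" and pl: "planar_graph N E" and N: "N > 288"
  shows "1 - \<mu> 1 \<le> 12 * sqrt 2 * \<delta> / sqrt N"
proof -
  have d: "\<delta> \<ge> 2" using max_deg_ge_2[OF sg cg] N by simp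
  define s where "s = sqrt N"
  have s: "s > 0" "s * s = N" using N by (auto simp: s_def)
  have r2: "sqrt 2 \<ge> 7 / 5" by (rule real_le_rsqrt) (simp add: power2_eq_square)
  consider (small) "real N \<le> 288 * \<delta>\<^sup>2" "\<exists>u v. u < N \<and> v < N \<and> u \<noteq> v \<and> \<not> E u v"
    | (complete) "\<forall>u v. u < N \<and> v < N \<and> u \<noteq> v \<longrightarrow> E u v" | (large) "real N > 288 * \<delta>\<^sup>2"
    by fastforce
  then have "1 - \<mu> 1 \<le> 12 * sqrt 2 * \<delta> / s"
  proof cases
    case small
    then obtain u v where uv: "u < N" "v < N" "u \<noteq> v" "\<not> E u v" by auto
    then have "1 - \<mu> 1 \<le> 1" using spectral_gap_le_pair[of u v 1] by simp
    also have "s \<le> 12 * sqrt 2 * \<delta>"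
      unfolding s_def using small(1) d by (intro real_le_lsqrt) (auto simp: power_mult_distrib)
    then have "1 \<le> 12 * sqrt 2 * \<delta> / s" using s by simp
    finally show ?thesis .
  next
    case complete
    have "1 - \<mu> 1 \<le> 2" using spectral_gap_le_pair[of 0 1 2] complete N by simp
    also have "2 \<le> 12 * sqrt 2 * \<delta> / s"
    proof -
      have "{w. w < N \<and> E 0 w} \<supseteq> {1..<N}" using complete N by auto
      then have "card {1..<N} \<le> gdeg N E 0" unfolding gdeg_def by (intro card_mono) auto
      also have "\<dots> \<le> max_deg N E" using N by (intro gdeg_le_max_deg) auto
      finally have "real N - 1 \<le> \<delta>" by simp
      then have "real N \<le> 2 * \<delta>" using N by linarith
      moreover have "s \<le> real N" using N by (simp add: s_def real_le_lsqrt power2_eq_square)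
      moreover have "12 * \<delta> \<le> 12 * sqrt 2 * \<delta>" using d r2 by simp
      ultimately have "2 * s \<le> 12 * sqrt 2 * \<delta>" using d by linarith
      then show ?thesis using s by (simp add: field_simps)
    qed
    finally show ?thesis .
  next
    case large
    have "\<delta>\<^sup>2 \<ge> 4" using d power_mono[of 2 \<delta> 2] by simp
    then have "real N \<ge> 33\<^sup>2" using large by simp
    then have s33: "s \<ge> 33" unfolding s_def by (rule real_le_rsqrt)
    \<comment> \<open>The least integer with r >= sqrt (3 N), as the separator theorem asks for 3 N
      <= r^2.\<close>
    define r where "r = nat \<lceil>sqrt 3 * s\<rceil>"
    have r: "real r \<ge> sqrt 3 * s" "real r \<le> sqrt 3 * s + 1"
      using s unfolding r_def by (auto simp: of_nat_ceiling)
    have r3: "sqrt 3 \<le> 7 / 4" by (rule real_le_lsqrt) (auto simp: power2_eq_square)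
    have rs: "real r \<le> 7 / 4 * s + 1" using r(2) mult_right_mono[OF r3, of s] s by linarith
    have r1: "r \<ge> 1" using r(1) s by (cases "r = 0") (auto simp: mult_le_0_iff)
    have "(sqrt 3 * s) * (sqrt 3 * s) \<le> real r * real r" using r(1) s by (intro mult_mono) auto
    then have "real (3 * card {..<N}) \<le> real (r * r)" using s(2) by (simp add: algebra_simps)
    then have rr: "3 * card {..<N} \<le> r * r" by (simp only: of_nat_le_iff)
    have sym: "\<And>a b. E a b \<Longrightarrow> E b a" using sg by (auto simp: simple_graph_def)
    have K6: "\<not> complete_minor E 6 {..<N}" by (rule planar_graph_no_K6_minor[OF sg pl])
    obtain S where S: "S \<subseteq> {..<N}" "card S \<le> 5 * r"
      "\<forall>v\<in>{..<N}-S. 2 * card (component E ({..<N} - S) v) \<le> card {..<N}"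
      using complete_minor_free_separator[of E "{..<N}" r] sym K6 r1 rr by auto
    have cS: "real (card S) \<le> 35 / 4 * s + 5" using S(2) rs by linarith
    have "33 * s \<le> real N" using s33 s mult_right_mono[of 33 s s] by simp
    then have "10 * card S \<le> 3 * card {..<N}" using cS s33 by simp
    then obtain A where A: "A \<subseteq> {..<N} - S" "card {..<N} \<le> 5 * card A" "card {..<N} \<le> 5 * card ({..<N} - S - A)"
      "\<forall>a\<in>A. \<forall>b\<in>{..<N}-S-A. \<not> E a b"
      using balanced_separation[of E "{..<N}" S] sym S by auto
    have "1 - \<mu> 1 \<le> 25 * card S / (8 * N)"
      by (rule spectral_gap_le_separator[OF _ S(1) A(1)]) (use A N in auto)
    also have "\<dots> \<le> 25 * (35 / 4 * s + 5) / (8 * (s * s))"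
      unfolding s(2) of_nat_mult of_nat_numeral using cS by (intro divide_right_mono mult_left_mono) auto
    \<comment> \<open>24 * 7/5 is a lower bound for 12 sqrt 2 \<delta>, from sqrt 2 >= 7/5 and
      \<delta> >= 2; the leading coefficient on the left is below 27.4.\<close>
    also have "\<dots> \<le> 24 * (7 / 5) * s / (s * s)"
    proof -
      have "25 * (35 / 4 * s + 5) / 8 \<le> 24 * (7 / 5) * s" using s33 by simp
      then have "25 * (35 / 4 * s + 5) / 8 / (s * s) \<le> 24 * (7 / 5) * s / (s * s)"
        by (rule divide_right_mono) simp
      then show ?thesis by simp
    qed
    also have "\<dots> = 12 * (7 / 5) * 2 / s" using s(1) by simp
    also have "\<dots> \<le> 12 * sqrt 2 * \<delta> / s"
      using d r2 s by (intro divide_right_mono mult_mono) auto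
    finally show ?thesis .
  qed
  then show ?thesis by (simp add: s_def)
qed

text \<open>All terms of the trace are positive, and only those of the two largest eigenvalues are
  kept.\<close>

lemma return_prob_lower:
  assumes N: "N \<ge> 2" and t: "t > 0" and gap: "1 - \<mu> 1 \<le> K"
  shows "1 / real N + exp (- t * K) / N \<le> return_prob N E t"
proof -
  let ?e = "\<lambda>a. exp (- t * (1 - \<mu> a))"
  have "?e 0 = 1" using eigs_0 N by simp
  moreover have "exp (- t * K) \<le> ?e 1" using gap t by simp
  ultimately have "1 + exp (- t * K) \<le> ?e 0 + ?e 1" by linarith
  also have "\<dots> = (\<Sum>a\<in>{0,1}. ?e a)" by simp
  also have "\<dots> \<le> (\<Sum>a<N. ?e a)" using N by (intro sum_mono2) auto
  finally have "1 + exp (- t * K) \<le> (\<Sum>a<N. ?e a)" .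
  then have "(1 + exp (- t * K)) / N \<le> (\<Sum>a<N. ?e a) / N" by (rule divide_right_mono) simp
  then show ?thesis by (simp add: return_prob_eq add_divide_distrib)
qed

end

theorem theorem1:
  fixes N :: nat and E :: "nat \<Rightarrow> nat \<Rightarrow> bool" and k :: nat and t :: real
  assumes "simple_graph N E" and "connected_graph N E"
    and "1 \<le> k" and "k \<le> N - 2"
    and "t > 0"
  defines "\<delta> \<equiv> real (max_deg N E)"
  shows "return_prob N E t \<le> 1 / real N + \<delta> * (real k / real N) * exp (- t * (1 - beta N E 2))
           + sqrt (pi / 32) * (\<delta> * sqrt (\<delta> + 2) / sqrt t)
             * exp (- (32 * t * real k ^ 2) / ((\<delta> + 2) * \<delta> ^ 2 * real N ^ 2))
       \<and> return_prob N E t \<le> 1 / real N + \<delta> * (real k / real N) * exp (- t * (1 - beta N E 2))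
           + (\<delta> ^ 2 * (\<delta> + 2) / (16 * t)) * (real N / real k)
             * exp (- (32 * t * real k ^ 2) / ((\<delta> + 2) * \<delta> ^ 2 * real N ^ 2))
       \<and> (planar_graph N E \<and> N > 288 \<longrightarrow>
           return_prob N E t \<ge> 1 / real N + exp (- t * (12 * sqrt 2 * \<delta>) / sqrt (real N)) / real N)"
proof -
  \<comment> \<open>Subtraction is truncated, so \<open>1 \<le> k\<close> and
    \<open>k \<le> N - 2\<close> exclude N <= 2.\<close>
  have N: "N \<ge> 3" using assms(3,4) by linarith
  have d: "max_deg N E > 0" using max_deg_ge_2[OF assms(1,2) N] by simp
  obtain u where "walk_eigenbasis N E u" using walk_eigenbasis_exists[OF assms(1) d] .
  then interpret walk_eigenbasis N E u .
  \<comment> \<open>\<open>beta\<close> counts eigenvalues from 1, the list from 0.\<close>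
  have b: "beta N E 2 = eigs_desc (delayed_P N E) ! 1" by (simp add: beta_def)
  have "1 / real N + exp (- t * (12 * sqrt 2 * \<delta>) / sqrt (real N)) / real N \<le> return_prob N E t"
    if "planar_graph N E" "N > 288"
    using return_prob_lower[OF _ assms(5) spectral_gap_planar[OF assms(2) that]] N
    by (simp add: \<delta>_def)
  then show ?thesis
    using return_prob_upper[OF assms(2) N assms(5,3)] unfolding b \<delta>_def by blast
qed

end
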